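(* Assume $\lim_{n\to\infty} N/n = c\in(0,\infty)$ and $$\sum_{n\ge 1} (\log n)^{3\alpha/2}\, n^{-1/2}\,\beta_n<\infty\quad\text{for some }\alpha>1 .$$ Then for every $z\in\mathbb C^+$, $$S_{\mathbf B_n}(z)-\mathbb E\big(S_{\mathbf B_n}(z)\big)\longrightarrow 0 \quad\text{almost surely as } n\to\infty .$$
   Context: Let $(\varepsilon_i)_{i\in\mathbb Z}$ be a strictly stationary sequence of real random variables. For two $\sigma$-algebras $\mathcal A,\mathcal B$, define $$\beta(\mathcal A,\mathcal B)=\tfrac12\sup\sum_{i\in I}\sum_{j\in J}\big|\mathbb P(A_i\cap B_j)-\mathbb P(A_i)\mathbb P(B_j)\big|,$$ where the supremum is over all finite partitions $(A_i)_{i\in I}$ of $\Omega$ into $\mathcal A$-measurable sets and $(B_j)_{j\in J}$ into $\mathcal B$-measurable sets. The $\beta$-mixing coefficients of $(\varepsilon_i)$ are $\beta_0=1$ and, for $n\ge1$, $$\beta_n=\sup_{k\in\mathbb Z}\beta\big(\sigma(\varepsilon_\ell,\ \ell\le k),\ \sigma(\varepsilon_{\ell+n},\ \ell\ge k)\big).$$ Let $g:\mathbb R^{\mathbb Z}\to\mathbb R$ be measurable, and set $X_k=g(\ldots,\varepsilon_{k-1},\varepsilon_k,\varepsilon_{k+1},\ldots)$ for $k\in\mathbb Z$. Assume $\mathbb E X_k=0$ and $\mathbb E X_k^2<\infty$. Let $N=N(n)$ be a sequence of positive integers. Let $\mathcal X_n$ be the $N\times n$ matrix with $(i,j)$ entry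 $X_{(j-1)N+i}$, and let $\mathbf B_n=\frac1n\mathcal X_n\mathcal X_n^T$. For an $N\times N$ real symmetric matrix $A$ and $z\in\mathbb C^+=\{z:\operatorname{Im}z>0\}$, the Stieltjes transform of its empirical spectral measure is $S_A(z)=\frac1N\operatorname{Tr}(A-zI)^{-1}$. *)

theory Defs
  imports "HOL-Probability.Probability" "Jordan_Normal_Form.Gauss_Jordan_Elimination"
begin

definition finite_partition_in :: "'a measure \<Rightarrow> 'a set set \<Rightarrow> 'a set set \<Rightarrow> bool" where
  "finite_partition_in M A P \<longleftrightarrow> finite P \<and> P \<subseteq> A \<and> \<Union>P = space M \<and>
     (\<forall>X\<in>P. \<forall>Y\<in>P. X \<noteq> Y \<longrightarrow> X \<inter> Y = {})"

definition beta_coeff :: "'a measure \<Rightarrow> 'a set set \<Rightarrow> 'a set set \<Rightarrow> real" where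
  "beta_coeff M A B = (1/2) * Sup {(\<Sum>X\<in>P. \<Sum>Y\<in>Q.
        \<bar>measure M (X \<inter> Y) - measure M X * measure M Y\<bar>) | P Q.
        finite_partition_in M A P \<and> finite_partition_in M B Q}"

definition gen_sigma :: "'a measure \<Rightarrow> (int \<Rightarrow> 'a \<Rightarrow> real) \<Rightarrow> int set \<Rightarrow> 'a set set" where
  "gen_sigma M eps L = sigma_sets (space M)
      (\<Union>l\<in>L. {eps l -` S \<inter> space M | S. S \<in> sets borel})"

definition beta_mixing :: "'a measure \<Rightarrow> (int \<Rightarrow> 'a \<Rightarrow> real) \<Rightarrow> nat \<Rightarrow> real" where
  "beta_mixing M eps n = (if n = 0 then 1 else
     (SUP k\<in>(UNIV::int set). beta_coeff M (gen_sigma M eps {..k})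
                                   (gen_sigma M eps {k + int n..})))"

definition strictly_stationary :: "'a measure \<Rightarrow> (int \<Rightarrow> 'a \<Rightarrow> real) \<Rightarrow> bool" where
  "strictly_stationary M eps \<longleftrightarrow>
     (\<forall>k::int. distr M (PiM UNIV (\<lambda>_::int. borel)) (\<lambda>\<omega> i. eps (i + k) \<omega>)
             = distr M (PiM UNIV (\<lambda>_::int. borel)) (\<lambda>\<omega> i. eps i \<omega>))"

definition Xproc :: "((int \<Rightarrow> real) \<Rightarrow> real) \<Rightarrow> (int \<Rightarrow> 'a \<Rightarrow> real) \<Rightarrow> int \<Rightarrow> 'a \<Rightarrow> real" where
  "Xproc g eps k \<omega> = g (\<lambda>i. eps (k + i) \<omega>)"

text \<open>The N x n data matrix with (i,j) entry X_{(j-1)N+i} (1-based); here 0-based indices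
  i < N, j < n, so the entry is X_{j N + i + 1}.\<close>
definition data_matrix :: "(int \<Rightarrow> 'a \<Rightarrow> real) \<Rightarrow> nat \<Rightarrow> nat \<Rightarrow> 'a \<Rightarrow> real mat" where
  "data_matrix X N n \<omega> = mat N n (\<lambda>(i, j). X (int (j * N + i + 1)) \<omega>)"

definition B_matrix :: "(int \<Rightarrow> 'a \<Rightarrow> real) \<Rightarrow> nat \<Rightarrow> nat \<Rightarrow> 'a \<Rightarrow> real mat" where
  "B_matrix X N n \<omega> = (1 / real n) \<cdot>\<^sub>m (data_matrix X N n \<omega> * transpose_mat (data_matrix X N n \<omega>))"

definition mat_trace :: "'b::comm_ring_1 mat \<Rightarrow> 'b" where
  "mat_trace A = (\<Sum>i<dim_row A. A $$ (i, i))"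

definition stieltjes :: "real mat \<Rightarrow> complex \<Rightarrow> complex" where
  "stieltjes A z = (let N = dim_row A in
     (1 / of_nat N) * mat_trace (the (mat_inverse
        (map_mat complex_of_real A - z \<cdot>\<^sub>m 1\<^sub>m N))))"

end

theory Submission
  imports Defs "Jordan_Normal_Form.Determinant" "HOL-Real_Asymp.Real_Asymp"
begin

text \<open>
  By the resolvent identity the Stieltjes transform is Lipschitz in the normalised Frobenius norm of
  the data, so a bounded multiple of \<open>\<theta> avg X\<^sup>2 + \<theta>\<^sup>-\<^sup>1 avg (X - X')\<^sup>2\<close> controls the error of replacing
  \<open>X\<^sub>k\<close> by an \<open>L\<^sup>2\<close>-close function \<open>X'\<^sub>k\<close> of finitely many \<open>\<epsilon>\<^sub>i\<close>; Hopf's maximal inequality makes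
  this error uniformly small in \<open>n\<close>, almost surely, without any ergodicity.

  For such finite-window functions cut the \<open>n\<close> columns into about \<open>A log n\<close> blocks and erase a small
  proportion of columns at the end of each block. Changing one column moves the trace of the resolvent by
  at most \<open>2 / Im z\<close>, so the erasure is harmless and a whole block moves the transform by \<open>O(1 / log n)\<close>.
  Up to a total variation error \<open>log n \<cdot> \<beta>(\<kappa> n\<^sup>2 / log n)\<close> the blocks are independent, and McDiarmid's
  inequality gives a tail \<open>O(n\<^sup>-\<^sup>2)\<close>. The mixing condition says, after grouping the indices between
  consecutive values of \<open>\<kappa> n\<^sup>2 / log n\<close>, that the total variation errors are summable, and the
  Borel--Cantelli lemma concludes.
\<close>

section \<open>Resolvents of Gram matrices\<close>

text \<open>The number of blocks is dictated by McDiarmid: each of \<open>B\<close> blocks moves the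
  transform by a constant times \<open>1 / B\<close>, so a fixed deviation has probability about
  \<open>exp (- const * B)\<close>, and a tail \<open>1 / n^2\<close> needs \<open>B\<close>
  proportional to \<open>ln n\<close>. A fixed fraction of a block is then about
  \<open>n / ln n\<close> columns of \<open>N\<close> entries, with \<open>N\<close> of order
  \<open>n\<close>; this is the gap length. Each \<open>n\<close> has \<open>ln n\<close> gaps, so
  the errors are \<open>ln n\<close> times \<open>\<beta>\<close> at \<open>k = n^2 / ln n\<close>.
  Since \<open>n\<close> is of order \<open>sqrt (k * ln k)\<close>, \<open>dn / dk\<close> is of
  order \<open>sqrt (ln k / k)\<close>, and the series turns into that of
  \<open>(ln k)^(3/2) * k^(-1/2) * \<beta> k\<close>: hence the exponents in the mixing condition.

  Two obstacles shape the rest. The data are unbounded, so bounded differences must not depend on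
  the size of the entries; the rank-one bound has this property. And \<open>g\<close> may read the
  whole path, so no gap separates its columns, while finite-window approximation comes without a
  rate. The approximation is therefore fixed before \<open>n\<close> tends to infinity, and its
  error must be controlled for all \<open>n\<close> at once.\<close>

definition is_resolvent :: "nat \<Rightarrow> (nat \<Rightarrow> nat \<Rightarrow> real) \<Rightarrow> complex \<Rightarrow> (nat \<Rightarrow> nat \<Rightarrow> complex) \<Rightarrow> bool" where
  "is_resolvent N B z G \<longleftrightarrow> (\<forall>i<N. \<forall>k<N.
     (\<Sum>j<N. of_real (B i j) * G j k) - z * G i k = of_bool (i = k) \<and>
     (\<Sum>j<N. G i j * of_real (B j k)) - z * G i k = of_bool (i = k))"

abbreviation cnorm :: "nat \<Rightarrow> (nat \<Rightarrow> complex) \<Rightarrow> real" where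
  "cnorm N u \<equiv> L2_set (\<lambda>i. cmod (u i)) {..<N}"

lemma cmod_sum_mult_le:
  "cmod (\<Sum>i<N. u i * w i) \<le> cnorm N u * cnorm N w"
proof -
  have "cmod (\<Sum>i<N. u i * w i) \<le> (\<Sum>i<N. \<bar>cmod (u i)\<bar> * \<bar>cmod (w i)\<bar>)"
    by (rule order_trans[OF norm_sum]) (simp add: norm_mult)
  also have "\<dots> \<le> cnorm N u * cnorm N w"
    by (rule L2_set_mult_ineq)
  finally show ?thesis .
qed

text \<open>Pair \<open>(B - z) u = w\<close> with the conjugate of \<open>u\<close>. The quadratic
  form of a real symmetric \<open>B\<close> is real, so on the left only \<open>- z\<close> times
  the squared norm has an imaginary part.\<close>

lemma resolvent_energy:
  assumes sym: "\<And>i j. i < N \<Longrightarrow> j < N \<Longrightarrow> B i j = B j i"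
    and eq: "\<And>i. i < N \<Longrightarrow> (\<Sum>j<N. of_real (B i j) * u j) - z * u i = w i"
  shows "Im z * (cnorm N u)\<^sup>2 = - Im (\<Sum>i<N. cnj (u i) * w i)"
proof -
  define Q where "Q = (\<Sum>i<N. \<Sum>j<N. cnj (u i) * (of_real (B i j) * u j))"
  have "cnj Q = (\<Sum>i<N. \<Sum>j<N. u i * (of_real (B i j) * cnj (u j)))"
    by (simp add: Q_def)
  also have "\<dots> = (\<Sum>j<N. \<Sum>i<N. u i * (of_real (B i j) * cnj (u j)))"
    by (rule sum.swap)
  also have "\<dots> = Q"
    unfolding Q_def by (intro sum.cong refl) (use sym in \<open>simp add: mult_ac\<close>)
  finally have "Im Q = 0"
    using complex_cnj_cancel_iff by (metis Reals_cnj_iff complex_is_Real_iff)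
  have "(\<Sum>i<N. cnj (u i) * w i)
      = (\<Sum>i<N. cnj (u i) * ((\<Sum>j<N. of_real (B i j) * u j) - z * u i))"
    by (intro sum.cong refl) (simp add: eq)
  also have "\<dots> = Q - z * (\<Sum>i<N. u i * cnj (u i))"
    by (simp add: Q_def algebra_simps sum_subtractf sum_distrib_left)
  also have "(\<Sum>i<N. u i * cnj (u i)) = of_real ((cnorm N u)\<^sup>2)"
    by (simp add: L2_set_def sum_nonneg complex_norm_square flip: of_real_power)
  finally show ?thesis
    using \<open>Im Q = 0\<close> by simp
qed

text \<open>The operator norm bound \<open>1 / Im z\<close> for the resolvent, from the energy
  identity and Cauchy-Schwarz, without a spectral decomposition.\<close>

lemma resolvent_norm_le:
  assumes "Im z > 0"
    and sym: "\<And>i j. i < N \<Longrightarrow> j < N \<Longrightarrow> B i j = B j i"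
    and eq: "\<And>i. i < N \<Longrightarrow> (\<Sum>j<N. of_real (B i j) * u j) - z * u i = w i"
  shows "cnorm N u \<le> cnorm N w / Im z"
proof -
  have "Im z * (cnorm N u)\<^sup>2 \<le> cmod (\<Sum>i<N. cnj (u i) * w i)"
    using resolvent_energy[OF sym eq] abs_Im_le_cmod[of "\<Sum>i<N. cnj (u i) * w i"] by linarith
  also have "\<dots> \<le> cnorm N u * cnorm N w"
    using cmod_sum_mult_le[of "\<lambda>i. cnj (u i)" w N] by simp
  finally have "cnorm N u * (Im z * cnorm N u) \<le> cnorm N u * cnorm N w"
    by (simp add: power2_eq_square mult_ac)
  then show ?thesis
    using assms(1) L2_set_nonneg[of "\<lambda>i. cmod (u i)" "{..<N}"]
      L2_set_nonneg[of "\<lambda>i. cmod (w i)" "{..<N}"]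
    by (cases "cnorm N u = 0") (auto simp: field_simps)
qed

text \<open>Injectivity of \<open>B - z\<close> is the norm bound for \<open>w = 0\<close>. Below,
  vectors are identified by checking that they solve the same system.\<close>

lemma resolvent_unique:
  fixes N :: nat
  assumes "Im z > 0"
    and sym: "\<And>i j. i < N \<Longrightarrow> j < N \<Longrightarrow> B i j = B j i"
    and eq: "\<And>i. i < N \<Longrightarrow> (\<Sum>j<N. of_real (B i j) * u j) - z * u i = 0"
    and "i < N"
  shows "u i = 0"
proof -
  have "cnorm N u \<le> 0"
    using resolvent_norm_le[OF assms(1) sym eq, simplified] by (simp add: L2_set_def)
  then have "(\<Sum>i<N. (cmod (u i))\<^sup>2) \<le> 0"
    by (simp add: L2_set_def)
  then have "(\<Sum>i<N. (cmod (u i))\<^sup>2) = 0"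
    by (meson order_antisym sum_nonneg zero_le_power2)
  then show ?thesis
    using \<open>i < N\<close> by (simp add: sum_nonneg_eq_0_iff)
qed

lemma resolvent_apply:
  assumes "is_resolvent N B z G" and "i < N"
  shows "(\<Sum>j<N. of_real (B i j) * (\<Sum>k<N. G j k * w k)) - z * (\<Sum>k<N. G i k * w k) = w i"
proof -
  have "(\<Sum>j<N. of_real (B i j) * (\<Sum>k<N. G j k * w k))
      = (\<Sum>k<N. \<Sum>j<N. of_real (B i j) * (G j k * w k))"
    unfolding sum_distrib_left by (rule sum.swap)
  also have "\<dots> - z * (\<Sum>k<N. G i k * w k)
      = (\<Sum>k<N. ((\<Sum>j<N. of_real (B i j) * G j k) - z * G i k) * w k)"
    by (simp add: sum_distrib_left sum_distrib_right sum_subtractf algebra_simps)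
  also have "\<dots> = (\<Sum>k<N. of_bool (i = k) * w k)"
    using assms by (intro sum.cong refl) (simp add: is_resolvent_def)
  also have "\<dots> = w i"
    using \<open>i < N\<close> by simp
  finally show ?thesis .
qed

text \<open>Row \<open>k\<close> and column \<open>k\<close> of \<open>G\<close> solve the same
  linear system because \<open>B\<close> is symmetric. No conjugation appears: \<open>G\<close> is
  complex symmetric.\<close>

lemma resolvent_symmetric:
  assumes "Im z > 0"
    and sym: "\<And>i j. i < N \<Longrightarrow> j < N \<Longrightarrow> B i j = B j i"
    and G: "is_resolvent N B z G" and "i < N" "k < N"
  shows "G i k = G k i"
proof -
  have "G i k - G k i = 0"
  proof (rule resolvent_unique[OF assms(1) sym, where u = "\<lambda>i. G i k - G k i"])
    fix i assume "i < N"
    have "(\<Sum>j<N. of_real (B i j) * G k j) = (\<Sum>j<N. G k j * of_real (B j i))"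
      using sym \<open>i < N\<close> by (intro sum.cong refl) simp
    moreover have "(\<Sum>j<N. of_real (B i j) * G j k) - z * G i k = of_bool (i = k)"
      and "(\<Sum>j<N. G k j * of_real (B j i)) - z * G k i = of_bool (k = i)"
      using G \<open>i < N\<close> \<open>k < N\<close> unfolding is_resolvent_def by blast+
    ultimately have "((\<Sum>j<N. of_real (B i j) * G j k) - (\<Sum>j<N. of_real (B i j) * G k j))
        - z * (G i k - G k i) = 0"
      by (auto simp: algebra_simps)
    then show "(\<Sum>j<N. of_real (B i j) * (G j k - G k j)) - z * (G i k - G k i) = 0"
      by (simp only: right_diff_distrib sum_subtractf)
  qed (use assms in auto)
  then show ?thesis by simp
qed

text \<open>The trace of the resolvent identity \<open>G - G' = G (B' - B) G'\<close>, with
  \<open>B' - B\<close> split into the rank-one matrices made of \<open>p l\<close> and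
  \<open>q l\<close>. Symmetry of \<open>G'\<close> turns the row vector \<open>q l\<close> times
  \<open>G'\<close> into \<open>G'\<close> applied to \<open>q l\<close>.\<close>

lemma resolvent_trace_diff:
  assumes "Im z > 0"
    and sym': "\<And>i j. i < N \<Longrightarrow> j < N \<Longrightarrow> B' i j = B' j i"
    and G: "is_resolvent N B z G" and G': "is_resolvent N B' z G'"
    and D: "\<And>a b. a < N \<Longrightarrow> b < N \<Longrightarrow> of_real (B' a b - B a b) = (\<Sum>l\<in>\<Lambda>. p l a * q l b)"
  shows "(\<Sum>i<N. G i i) - (\<Sum>i<N. G' i i)
       = (\<Sum>l\<in>\<Lambda>. \<Sum>i<N. (\<Sum>a<N. G i a * p l a) * (\<Sum>b<N. G' i b * q l b))"
proof -
  have resolvent_identity: "G i i - G' i i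
      = (\<Sum>a<N. \<Sum>b<N. G i a * of_real (B' a b - B a b) * G' b i)" if i: "i < N" for i
  proof -
    have "G i i = (\<Sum>a<N. G i a * of_bool (a = i))"
      using i by simp
    also have "\<dots> = (\<Sum>a<N. G i a * ((\<Sum>b<N. of_real (B' a b) * G' b i) - z * G' a i))"
      using G' i by (intro sum.cong refl) (simp add: is_resolvent_def)
    finally have 1: "G i i = (\<Sum>a<N. \<Sum>b<N. G i a * of_real (B' a b) * G' b i)
        - z * (\<Sum>a<N. G i a * G' a i)"
      by (simp add: sum_distrib_left sum_subtractf algebra_simps)
    have "G' i i = (\<Sum>b<N. of_bool (i = b) * G' b i)"
      using i by simp
    also have "\<dots> = (\<Sum>b<N. ((\<Sum>a<N. G i a * of_real (B a b)) - z * G i b) * G' b i)"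
      using G i by (intro sum.cong refl) (simp add: is_resolvent_def)
    also have "\<dots> = (\<Sum>b<N. \<Sum>a<N. G i a * of_real (B a b) * G' b i)
        - z * (\<Sum>b<N. G i b * G' b i)"
      by (simp add: sum_distrib_left sum_distrib_right sum_subtractf algebra_simps)
    also have "(\<Sum>b<N. \<Sum>a<N. G i a * of_real (B a b) * G' b i)
        = (\<Sum>a<N. \<Sum>b<N. G i a * of_real (B a b) * G' b i)"
      by (rule sum.swap)
    finally show ?thesis
      unfolding 1 by (simp add: sum_subtractf algebra_simps)
  qed
  have "(\<Sum>i<N. G i i) - (\<Sum>i<N. G' i i)
      = (\<Sum>i<N. \<Sum>a<N. \<Sum>b<N. G i a * of_real (B' a b - B a b) * G' b i)"
    unfolding sum_subtractf[symmetric] by (intro sum.cong refl resolvent_identity) simp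
  also have "\<dots> = (\<Sum>i<N. \<Sum>l\<in>\<Lambda>. (\<Sum>a<N. G i a * p l a) * (\<Sum>b<N. G' i b * q l b))"
  proof (intro sum.cong refl)
    fix i assume "i \<in> {..<N}"
    then have "(\<Sum>a<N. \<Sum>b<N. G i a * of_real (B' a b - B a b) * G' b i)
        = (\<Sum>a<N. \<Sum>b<N. \<Sum>l\<in>\<Lambda>. G i a * p l a * (G' i b * q l b))"
      by (intro sum.cong refl)
        (simp add: D resolvent_symmetric[OF assms(1) sym' G'] sum_distrib_left sum_distrib_right mult_ac
           del: of_real_diff)
    also have "\<dots> = (\<Sum>a<N. \<Sum>l\<in>\<Lambda>. \<Sum>b<N. G i a * p l a * (G' i b * q l b))"
      by (intro sum.cong refl sum.swap)
    also have "\<dots> = (\<Sum>l\<in>\<Lambda>. \<Sum>a<N. \<Sum>b<N. G i a * p l a * (G' i b * q l b))"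
      by (rule sum.swap)
    finally show "(\<Sum>a<N. \<Sum>b<N. G i a * of_real (B' a b - B a b) * G' b i)
        = (\<Sum>l\<in>\<Lambda>. (\<Sum>a<N. G i a * p l a) * (\<Sum>b<N. G' i b * q l b))"
      by (simp add: sum_product)
  qed
  also have "\<dots> = (\<Sum>l\<in>\<Lambda>. \<Sum>i<N. (\<Sum>a<N. G i a * p l a) * (\<Sum>b<N. G' i b * q l b))"
    by (rule sum.swap)
  finally show ?thesis .
qed

lemma resolvent_trace_diff_le:
  assumes z: "Im z > 0"
    and sym: "\<And>i j. i < N \<Longrightarrow> j < N \<Longrightarrow> B i j = B j i"
    and sym': "\<And>i j. i < N \<Longrightarrow> j < N \<Longrightarrow> B' i j = B' j i"
    and G: "is_resolvent N B z G" and G': "is_resolvent N B' z G'"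
    and D: "\<And>a b. a < N \<Longrightarrow> b < N \<Longrightarrow> of_real (B' a b - B a b) = (\<Sum>l\<in>\<Lambda>. p l a * q l b)"
  shows "cmod ((\<Sum>i<N. G i i) - (\<Sum>i<N. G' i i)) \<le> (\<Sum>l\<in>\<Lambda>. cnorm N (p l) * cnorm N (q l)) / (Im z)\<^sup>2"
proof -
  have "cmod (\<Sum>i<N. (\<Sum>a<N. G i a * p l a) * (\<Sum>b<N. G' i b * q l b))
      \<le> cnorm N (p l) * cnorm N (q l) / (Im z)\<^sup>2" for l
  proof -
    have "cmod (\<Sum>i<N. (\<Sum>a<N. G i a * p l a) * (\<Sum>b<N. G' i b * q l b))
        \<le> cnorm N (\<lambda>i. \<Sum>a<N. G i a * p l a) * cnorm N (\<lambda>i. \<Sum>b<N. G' i b * q l b)"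
      by (rule cmod_sum_mult_le)
    also have "\<dots> \<le> (cnorm N (p l) / Im z) * (cnorm N (q l) / Im z)"
      using resolvent_norm_le[OF z sym resolvent_apply[OF G]]
        resolvent_norm_le[OF z sym' resolvent_apply[OF G']]
      by (intro mult_mono L2_set_nonneg divide_nonneg_pos z) auto
    finally show ?thesis by (simp add: power2_eq_square)
  qed
  moreover have "(\<Sum>i<N. G i i) - (\<Sum>i<N. G' i i)
       = (\<Sum>l\<in>\<Lambda>. \<Sum>i<N. (\<Sum>a<N. G i a * p l a) * (\<Sum>b<N. G' i b * q l b))"
    by (rule resolvent_trace_diff[OF z sym' G G' D])
  ultimately show ?thesis
    unfolding sum_divide_distrib by (simp add: sum_norm_le)
qed

text \<open>Sherman-Morrison. With \<open>u = G a\<close> and \<open>s\<close> the bilinear product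
  of \<open>a\<close> and \<open>u\<close>, the trace changes by the bilinear square of
  \<open>u\<close> divided by \<open>1 + s\<close>, while the energy identity gives
  \<open>Im z\<close> times the squared norm of \<open>u\<close> as \<open>Im s\<close>, which is at
  most \<open>|1 + s|\<close>. These cancel, so the bound does not see the size of
  \<open>a\<close>.\<close>

lemma resolvent_rank_one:
  assumes z: "Im z > 0"
    and sym: "\<And>i j. i < N \<Longrightarrow> j < N \<Longrightarrow> B i j = B j i"
    and sym': "\<And>i j. i < N \<Longrightarrow> j < N \<Longrightarrow> B' i j = B' j i"
    and G: "is_resolvent N B z G" and G': "is_resolvent N B' z G'"
    and D: "\<And>i j. i < N \<Longrightarrow> j < N \<Longrightarrow> B' i j = B i j + a i * a j"
  shows "cmod ((\<Sum>i<N. G i i) - (\<Sum>i<N. G' i i)) \<le> 1 / Im z"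
proof -
  define u where "u i = (\<Sum>k<N. G i k * of_real (a k))" for i
  define u' where "u' i = (\<Sum>k<N. G' i k * of_real (a k))" for i
  define s where "s = (\<Sum>i<N. of_real (a i) * u i)"
  define s' where "s' = (\<Sum>i<N. of_real (a i) * u' i)"
  have u: "(\<Sum>j<N. of_real (B i j) * u j) - z * u i = of_real (a i)" if "i < N" for i
    unfolding u_def by (rule resolvent_apply[OF G that])
  have u': "(\<Sum>j<N. of_real (B' i j) * u' j) - z * u' i = of_real (a i)" if "i < N" for i
    unfolding u'_def by (rule resolvent_apply[OF G' that])
  have u'u: "u' i = (1 - s') * u i" if "i < N" for i
  proof -
    \<comment> \<open>Moving the rank-one term to the right gives
      \<open>(B - z) u' = (1 - s') a\<close>, and \<open>(1 - s') u\<close> solves this system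
      too.\<close>
    have "u' i - (1 - s') * u i = 0"
    proof (rule resolvent_unique[OF z sym, where u = "\<lambda>i. u' i - (1 - s') * u i"])
      fix i assume i: "i < N"
      have "(\<Sum>j<N. of_real (B' i j) * u' j) = (\<Sum>j<N. of_real (B i j) * u' j) + of_real (a i) * s'"
        unfolding s'_def sum_distrib_left sum.distrib[symmetric]
        using i by (intro sum.cong refl) (simp add: D algebra_simps)
      with u'[OF i] have 1: "(\<Sum>j<N. of_real (B i j) * u' j) = z * u' i + of_real (a i) - of_real (a i) * s'"
        by (simp add: algebra_simps)
      have 2: "(\<Sum>j<N. of_real (B i j) * u j) = z * u i + of_real (a i)"
        using u[OF i] by (simp add: algebra_simps)
      have "(\<Sum>j<N. of_real (B i j) * (u' j - (1 - s') * u j))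
          = (\<Sum>j<N. of_real (B i j) * u' j) - (1 - s') * (\<Sum>j<N. of_real (B i j) * u j)"
        unfolding sum_distrib_left sum_subtractf[symmetric] by (simp add: algebra_simps)
      then show "(\<Sum>j<N. of_real (B i j) * (u' j - (1 - s') * u j)) - z * (u' i - (1 - s') * u i) = 0"
        unfolding 1 2 by (simp add: algebra_simps)
    qed (use that in auto)
    then show ?thesis by simp
  qed
  have "s' = (\<Sum>i<N. (1 - s') * (of_real (a i) * u i))"
    by (subst s'_def, intro sum.cong refl) (simp add: u'u)
  then have "s' = (1 - s') * s"
    by (simp only: s_def sum_distrib_left)
  \<comment> \<open>So \<open>1 - s'\<close> is the reciprocal of \<open>1 + s\<close>; the product
    form spares a separate proof that \<open>1 + s\<close> is nonzero.\<close>
  then have ss': "(1 - s') * (1 + s) = 1"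
    by (simp add: algebra_simps)
  have "(\<Sum>i<N. G i i) - (\<Sum>i<N. G' i i) = (\<Sum>i<N. u i * u' i)"
    using resolvent_trace_diff[OF z sym' G G', where \<Lambda> = "{()}" and p = "\<lambda>_ i. of_real (a i)" and q = "\<lambda>_ i. of_real (a i)"]
    by (simp add: D u_def u'_def)
  also have "\<dots> = (1 - s') * (\<Sum>i<N. u i * u i)"
    unfolding sum_distrib_left by (intro sum.cong refl) (simp add: u'u)
  finally have "cmod ((\<Sum>i<N. G i i) - (\<Sum>i<N. G' i i)) = cmod (1 - s') * cmod (\<Sum>i<N. u i * u i)"
    by (simp add: norm_mult)
  also have "\<dots> \<le> cmod (1 - s') * (cnorm N u)\<^sup>2"
    using cmod_sum_mult_le[of u u N] by (intro mult_left_mono) (auto simp: power2_eq_square)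
  also have "\<dots> \<le> cmod (1 - s') * (cmod (1 + s) / Im z)"
  proof (intro mult_left_mono)
    have "(\<Sum>i<N. cnj (u i) * of_real (a i)) = cnj s"
      by (simp add: s_def mult_ac)
    then have "Im z * (cnorm N u)\<^sup>2 = - Im (cnj s)"
      using resolvent_energy[OF sym u] by (simp only:)
    also have "\<dots> = Im (1 + s)" by simp
    also have "\<dots> \<le> cmod (1 + s)"
      by (metis abs_Im_le_cmod abs_le_D1)
    finally show "(cnorm N u)\<^sup>2 \<le> cmod (1 + s) / Im z"
      using z by (simp add: field_simps)
  qed auto
  also have "\<dots> = cmod ((1 - s') * (1 + s)) / Im z"
    by (simp add: norm_mult)
  also have "\<dots> = 1 / Im z" by (simp add: ss')
  finally show ?thesis .
qed

text \<open>\<open>mat_inverse\<close> returns an option, so nonsingularity comes first: a nonzero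
  kernel vector of \<open>C\<close> would contradict \<open>resolvent_unique\<close>. The adjugate
  formula for the diagonal is prepared for the measurability proof.\<close>

lemma mat_inverse_resolvent:
  fixes B :: "nat \<Rightarrow> nat \<Rightarrow> real"
  assumes z: "Im z > 0"
    and sym: "\<And>i j. i < N \<Longrightarrow> j < N \<Longrightarrow> B i j = B j i"
  defines "C \<equiv> map_mat complex_of_real (mat N N (\<lambda>(i, j). B i j)) - z \<cdot>\<^sub>m 1\<^sub>m N"
  shows "is_resolvent N B z (\<lambda>i j. the (mat_inverse C) $$ (i, j))"
    and "the (mat_inverse C) \<in> carrier_mat N N"
    and "i < N \<Longrightarrow> the (mat_inverse C) $$ (i, i) = adj_mat C $$ (i, i) / det C"
proof -
  have C: "C \<in> carrier_mat N N" by (auto simp: C_def)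
  have C_ix: "C $$ (i, j) = of_real (B i j) - z * of_bool (i = j)" if "i < N" "j < N" for i j
    using that by (simp add: C_def)
  have split: "(\<Sum>j<N. C $$ (i, j) * u j) = (\<Sum>j<N. of_real (B i j) * u j) - z * u i"
    if "i < N" for i u
  proof -
    have "(\<Sum>j<N. C $$ (i, j) * u j) = (\<Sum>j<N. of_real (B i j) * u j - z * of_bool (i = j) * u j)"
      using that by (intro sum.cong refl) (simp add: C_ix algebra_simps)
    also have "\<dots> = (\<Sum>j<N. of_real (B i j) * u j) - (\<Sum>j<N. z * of_bool (i = j) * u j)"
      by (rule sum_subtractf)
    also have "(\<Sum>j<N. z * of_bool (i = j) * u j) = (\<Sum>j<N. if j = i then z * u j else 0)"
      by (intro sum.cong) auto
    finally show ?thesis using that by (simp add: sum.delta)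
  qed
  have split': "(\<Sum>j<N. u j * C $$ (j, i)) = (\<Sum>j<N. u j * of_real (B j i)) - z * u i"
    if "i < N" for i u
  proof -
    have "(\<Sum>j<N. u j * C $$ (j, i)) = (\<Sum>j<N. C $$ (i, j) * u j)"
      using that by (intro sum.cong refl) (auto simp add: C_ix sym mult_ac)
    also have "\<dots> = (\<Sum>j<N. of_real (B i j) * u j) - z * u i"
      by (rule split[OF that])
    also have "(\<Sum>j<N. of_real (B i j) * u j) = (\<Sum>j<N. u j * of_real (B j i))"
      using that by (intro sum.cong refl) (auto simp add: sym mult_ac)
    finally show ?thesis .
  qed
  have det: "det C \<noteq> 0"
  proof
    assume "det C = 0"
    then obtain v where v: "v \<in> carrier_vec N" "v \<noteq> 0\<^sub>v N" "C *\<^sub>v v = 0\<^sub>v N"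
      using det_0_iff_vec_prod_zero_field[OF C] by auto
    have "v $ i = 0" if "i < N" for i
    proof (rule resolvent_unique[OF z sym, where u = "\<lambda>i. v $ i"])
      fix i assume i: "i < N"
      have "(C *\<^sub>v v) $ i = (\<Sum>j<N. C $$ (i, j) * v $ j)"
        using C v(1) i by (simp add: scalar_prod_def lessThan_atLeast0 row_def)
      then show "(\<Sum>j<N. of_real (B i j) * v $ j) - z * v $ i = 0"
        using v(3) i split[OF i] by simp
    qed (use that in auto)
    then have "v = 0\<^sub>v N" using v(1) by (intro eq_vecI) auto
    with v(2) show False by simp
  qed
  have "mat_inverse C \<noteq> None"
    using mat_inverse(1)[OF C, where b = "()"] det_non_zero_imp_unit[OF C det, where b = "()"] by blast
  then obtain R where R: "mat_inverse C = Some R" by auto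
  note R' = mat_inverse(2)[OF C R]
  then have Rc: "R \<in> carrier_mat N N" and CR: "C * R = 1\<^sub>m N" and RC: "R * C = 1\<^sub>m N" by auto
  show "the (mat_inverse C) \<in> carrier_mat N N" using Rc R by simp
  have 1: "(\<Sum>j<N. C $$ (i, j) * R $$ (j, k)) = of_bool (i = k)" if "i < N" "k < N" for i k
  proof -
    have "(\<Sum>j<N. C $$ (i, j) * R $$ (j, k)) = (C * R) $$ (i, k)"
      using C Rc that by (simp add: scalar_prod_def lessThan_atLeast0 row_def col_def)
    then show ?thesis using that by (simp add: CR)
  qed
  have 2: "(\<Sum>j<N. R $$ (i, j) * C $$ (j, k)) = of_bool (i = k)" if "i < N" "k < N" for i k
  proof -
    have "(\<Sum>j<N. R $$ (i, j) * C $$ (j, k)) = (R * C) $$ (i, k)"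
      using C Rc that by (simp add: scalar_prod_def lessThan_atLeast0 row_def col_def)
    then show ?thesis using that by (simp add: RC)
  qed
  show "is_resolvent N B z (\<lambda>i j. the (mat_inverse C) $$ (i, j))"
    unfolding is_resolvent_def R option.sel
  proof (intro allI impI conjI)
    fix i k assume "i < N" "k < N"
    then show "(\<Sum>j<N. of_real (B i j) * R $$ (j, k)) - z * R $$ (i, k) = of_bool (i = k)"
      using 1[of i k] split[of i "\<lambda>j. R $$ (j, k)"] by simp
    show "(\<Sum>j<N. R $$ (i, j) * of_real (B j k)) - z * R $$ (i, k) = of_bool (i = k)"
      using \<open>i < N\<close> \<open>k < N\<close> 2[of i k] split'[of k "\<lambda>j. R $$ (i, j)"] by simp
  qed
  show "the (mat_inverse C) $$ (i, i) = adj_mat C $$ (i, i) / det C" if "i < N"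
  proof -
    note adj = adj_mat[OF C]
    have "R * (C * adj_mat C) = R * C * adj_mat C"
      using Rc C adj by (intro assoc_mult_mat[symmetric])
    then have "det C \<cdot>\<^sub>m R = adj_mat C"
      using Rc adj by (simp add: RC mult_smult_distrib[OF Rc, of _ N])
    then have "det C * R $$ (i, i) = adj_mat C $$ (i, i)"
      using Rc that by (metis carrier_matD index_smult_mat(1))
    then show ?thesis using det R by (simp add: field_simps)
  qed
qed

section \<open>Stieltjes transforms of Gram matrices and their dependence on the columns\<close>

definition gram :: "nat \<Rightarrow> (nat \<Rightarrow> nat \<Rightarrow> real) \<Rightarrow> nat \<Rightarrow> nat \<Rightarrow> real" where
  "gram n w i j = (1 / real n) * (\<Sum>l<n. w l i * w l j)"

text \<open>In \<open>w l i\<close> the column comes first and the row second, against matrix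
  custom, so that modifying a column means modifying the function \<open>w l\<close>.\<close>

definition gram_stieltjes :: "nat \<Rightarrow> nat \<Rightarrow> complex \<Rightarrow> (nat \<Rightarrow> nat \<Rightarrow> real) \<Rightarrow> complex" where
  "gram_stieltjes N n z w = stieltjes (mat N N (\<lambda>(i, j). gram n w i j)) z"

lemma gram_sym: "gram n w i j = gram n w j i"
  by (simp add: gram_def mult.commute)

lemma stieltjes_B_matrix:
  "stieltjes (B_matrix X N n \<omega>) z = gram_stieltjes N n z (\<lambda>l i. X (int (l * N + i + 1)) \<omega>)"
proof -
  have "B_matrix X N n \<omega> = mat N N (\<lambda>(i, j). gram n (\<lambda>l i. X (int (l * N + i + 1)) \<omega>) i j)"
    by (intro eq_matI)
      (auto simp: B_matrix_def data_matrix_def gram_def scalar_prod_def lessThan_atLeast0)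
  then show ?thesis by (simp add: gram_stieltjes_def)
qed

lemma gram_stieltjes_resolvent:
  assumes "Im z > 0"
  obtains G where "is_resolvent N (gram n w) z G"
    and "gram_stieltjes N n z w = (\<Sum>i<N. G i i) / of_nat N"
proof (rule that)
  let ?C = "map_mat complex_of_real (mat N N (\<lambda>(i, j). gram n w i j)) - z \<cdot>\<^sub>m 1\<^sub>m N"
  let ?G = "\<lambda>i j. the (mat_inverse ?C) $$ (i, j)"
  show "is_resolvent N (gram n w) z ?G"
    by (rule mat_inverse_resolvent(1)[OF assms gram_sym])
  have "dim_row (the (mat_inverse ?C)) = N"
    using mat_inverse_resolvent(2)[OF assms, of N "gram n w"] by (auto simp: gram_sym)
  then show "gram_stieltjes N n z w = (\<Sum>i<N. ?G i i) / of_nat N"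
    by (simp add: gram_stieltjes_def stieltjes_def mat_trace_def)
qed

text \<open>Column \<open>i\<close> of the resolvent solves the system whose right-hand side is the
  \<open>i\<close>-th unit vector, so each diagonal entry obeys the operator norm bound. For
  \<open>N = 0\<close> the transform is 0 by division by zero.\<close>

lemma norm_gram_stieltjes_le:
  assumes z: "Im z > 0"
  shows "cmod (gram_stieltjes N n z w) \<le> 1 / Im z"
proof (cases "N = 0")
  case True
  then show ?thesis using z by (simp add: gram_stieltjes_def stieltjes_def)
next
  case False
  obtain G where G: "is_resolvent N (gram n w) z G"
    and eq: "gram_stieltjes N n z w = (\<Sum>i<N. G i i) / of_nat N"
    using gram_stieltjes_resolvent[OF z] .
  have "cmod (G i i) \<le> 1 / Im z" if i: "i < N" for i
  proof -
    let ?e = "\<lambda>k. of_bool (k = i) :: complex"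
    have "cmod (G i i) \<le> cnorm N (\<lambda>j. G j i)"
      using member_le_L2_set[of "{..<N}" i "\<lambda>j. cmod (G j i)"] i by simp
    also have "\<dots> \<le> cnorm N ?e / Im z"
      using G i unfolding is_resolvent_def
      by (intro resolvent_norm_le[OF z, where B = "gram n w"]) (auto intro: gram_sym)
    also have "cnorm N ?e = 1"
    proof -
      have "(\<Sum>k<N. (cmod (?e k))\<^sup>2) = (\<Sum>k<N. if k = i then 1 else 0)"
        by (intro sum.cong) auto
      then show ?thesis using i by (simp add: L2_set_def)
    qed
    finally show ?thesis .
  qed
  then have "cmod (\<Sum>i<N. G i i) \<le> (\<Sum>i<N. 1 / Im z)"
    by (intro sum_norm_le) auto
  then show ?thesis
    using False by (simp add: eq norm_divide field_simps)
qed

text \<open>Up to \<open>1 / n\<close>, the Gram matrices differ by \<open>(w' - w)\<close> times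
  \<open>w'\<close> transposed plus \<open>w\<close> times \<open>(w' - w)\<close> transposed. These
  are two rank-one terms per column, hence the disjoint sum \<open><+>\<close> as index set. Young's
  inequality with a free \<open>\<theta>\<close> then separates the two squared norms, so that each
  becomes a plain average along the path.\<close>

lemma gram_stieltjes_diff_le:
  assumes z: "Im z > 0" and \<theta>: "\<theta> > 0"
  shows "cmod (gram_stieltjes N n z w - gram_stieltjes N n z w')
    \<le> (\<theta> * (\<Sum>l<n. \<Sum>i<N. (w l i)\<^sup>2) + (1 + 1 / \<theta>) * (\<Sum>l<n. \<Sum>i<N. (w l i - w' l i)\<^sup>2))
        / (real n * real N) / (Im z)\<^sup>2"
proof (cases "N = 0 \<or> n = 0")
  \<comment> \<open>Here the bound is 0 by division by zero, and the two transforms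
    coincide.\<close>
  case True
  then show ?thesis by (auto simp: gram_stieltjes_def stieltjes_def gram_def)
next
  case False
  then have N: "N > 0" and n: "n > 0" by auto
  obtain G where G: "is_resolvent N (gram n w) z G"
    and eq: "gram_stieltjes N n z w = (\<Sum>i<N. G i i) / of_nat N"
    using gram_stieltjes_resolvent[OF z] .
  obtain G' where G': "is_resolvent N (gram n w') z G'"
    and eq': "gram_stieltjes N n z w' = (\<Sum>i<N. G' i i) / of_nat N"
    using gram_stieltjes_resolvent[OF z] .
  define d where "d l i = complex_of_real (w' l i - w l i)" for l i
  define p where "p = case_sum d (\<lambda>l i. complex_of_real (w l i))"
  define q where "q = case_sum (\<lambda>l i. complex_of_real (w' l i / real n)) (\<lambda>l i. d l i / of_nat n)"
  define a where "a l = cnorm N (\<lambda>i. complex_of_real (w l i))" for l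
  define b where "b l = cnorm N (d l)" for l
  have ab: "a l \<ge> 0" "b l \<ge> 0" for l by (simp_all add: a_def b_def L2_set_nonneg)
  have "cmod ((\<Sum>i<N. G i i) - (\<Sum>i<N. G' i i))
      \<le> (\<Sum>l\<in>{..<n} <+> {..<n}. cnorm N (p l) * cnorm N (q l)) / (Im z)\<^sup>2"
  proof (rule resolvent_trace_diff_le[OF z gram_sym gram_sym G G'])
    fix i j :: nat
    have "gram n w' i j - gram n w i j
        = (\<Sum>l<n. (w' l i - w l i) * (w' l j / real n)) + (\<Sum>l<n. w l i * ((w' l j - w l j) / real n))"
      unfolding gram_def sum_distrib_left sum.distrib[symmetric] sum_subtractf[symmetric]
      by (intro sum.cong refl) (use n in \<open>simp add: field_simps\<close>)
    then show "of_real (gram n w' i j - gram n w i j) = (\<Sum>l\<in>{..<n} <+> {..<n}. p l i * q l j)"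
      by (simp add: sum.Plus p_def q_def d_def)
  qed
  also have "(\<Sum>l\<in>{..<n} <+> {..<n}. cnorm N (p l) * cnorm N (q l))
      = (\<Sum>l<n. (b l * cnorm N (\<lambda>i. complex_of_real (w' l i)) + a l * b l) / real n)"
  proof -
    have "cnorm N (\<lambda>i. u i / of_nat n) = cnorm N u / real n" for u
      by (simp add: norm_divide L2_set_def power_divide real_sqrt_divide flip: sum_divide_distrib)
    then show ?thesis
      by (simp add: sum.Plus p_def q_def a_def b_def sum.distrib add_divide_distrib)
  qed
  also have "\<dots> \<le> (\<Sum>l<n. (\<theta> * (a l)\<^sup>2 + (1 + 1 / \<theta>) * (b l)\<^sup>2) / real n)"
  proof (intro sum_mono divide_right_mono)
    fix l
    have "cnorm N (\<lambda>i. complex_of_real (w' l i)) \<le> L2_set (\<lambda>i. cmod (of_real (w l i)) + cmod (d l i)) {..<N}"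
      by (intro L2_set_mono) (auto simp: d_def simp flip: of_real_diff)
    also have "\<dots> \<le> a l + b l"
      unfolding a_def b_def by (rule L2_set_triangle_ineq)
    finally have "b l * cnorm N (\<lambda>i. complex_of_real (w' l i)) \<le> b l * (a l + b l)"
      using ab by (intro mult_left_mono)
    moreover have "2 * (a l * b l) \<le> \<theta> * (a l)\<^sup>2 + (b l)\<^sup>2 / \<theta>"
    proof -
      have "0 \<le> (\<theta> * a l - b l)\<^sup>2 / \<theta>" using \<theta> by simp
      then show ?thesis using \<theta> by (simp add: power2_eq_square field_simps)
    qed
    ultimately show "b l * cnorm N (\<lambda>i. complex_of_real (w' l i)) + a l * b l
        \<le> \<theta> * (a l)\<^sup>2 + (1 + 1 / \<theta>) * (b l)\<^sup>2"
      by (simp add: algebra_simps power2_eq_square)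
  qed auto
  also have "\<dots> = (\<theta> * (\<Sum>l<n. (a l)\<^sup>2) + (1 + 1 / \<theta>) * (\<Sum>l<n. (b l)\<^sup>2)) / real n"
    by (simp add: sum_distrib_left sum.distrib flip: sum_divide_distrib)
  also have "(\<Sum>l<n. (a l)\<^sup>2) = (\<Sum>l<n. \<Sum>i<N. (w l i)\<^sup>2)"
    by (simp add: a_def L2_set_def sum_nonneg)
  also have "(\<Sum>l<n. (b l)\<^sup>2) = (\<Sum>l<n. \<Sum>i<N. (w l i - w' l i)\<^sup>2)"
    by (simp add: b_def d_def L2_set_def sum_nonneg power2_commute flip: of_real_diff)
  finally have "cmod ((\<Sum>i<N. G i i) - (\<Sum>i<N. G' i i)) / real N \<le>
     (\<theta> * (\<Sum>l<n. \<Sum>i<N. (w l i)\<^sup>2) + (1 + 1 / \<theta>) * (\<Sum>l<n. \<Sum>i<N. (w l i - w' l i)\<^sup>2))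
      / real n / (Im z)\<^sup>2 / real N"
    by (intro divide_right_mono) (auto simp: divide_right_mono)
  then show ?thesis
    unfolding eq eq' by (simp add: norm_divide mult_ac flip: diff_divide_distrib)
qed

text \<open>Both data are compared with the matrix in which column \<open>k\<close> is erased. Each
  comparison is a rank-one perturbation, whence the factor 2 and the absence of any bound on the
  entries.\<close>

lemma gram_stieltjes_change_column:
  assumes z: "Im z > 0" and k: "k < n"
    and same: "\<And>l i. l < n \<Longrightarrow> l \<noteq> k \<Longrightarrow> i < N \<Longrightarrow> w l i = w' l i"
  shows "cmod (gram_stieltjes N n z w - gram_stieltjes N n z w') \<le> 2 / (real N * Im z)"
proof -
  define w0 where "w0 l i = (if l = k then 0 else w l i)" for l i
  have add_column: "cmod (gram_stieltjes N n z w0 - gram_stieltjes N n z v) \<le> 1 / Im z / real N"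
    if v: "\<And>l i. l < n \<Longrightarrow> l \<noteq> k \<Longrightarrow> i < N \<Longrightarrow> w l i = v l i" for v
  proof -
    obtain G where G: "is_resolvent N (gram n w0) z G"
      and eq: "gram_stieltjes N n z w0 = (\<Sum>i<N. G i i) / of_nat N"
      using gram_stieltjes_resolvent[OF z] .
    obtain G' where G': "is_resolvent N (gram n v) z G'"
      and eq': "gram_stieltjes N n z v = (\<Sum>i<N. G' i i) / of_nat N"
      using gram_stieltjes_resolvent[OF z] .
    have "cmod ((\<Sum>i<N. G i i) - (\<Sum>i<N. G' i i)) \<le> 1 / Im z"
    proof (rule resolvent_rank_one[OF z gram_sym gram_sym G G', of "\<lambda>i. v k i / sqrt (real n)"])
      fix i j assume ij: "i < N" "j < N"
      have "(\<Sum>l<n. v l i * v l j) = (\<Sum>l\<in>{..<n}-{k}. v l i * v l j) + v k i * v k j"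
        using k by (simp add: sum.remove[of "{..<n}" k])
      moreover have "(\<Sum>l<n. w0 l i * w0 l j) = (\<Sum>l\<in>{..<n}-{k}. w0 l i * w0 l j) + w0 k i * w0 k j"
        using k by (simp add: sum.remove[of "{..<n}" k])
      moreover have "(\<Sum>l\<in>{..<n}-{k}. w0 l i * w0 l j) = (\<Sum>l\<in>{..<n}-{k}. v l i * v l j)"
        using v ij by (intro sum.cong) (auto simp: w0_def)
      ultimately show "gram n v i j = gram n w0 i j + v k i / sqrt (real n) * (v k j / sqrt (real n))"
        by (simp add: gram_def w0_def add_divide_distrib)
    qed
    then have "cmod ((\<Sum>i<N. G i i) - (\<Sum>i<N. G' i i)) / real N \<le> 1 / Im z / real N"
      by (intro divide_right_mono) auto
    then show ?thesis
      unfolding eq eq' by (simp add: norm_divide flip: diff_divide_distrib)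
  qed
  show ?thesis
    using add_column[of w] add_column[of w'] same
      norm_triangle_ineq4[of "gram_stieltjes N n z w0 - gram_stieltjes N n z w'"
        "gram_stieltjes N n z w0 - gram_stieltjes N n z w"]
    by (simp add: mult.commute)
qed

lemma gram_stieltjes_change_columns:
  assumes z: "Im z > 0" and K: "K \<subseteq> {..<n}"
    and same: "\<And>l i. l < n \<Longrightarrow> l \<notin> K \<Longrightarrow> i < N \<Longrightarrow> w l i = w' l i"
  shows "cmod (gram_stieltjes N n z w - gram_stieltjes N n z w') \<le> 2 * real (card K) / (real N * Im z)"
proof -
  have "finite K" using K finite_subset by blast
  then show ?thesis using K same
  proof (induction K arbitrary: w' rule: finite_induct)
    case empty
    then have "gram n w i j = gram n w' i j" if "i < N" "j < N" for i j
      using that by (simp add: gram_def)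
    then have "mat N N (\<lambda>(i, j). gram n w i j) = mat N N (\<lambda>(i, j). gram n w' i j)"
      by (intro eq_matI) auto
    then show ?case by (simp add: gram_stieltjes_def)
  next
    case (insert k K)
    let ?v = "\<lambda>l i. if l = k then w l i else w' l i"
    have "cmod (gram_stieltjes N n z w - gram_stieltjes N n z ?v) \<le> 2 * real (card K) / (real N * Im z)"
      using insert by (intro insert.IH) auto
    moreover have "cmod (gram_stieltjes N n z ?v - gram_stieltjes N n z w') \<le> 2 / (real N * Im z)"
      using insert by (intro gram_stieltjes_change_column[OF z, of k]) auto
    ultimately have "cmod (gram_stieltjes N n z w - gram_stieltjes N n z w')
        \<le> 2 * real (card K) / (real N * Im z) + 2 / (real N * Im z)"
      using norm_triangle_ineq[of "gram_stieltjes N n z w - gram_stieltjes N n z ?v"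
          "gram_stieltjes N n z ?v - gram_stieltjes N n z w'"] by simp
    then show ?case
      using insert by (simp add: add_divide_distrib algebra_simps)
  qed
qed

section \<open>Measurability of the transform\<close>

lemma measurable_det:
  fixes A :: "'a \<Rightarrow> complex mat"
  assumes dim: "\<And>x. A x \<in> carrier_mat k k"
    and meas: "\<And>i j. i < k \<Longrightarrow> j < k \<Longrightarrow> (\<lambda>x. A x $$ (i, j)) \<in> borel_measurable M"
  shows "(\<lambda>x. det (A x)) \<in> borel_measurable M"
proof -
  have "(\<lambda>x. \<Sum>p\<in>{p. p permutes {0..<k}}. signof p * (\<Prod>i = 0..<k. A x $$ (i, p i))) \<in> borel_measurable M"
  proof (intro borel_measurable_sum borel_measurable_times borel_measurable_prod borel_measurable_const)
    fix p i assume "p \<in> {p. p permutes {0..<k}}" "i \<in> {0..<k}"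
    then have "p i < k" using permutes_in_image[of p "{0..<k}" i] by auto
    then show "(\<lambda>x. A x $$ (i, p i)) \<in> borel_measurable M"
      using \<open>i \<in> {0..<k}\<close> by (intro meas) auto
  qed
  then show ?thesis using det_def'[OF dim] by simp
qed

text \<open>\<open>mat_inverse\<close> is the outcome of an elimination procedure whose
  measurability is not evident. The trace is therefore rewritten with adjugate entries over the
  determinant, which are ratios of polynomials in the entries.\<close>

lemma measurable_gram_stieltjes:
  assumes z: "Im z > 0"
    and meas: "\<And>l i. (\<lambda>x. w x l i) \<in> borel_measurable M"
  shows "(\<lambda>x. gram_stieltjes N n z (w x)) \<in> borel_measurable M"
proof -
  define C where "C x = map_mat complex_of_real (mat N N (\<lambda>(i, j). gram n (w x) i j)) - z \<cdot>\<^sub>m 1\<^sub>m N" for x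
  have C: "C x \<in> carrier_mat N N" for x by (auto simp: C_def)
  have C_ix: "C x $$ (i, j) = of_real (gram n (w x) i j) - z * of_bool (i = j)" if "i < N" "j < N" for x i j
    using that by (simp add: C_def)
  have C_meas: "(\<lambda>x. C x $$ (i, j)) \<in> borel_measurable M" if "i < N" "j < N" for i j
    using meas that by (simp add: C_ix gram_def)
  have "gram_stieltjes N n z (w x) = (\<Sum>i<N. adj_mat (C x) $$ (i, i) / det (C x)) / of_nat N" for x
  proof -
    have "dim_row (the (mat_inverse (C x))) = N"
      using mat_inverse_resolvent(2)[OF z, of N "gram n (w x)"] by (auto simp: C_def gram_sym)
    then have "gram_stieltjes N n z (w x) = (\<Sum>i<N. the (mat_inverse (C x)) $$ (i, i)) / of_nat N"
      by (simp add: gram_stieltjes_def stieltjes_def mat_trace_def C_def)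
    also have "(\<Sum>i<N. the (mat_inverse (C x)) $$ (i, i)) = (\<Sum>i<N. adj_mat (C x) $$ (i, i) / det (C x))"
      unfolding C_def by (intro sum.cong refl mat_inverse_resolvent(3)[OF z gram_sym]) auto
    finally show ?thesis .
  qed
  moreover have "(\<lambda>x. adj_mat (C x) $$ (i, i)) \<in> borel_measurable M" if i: "i < N" for i
  proof -
    have "adj_mat (C x) $$ (i, i) = det (mat_delete (C x) i i)" for x
      using C[of x] i by (simp add: adj_mat_def cofactor_def)
    moreover have "(\<lambda>x. det (mat_delete (C x) i i)) \<in> borel_measurable M"
    proof (rule measurable_det[of _ "N - 1"])
      show "mat_delete (C x) i i \<in> carrier_mat (N - 1) (N - 1)" for x
        using C by (rule mat_delete_carrier)
      fix a b assume ab: "a < N - 1" "b < N - 1"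
      then have "mat_delete (C x) i i $$ (a, b)
          = C x $$ (if a < i then a else Suc a, if b < i then b else Suc b)" for x
        using C[of x] by (simp add: mat_delete_def)
      then show "(\<lambda>x. mat_delete (C x) i i $$ (a, b)) \<in> borel_measurable M"
        using ab by (auto intro!: C_meas)
    qed
    ultimately show ?thesis by simp
  qed
  moreover have "(\<lambda>x. det (C x)) \<in> borel_measurable M"
    by (rule measurable_det[OF C C_meas])
  ultimately show ?thesis
    by (auto intro!: borel_measurable_sum borel_measurable_divide)
qed

section \<open>Total variation and mixing\<close>

text \<open>The sets approximable from the algebra \<open>\<A>\<close> are closed under complements
  and countable unions. Two measures are handled together because a single approximating set must
  serve a joint law and a product law.\<close>

lemma sigma_sets_approx:
  assumes fin: "finite_measure M1" "finite_measure M2" and sets: "sets M2 = sets M1"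
    and \<A>: "\<A> \<subseteq> sets M1"
    and compl: "\<And>A. A \<in> \<A> \<Longrightarrow> space M1 - A \<in> \<A>"
    and union: "\<And>A B. A \<in> \<A> \<Longrightarrow> B \<in> \<A> \<Longrightarrow> A \<union> B \<in> \<A>"
    and G: "G \<subseteq> \<A>" and ne: "{} \<in> \<A>"
    and A: "A \<in> sigma_sets (space M1) G" and e: "e > 0"
  shows "\<exists>B\<in>\<A>. measure M1 (sym_diff A B) + measure M2 (sym_diff A B) < e"
proof -
  interpret M1: finite_measure M1 by fact
  interpret M2: finite_measure M2 by fact
  let ?m = "\<lambda>A. measure M1 A + measure M2 A"
  have sub: "?m A \<le> ?m B" if "A \<subseteq> B" "B \<in> sets M1" for A B
    using that by (intro add_mono M1.finite_measure_mono M2.finite_measure_mono) (auto simp: sets)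
  have subadd: "?m (A \<union> B) \<le> ?m A + ?m B" if "A \<in> sets M1" "B \<in> sets M1" for A B
    using measure_Un_le[of A M1 B] measure_Un_le[of A M2 B] that by (simp add: sets)
  have sG: "sigma_sets (space M1) G \<subseteq> sets M1"
    using G \<A> by (intro sets.sigma_sets_subset) auto
  have "\<forall>e>0. \<exists>B\<in>\<A>. ?m (sym_diff A B) < e" using A
  proof (induction rule: sigma_sets.induct)
    case (Basic a)
    then show ?case using G by (intro allI impI bexI[of _ a]) auto
  next
    case Empty
    then show ?case using ne by (intro allI impI bexI[of _ "{}"]) auto
  next
    case (Compl a)
    show ?case
    proof (intro allI impI)
      fix e :: real assume "e > 0"
      with Compl obtain B where B: "B \<in> \<A>" "?m (sym_diff a B) < e" by auto
      have "a \<in> sets M1" "B \<in> sets M1" using Compl.hyps sG B \<A> by auto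
      then have "sym_diff (space M1 - a) (space M1 - B) = sym_diff a B"
        using sets.sets_into_space by blast
      then show "\<exists>B\<in>\<A>. ?m (sym_diff (space M1 - a) B) < e"
        using B compl[of B] by (intro bexI[of _ "space M1 - B"]) auto
    qed
  next
    case (Union a)
    show ?case
    proof (intro allI impI)
      fix e :: real assume "e > 0"
      have a: "a i \<in> sets M1" for i using Union.hyps sG by auto
      \<comment> \<open>Half of \<open>e\<close> is shared geometrically among the pieces; the other
        half pays for truncating the union at a finite stage.\<close>
      have "\<forall>i. \<exists>B\<in>\<A>. ?m (sym_diff (a i) B) < e / 2 * (1/2) ^ Suc i"
      proof
        fix i
        have "e / 2 * (1/2) ^ Suc i > 0" using \<open>e > 0\<close> by simp
        then show "\<exists>B\<in>\<A>. ?m (sym_diff (a i) B) < e / 2 * (1/2) ^ Suc i"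
          using Union.IH[of i] by blast
      qed
      then obtain B where B: "\<And>i. B i \<in> \<A>" "\<And>i. ?m (sym_diff (a i) (B i)) < e / 2 * (1/2) ^ Suc i"
        by metis
      have Bs: "B i \<in> sets M1" for i using B \<A> by auto
      have conv: "(\<lambda>n. ?m ((\<Union>i. a i) - (\<Union>i<n. a i))) \<longlonglongrightarrow> 0"
      proof -
        have dec: "decseq (\<lambda>n. (\<Union>i. a i) - (\<Union>i<n. a i))"
          by (force simp: decseq_def)
        have emp: "(\<Inter>n. (\<Union>i. a i) - (\<Union>i<n. a i)) = {}"
          by (auto intro: lessI)
        have "(\<lambda>n. measure M1 ((\<Union>i. a i) - (\<Union>i<n. a i))) \<longlonglongrightarrow> 0"
          using M1.finite_Lim_measure_decseq[OF _ dec] a unfolding emp by auto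
        moreover have "(\<lambda>n. measure M2 ((\<Union>i. a i) - (\<Union>i<n. a i))) \<longlonglongrightarrow> 0"
          using M2.finite_Lim_measure_decseq[OF _ dec] a unfolding emp by (auto simp: sets)
        ultimately show ?thesis using tendsto_add[of _ 0 _ _ 0] by auto
      qed
      then have "eventually (\<lambda>n. ?m ((\<Union>i. a i) - (\<Union>i<n. a i)) < e / 2) sequentially"
        using \<open>e > 0\<close> by (intro order_tendstoD) auto
      then obtain n where n: "?m ((\<Union>i. a i) - (\<Union>i<n. a i)) < e / 2"
        by (auto simp: eventually_sequentially)
      have un: "(\<Union>i<m. B i) \<in> \<A>" for m
        by (induction m) (auto simp: lessThan_Suc ne B(1) intro: union)
      have bound: "?m (\<Union>i<m. sym_diff (a i) (B i)) \<le> e / 2 * (1 - (1/2) ^ m)" for m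
      proof (induction m)
        case (Suc m)
        have "?m (\<Union>i<Suc m. sym_diff (a i) (B i))
            \<le> ?m (sym_diff (a m) (B m)) + ?m (\<Union>i<m. sym_diff (a i) (B i))"
          unfolding lessThan_Suc image_insert Union_insert
          using a Bs by (intro subadd) auto
        also have "\<dots> \<le> e / 2 * (1/2) ^ Suc m + e / 2 * (1 - (1/2) ^ m)"
          using Suc B(2)[of m] by linarith
        also have "\<dots> = e / 2 * (1 - (1/2) ^ Suc m)" by (simp add: field_simps)
        finally show ?case .
      qed simp
      have "?m (sym_diff (\<Union>i. a i) (\<Union>i<n. B i))
          \<le> ?m (((\<Union>i. a i) - (\<Union>i<n. a i)) \<union> (\<Union>i<n. sym_diff (a i) (B i)))"
        using a Bs by (intro sub) auto
      also have "\<dots> \<le> ?m ((\<Union>i. a i) - (\<Union>i<n. a i)) + ?m (\<Union>i<n. sym_diff (a i) (B i))"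
        using a Bs by (intro subadd) auto
      also have "\<dots> < e / 2 + e / 2"
      proof (intro add_less_le_mono n)
        have "e / 2 * (1 - (1/2) ^ n) \<le> e / 2 * 1" using \<open>e > 0\<close> by (intro mult_left_mono) auto
        then show "?m (\<Union>i<n. sym_diff (a i) (B i)) \<le> e / 2" using bound[of n] by linarith
      qed
      finally show "\<exists>B\<in>\<A>. ?m (sym_diff (\<Union>i. a i) B) < e"
        using un by (intro bexI[of _ "\<Union>i<n. B i"]) auto
    qed
  qed
  with e show ?thesis by blast
qed

text \<open>Since the totals agree, the discrepancy on \<open>R\<close> is the opposite of that on
  \<open>I - R\<close>, so each takes at most half of the absolute sum. This half matches the
  \<open>1/2\<close> in \<open>beta_coeff\<close>.\<close>

lemma sum_abs_diff_subset:
  fixes f g :: "'a \<Rightarrow> real"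
  assumes "finite I" "R \<subseteq> I" "sum f I = sum g I"
  shows "\<bar>sum f R - sum g R\<bar> \<le> (\<Sum>i\<in>I. \<bar>f i - g i\<bar>) / 2"
proof -
  have "sum f I = sum f R + sum f (I - R)" "sum g I = sum g R + sum g (I - R)"
    "(\<Sum>i\<in>I. \<bar>f i - g i\<bar>) = (\<Sum>i\<in>R. \<bar>f i - g i\<bar>) + (\<Sum>i\<in>I - R. \<bar>f i - g i\<bar>)"
    using assms by (simp_all add: sum.subset_diff add.commute)
  moreover have "\<bar>sum f R - sum g R\<bar> \<le> (\<Sum>i\<in>R. \<bar>f i - g i\<bar>)"
    "\<bar>sum f (I - R) - sum g (I - R)\<bar> \<le> (\<Sum>i\<in>I - R. \<bar>f i - g i\<bar>)"
    by (simp_all flip: sum_subtractf)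
  ultimately show ?thesis using assms(3) by linarith
qed

section \<open>Total variation distance between a joint law and the product of its marginals\<close>

text \<open>The finite unions of rectangles, presented through finite-valued functions so that
  common refinements are simply pairs.\<close>
definition rect_algebra :: "'a measure \<Rightarrow> 'b measure \<Rightarrow> ('a \<times> 'b) set set" where
  "rect_algebra A B = {{p \<in> space (A \<Otimes>\<^sub>M B). (u (fst p), v (snd p)) \<in> R} | (u :: _ \<Rightarrow> nat) (v :: _ \<Rightarrow> nat) R.
     simple_function A u \<and> simple_function B v}"

lemma rect_algebraI:
  fixes u :: "'a \<Rightarrow> nat" and v :: "'b \<Rightarrow> nat"
  assumes "E = {p \<in> space (A \<Otimes>\<^sub>M B). (u (fst p), v (snd p)) \<in> R}"
    and "simple_function A u" "simple_function B v"
  shows "E \<in> rect_algebra A B"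
  using assms unfolding rect_algebra_def by blast

lemma rect_algebra_sets: "rect_algebra A B \<subseteq> sets (A \<Otimes>\<^sub>M B)"
proof
  fix E assume "E \<in> rect_algebra A B"
  then obtain u v R where E: "E = {p \<in> space (A \<Otimes>\<^sub>M B). (u (fst p), v (snd p)) \<in> R}"
    and uv: "simple_function A (u :: _ \<Rightarrow> nat)" "simple_function B (v :: _ \<Rightarrow> nat)"
    by (auto simp: rect_algebra_def)
  have [measurable]: "u \<in> measurable A (count_space UNIV)" "v \<in> measurable B (count_space UNIV)"
    using uv by (auto intro: measurable_simple_function)
  show "E \<in> sets (A \<Otimes>\<^sub>M B)"
    unfolding E by measurable
qed

lemma rect_algebra_compl:
  assumes "E \<in> rect_algebra A B"
  shows "space (A \<Otimes>\<^sub>M B) - E \<in> rect_algebra A B"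
proof -
  obtain u v R where E: "E = {p \<in> space (A \<Otimes>\<^sub>M B). (u (fst p), v (snd p)) \<in> R}"
    and uv: "simple_function A (u :: _ \<Rightarrow> nat)" "simple_function B (v :: _ \<Rightarrow> nat)"
    using assms by (auto simp: rect_algebra_def)
  have "space (A \<Otimes>\<^sub>M B) - E = {p \<in> space (A \<Otimes>\<^sub>M B). (u (fst p), v (snd p)) \<in> - R}"
    by (auto simp: E)
  then show ?thesis using uv by (rule rect_algebraI)
qed

lemma rect_algebra_union:
  assumes "E \<in> rect_algebra A B" "E' \<in> rect_algebra A B"
  shows "E \<union> E' \<in> rect_algebra A B"
proof -
  obtain u v R where E: "E = {p \<in> space (A \<Otimes>\<^sub>M B). (u (fst p), v (snd p)) \<in> R}"
    and uv: "simple_function A (u :: _ \<Rightarrow> nat)" "simple_function B (v :: _ \<Rightarrow> nat)"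
    using assms by (auto simp: rect_algebra_def)
  obtain u' v' R' where E': "E' = {p \<in> space (A \<Otimes>\<^sub>M B). (u' (fst p), v' (snd p)) \<in> R'}"
    and uv': "simple_function A (u' :: _ \<Rightarrow> nat)" "simple_function B (v' :: _ \<Rightarrow> nat)"
    using assms by (auto simp: rect_algebra_def)
  let ?u = "\<lambda>x. prod_encode (u x, u' x)" and ?v = "\<lambda>x. prod_encode (v x, v' x)"
  let ?R = "{(a, b). (fst (prod_decode a), fst (prod_decode b)) \<in> R
                   \<or> (snd (prod_decode a), snd (prod_decode b)) \<in> R'}"
  have "E \<union> E' = {p \<in> space (A \<Otimes>\<^sub>M B). (?u (fst p), ?v (snd p)) \<in> ?R}"
    by (auto simp: E E')
  moreover have "simple_function A ?u" "simple_function B ?v"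
    using uv uv' by (auto intro!: simple_function_compose1[where g = prod_encode])
  ultimately show ?thesis by (rule rect_algebraI)
qed

lemma rect_algebra_Times:
  assumes "a \<in> sets A" "b \<in> sets B"
  shows "a \<times> b \<in> rect_algebra A B"
proof -
  have "a \<times> b = {p \<in> space (A \<Otimes>\<^sub>M B). (of_bool (fst p \<in> a) :: nat, of_bool (snd p \<in> b) :: nat) \<in> {(1, 1)}}"
    using sets.sets_into_space[OF assms(1)] sets.sets_into_space[OF assms(2)]
    by (auto simp: space_pair_measure)
  moreover have "simple_function A (\<lambda>x. of_bool (x \<in> a) :: nat)" "simple_function B (\<lambda>x. of_bool (x \<in> b) :: nat)"
    unfolding of_bool_def using assms by (auto intro!: simple_function_If)
  ultimately show ?thesis by (rule rect_algebraI)
qed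

text \<open>Mixing is phrased with finite-valued functions of \<open>U\<close> and \<open>V\<close>;
  their level sets are the partitions. The bound is \<open>2 * \<beta>\<close> because the sum over
  cells is twice a \<open>beta_coeff\<close>, and \<open>\<beta>\<close> itself will bound the total
  variation distance.\<close>

locale almost_independent = prob_space M for M :: "'a measure" +
  fixes A :: "'b measure" and B :: "'c measure" and U V and \<beta> :: real
  assumes U[measurable]: "U \<in> measurable M A" and V[measurable]: "V \<in> measurable M B"
    and mix: "\<And>(u :: 'b \<Rightarrow> nat) (v :: 'c \<Rightarrow> nat). simple_function A u \<Longrightarrow> simple_function B v \<Longrightarrow>
      (\<Sum>i\<in>u ` space A. \<Sum>j\<in>v ` space B.
        \<bar>prob {\<omega> \<in> space M. u (U \<omega>) = i \<and> v (V \<omega>) = j}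
         - prob {\<omega> \<in> space M. u (U \<omega>) = i} * prob {\<omega> \<in> space M. v (V \<omega>) = j}\<bar>) \<le> 2 * \<beta>"
begin

definition "joint = distr M (A \<Otimes>\<^sub>M B) (\<lambda>\<omega>. (U \<omega>, V \<omega>))"
definition "indep = distr M A U \<Otimes>\<^sub>M distr M B V"

sublocale joint: prob_space joint
  unfolding joint_def by (rule prob_space_distr) measurable

sublocale indep: pair_prob_space "distr M A U" "distr M B V"
proof -
  interpret A: prob_space "distr M A U" by (rule prob_space_distr) (rule U)
  interpret B: prob_space "distr M B V" by (rule prob_space_distr) (rule V)
  show "pair_prob_space (distr M A U) (distr M B V)" ..
qed

lemma sets_joint[measurable_cong]: "sets joint = sets (A \<Otimes>\<^sub>M B)"
  by (simp add: joint_def)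
lemma sets_indep[measurable_cong]: "sets indep = sets (A \<Otimes>\<^sub>M B)"
  unfolding indep_def by (intro sets_pair_measure_cong) auto
lemma space_joint: "space joint = space (A \<Otimes>\<^sub>M B)"
  by (simp add: joint_def)
lemma space_indep: "space indep = space (A \<Otimes>\<^sub>M B)"
  by (simp add: indep_def space_pair_measure)
lemma prob_space_indep: "prob_space indep"
  unfolding indep_def by (rule indep.prob_space_axioms)

lemma measure_joint_Times:
  assumes "a \<in> sets A" "b \<in> sets B"
  shows "measure joint (a \<times> b) = prob {\<omega> \<in> space M. U \<omega> \<in> a \<and> V \<omega> \<in> b}"
  using assms unfolding joint_def
  by (subst measure_distr) (auto intro!: arg_cong[where f = prob])

lemma measure_indep_Times:
  assumes "a \<in> sets A" "b \<in> sets B"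
  shows "measure indep (a \<times> b) = prob {\<omega> \<in> space M. U \<omega> \<in> a} * prob {\<omega> \<in> space M. V \<omega> \<in> b}"
proof -
  have "measure indep (a \<times> b) = measure (distr M A U) a * measure (distr M B V) b"
    unfolding indep_def using assms
    by (simp add: measure_def indep.M2.emeasure_pair_measure_Times enn2real_mult)
  also have "\<dots> = prob {\<omega> \<in> space M. U \<omega> \<in> a} * prob {\<omega> \<in> space M. V \<omega> \<in> b}"
    using assms by (auto simp: measure_distr vimage_def Int_def conj_commute)
  finally show ?thesis .
qed

text \<open>\<open>E\<close> is a union of product cells of \<open>u\<close> and \<open>v\<close>,
  and both laws give total mass 1 to the cells. So \<open>sum_abs_diff_subset\<close> applies and
  halves the sum in \<open>mix\<close>.\<close>

lemma measure_diff_rect_algebra: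
  assumes "E \<in> rect_algebra A B"
  shows "\<bar>measure joint E - measure indep E\<bar> \<le> \<beta>"
proof -
  interpret indep': prob_space indep by (rule prob_space_indep)
  obtain u v R where E: "E = {p \<in> space (A \<Otimes>\<^sub>M B). (u (fst p), v (snd p)) \<in> R}"
    and uv: "simple_function A (u :: _ \<Rightarrow> nat)" "simple_function B (v :: _ \<Rightarrow> nat)"
    using assms by (auto simp: rect_algebra_def)
  define I where "I = u ` space A \<times> v ` space B"
  have "finite I" using uv by (auto simp: I_def simple_function_def)
  define a where "a i = u -` {i} \<inter> space A" for i
  define b where "b j = v -` {j} \<inter> space B" for j
  have a: "a i \<in> sets A" for i unfolding a_def using uv(1) by (rule simple_functionD)
  have b: "b i \<in> sets B" for i unfolding b_def using uv(2) by (rule simple_functionD)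
  define cell where "cell p = a (fst p) \<times> b (snd p)" for p
  have cell: "cell p \<in> sets (A \<Otimes>\<^sub>M B)" for p unfolding cell_def using a b by auto
  have disj: "disjoint_family_on cell J" for J
    by (auto simp: disjoint_family_on_def cell_def a_def b_def)
  have E_eq: "E = (\<Union>p\<in>R \<inter> I. cell p)"
    by (auto simp: E cell_def I_def a_def b_def space_pair_measure)
  have sp_eq: "space (A \<Otimes>\<^sub>M B) = (\<Union>p\<in>I. cell p)"
    by (auto simp: cell_def I_def a_def b_def space_pair_measure)
  have sumj: "measure joint (\<Union>p\<in>J. cell p) = (\<Sum>p\<in>J. measure joint (cell p))" if "J \<subseteq> I" for J
    using that \<open>finite I\<close> finite_subset disj cell
    by (intro joint.finite_measure_finite_Union) (auto simp: sets_joint)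
  have sumi: "measure indep (\<Union>p\<in>J. cell p) = (\<Sum>p\<in>J. measure indep (cell p))" if "J \<subseteq> I" for J
    using that \<open>finite I\<close> finite_subset disj cell
    by (intro indep'.finite_measure_finite_Union) (auto simp: sets_indep)
  have "(\<Sum>p\<in>I. measure joint (cell p)) = (\<Sum>p\<in>I. measure indep (cell p))"
    using sumj[of I] sumi[of I] joint.prob_space indep'.prob_space
    by (simp flip: sp_eq add: space_joint space_indep)
  then have "\<bar>measure joint E - measure indep E\<bar>
      \<le> (\<Sum>p\<in>I. \<bar>measure joint (cell p) - measure indep (cell p)\<bar>) / 2"
    unfolding E_eq using sumj[of "R \<inter> I"] sumi[of "R \<inter> I"]
      sum_abs_diff_subset[OF \<open>finite I\<close> Int_lower2] by simp
  also have "(\<Sum>p\<in>I. \<bar>measure joint (cell p) - measure indep (cell p)\<bar>)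
      = (\<Sum>i\<in>u ` space A. \<Sum>j\<in>v ` space B. \<bar>measure joint (a i \<times> b j) - measure indep (a i \<times> b j)\<bar>)"
    by (simp add: I_def cell_def sum.cartesian_product case_prod_unfold)
  also have "\<dots> \<le> 2 * \<beta>"
  proof -
    have "{\<omega> \<in> space M. U \<omega> \<in> a i} = {\<omega> \<in> space M. u (U \<omega>) = i}"
      "{\<omega> \<in> space M. V \<omega> \<in> b j} = {\<omega> \<in> space M. v (V \<omega>) = j}"
      "{\<omega> \<in> space M. U \<omega> \<in> a i \<and> V \<omega> \<in> b j} = {\<omega> \<in> space M. u (U \<omega>) = i \<and> v (V \<omega>) = j}" for i j
      using measurable_space[OF U] measurable_space[OF V] by (auto simp: a_def b_def)
    then show ?thesis
      using mix[OF uv] by (simp add: measure_joint_Times measure_indep_Times a b)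
  qed
  finally show ?thesis by simp
qed

lemma measure_diff:
  assumes "E \<in> sets (A \<Otimes>\<^sub>M B)"
  shows "\<bar>measure joint E - measure indep E\<bar> \<le> \<beta>"
proof (rule field_le_epsilon)
  fix e :: real assume "e > 0"
  interpret indep': prob_space indep by (rule prob_space_indep)
  have "\<exists>F\<in>rect_algebra A B. measure joint (sym_diff E F) + measure indep (sym_diff E F) < e"
  proof (rule sigma_sets_approx[where G = "{a \<times> b |a b. a \<in> sets A \<and> b \<in> sets B}"])
    show "E \<in> sigma_sets (space joint) {a \<times> b |a b. a \<in> sets A \<and> b \<in> sets B}"
      using assms by (simp add: space_joint sets_pair_measure space_pair_measure)
    show "{} \<in> rect_algebra A B" using rect_algebra_Times[of "{}" A "{}" B] by simp
  qed (use rect_algebra_sets rect_algebra_compl rect_algebra_union rect_algebra_Times \<open>e > 0\<close>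
       joint.finite_measure_axioms indep'.finite_measure_axioms in
       \<open>auto simp: sets_joint sets_indep space_joint\<close>)
  then obtain F where F: "F \<in> rect_algebra A B"
    "measure joint (sym_diff E F) + measure indep (sym_diff E F) < e" by auto
  have F': "F \<in> sets (A \<Otimes>\<^sub>M B)" using F rect_algebra_sets by blast
  have bd: "\<bar>measure P E - measure P F\<bar> \<le> measure P (sym_diff E F)"
    if "prob_space P" "sets P = sets (A \<Otimes>\<^sub>M B)" for P
  proof -
    interpret P: prob_space P by fact
    have "measure P E \<le> measure P (F \<union> sym_diff E F)" "measure P F \<le> measure P (E \<union> sym_diff E F)"
      using assms F' that by (auto intro!: P.finite_measure_mono)
    moreover have "measure P (F \<union> sym_diff E F) \<le> measure P F + measure P (sym_diff E F)"
      "measure P (E \<union> sym_diff E F) \<le> measure P E + measure P (sym_diff E F)"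
      using assms F' that by (auto intro!: measure_Un_le)
    ultimately show ?thesis by linarith
  qed
  show "\<bar>measure joint E - measure indep E\<bar> \<le> \<beta> + e"
    using bd[OF joint.prob_space_axioms sets_joint] bd[OF prob_space_indep sets_indep]
      measure_diff_rect_algebra[OF F(1)] F(2) by linarith
qed

text \<open>Layer cake: up to \<open>1 / n\<close>, \<open>f\<close> is the mean of the indicators
  of its \<open>n\<close> level sets \<open>E k\<close>. Averaging the bounds for single events
  keeps the constant \<open>\<beta>\<close>.\<close>

lemma integral_diff_unit:
  assumes f[measurable]: "f \<in> borel_measurable (A \<Otimes>\<^sub>M B)"
    and bd: "\<And>p. 0 \<le> f p" "\<And>p. f p \<le> (1::real)"
  shows "\<bar>integral\<^sup>L joint f - integral\<^sup>L indep f\<bar> \<le> \<beta>"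
proof (rule field_le_epsilon)
  fix e :: real assume "e > 0"
  interpret indep': prob_space indep by (rule prob_space_indep)
  obtain n :: nat where n': "2 / e < real n" using reals_Archimedean2 by blast
  then have "0 < real n" using \<open>e > 0\<close> by (smt (verit) divide_pos_pos)
  then have n: "n > 0" "2 / real n < e" using n' \<open>e > 0\<close> by (auto simp: field_simps)
  define E where "E k = {p \<in> space (A \<Otimes>\<^sub>M B). real k \<le> real n * f p}" for k :: nat
  have E: "E k \<in> sets (A \<Otimes>\<^sub>M B)" for k unfolding E_def by measurable
  define h where "h p = (\<Sum>k=1..n. indicat_real (E k) p) / real n" for p
  have h: "\<bar>f p - h p\<bar> \<le> 1 / real n" if "p \<in> space (A \<Otimes>\<^sub>M B)" for p
  proof -
    define m where "m = nat \<lfloor>real n * f p\<rfloor>"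
    have m: "real m \<le> real n * f p" "real n * f p < real m + 1"
      using bd(1)[of p] by (auto simp: m_def)
    have "real m \<le> real n * 1" using m(1) bd(2)[of p] by (meson mult_left_mono of_nat_0_le_iff order_trans)
    then have "m \<le> n" by simp
    have "(\<Sum>k=1..n. indicat_real (E k) p) = (\<Sum>k\<in>{1..n} \<inter> {..m}. 1)"
    proof (intro sum.mono_neutral_cong_right ballI)
      fix k assume "k \<in> {1..n} - {1..n} \<inter> {..m}"
      then have "m + 1 \<le> k" by auto
      then have "real m + 1 \<le> real k" by (simp flip: of_nat_Suc)
      then show "indicat_real (E k) p = 0" using m by (auto simp: E_def)
    next
      fix k assume "k \<in> {1..n} \<inter> {..m}"
      then have "real k \<le> real n * f p" using m(1) by auto
      then show "indicat_real (E k) p = 1" using that by (auto simp: E_def)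
    qed auto
    also have "{1..n} \<inter> {..m} = {1..m}" using \<open>m \<le> n\<close> by auto
    also have "(\<Sum>k\<in>{1..m}. 1) = real m" by simp
    finally have "h p = real m / real n" by (simp add: h_def)
    then show ?thesis using m n by (simp add: field_simps abs_le_iff)
  qed
  have int_h: "\<bar>integral\<^sup>L P f - (\<Sum>k=1..n. measure P (E k)) / real n\<bar> \<le> 1 / real n"
    if "prob_space P" "sets P = sets (A \<Otimes>\<^sub>M B)" for P
  proof -
    interpret P: prob_space P by fact
    note [measurable_cong] = that(2)
    have sp: "space P = space (A \<Otimes>\<^sub>M B)" using that(2) by (rule sets_eq_imp_space_eq)
    have f': "integrable P f"
      using bd by (intro P.integrable_const_bound[of _ 1]) auto
    have iE: "integrable P (indicat_real (E k))" for k
      using E[of k] that(2) by (intro integrable_real_indicator) (auto simp: P.emeasure_eq_measure)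
    have h': "integrable P h"
      unfolding h_def using iE by auto
    have "integral\<^sup>L P h = (\<Sum>k=1..n. measure P (E k)) / real n"
      unfolding h_def using iE E by (simp add: that(2))
    moreover have "\<bar>integral\<^sup>L P f - integral\<^sup>L P h\<bar> \<le> 1 / real n"
    proof -
      have "\<bar>integral\<^sup>L P f - integral\<^sup>L P h\<bar> = \<bar>\<integral>p. f p - h p \<partial>P\<bar>"
        using f' h' by simp
      also have "\<dots> \<le> (\<integral>p. \<bar>f p - h p\<bar> \<partial>P)" by (rule integral_abs_bound)
      also have "\<dots> \<le> (\<integral>p. 1 / real n \<partial>P)"
        using f' h' h by (intro integral_mono) (auto simp: sp)
      finally show ?thesis by (simp add: P.prob_space)
    qed
    ultimately show ?thesis by simp
  qed
  have "\<bar>(\<Sum>k=1..n. measure joint (E k)) / real n - (\<Sum>k=1..n. measure indep (E k)) / real n\<bar>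
      \<le> (\<Sum>k=1..n. \<bar>measure joint (E k) - measure indep (E k)\<bar>) / real n"
    by (simp add: divide_right_mono abs_divide sum_abs flip: diff_divide_distrib sum_subtractf)
  also have "\<dots> \<le> (\<Sum>k=1..n. \<beta>) / real n"
    by (intro divide_right_mono sum_mono measure_diff E) auto
  also have "\<dots> = \<beta>" using n by simp
  finally show "\<bar>integral\<^sup>L joint f - integral\<^sup>L indep f\<bar> \<le> \<beta> + e"
    using int_h[OF joint.prob_space_axioms sets_joint] int_h[OF prob_space_indep sets_indep] n(2)
    by linarith
qed

lemma integral_diff:
  assumes f[measurable]: "f \<in> borel_measurable (A \<Otimes>\<^sub>M B)"
    and bd: "\<And>p. a \<le> f p" "\<And>p. f p \<le> (b::real)"
  shows "\<bar>(\<integral>\<omega>. f (U \<omega>, V \<omega>) \<partial>M) - (\<integral>\<omega>. (\<integral>\<omega>'. f (U \<omega>, V \<omega>') \<partial>M) \<partial>M)\<bar> \<le> (b - a) * \<beta>"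
proof -
  interpret indep': prob_space indep by (rule prob_space_indep)
  have int: "integrable P f" if "prob_space P" "sets P = sets (A \<Otimes>\<^sub>M B)" for P
  proof -
    interpret P: prob_space P by fact
    note [measurable_cong] = that(2)
    show ?thesis
      using bd by (intro P.integrable_const_bound[of _ "\<bar>a\<bar> + \<bar>b\<bar>"] AE_I2)
        (auto simp: abs_le_iff intro: order_trans, (smt (verit) bd)+)
  qed
  have 1: "(\<integral>\<omega>. f (U \<omega>, V \<omega>) \<partial>M) = integral\<^sup>L joint f"
    unfolding joint_def by (subst integral_distr) auto
  have "integral\<^sup>L indep f = (\<integral>x. (\<integral>y. f (x, y) \<partial>distr M B V) \<partial>distr M A U)"
    using int[OF prob_space_indep sets_indep] unfolding indep_def
    by (intro indep.integral_fst'[symmetric])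
  also have "\<dots> = (\<integral>x. (\<integral>\<omega>'. f (x, V \<omega>') \<partial>M) \<partial>distr M A U)"
    by (intro Bochner_Integration.integral_cong refl integral_distr V) auto
  also have "\<dots> = (\<integral>\<omega>. (\<integral>\<omega>'. f (U \<omega>, V \<omega>') \<partial>M) \<partial>M)"
    by (subst integral_distr) auto
  finally have 2: "(\<integral>\<omega>. (\<integral>\<omega>'. f (U \<omega>, V \<omega>') \<partial>M) \<partial>M) = integral\<^sup>L indep f" by simp
  show ?thesis
  proof (cases "a < b")
    case True
    have "\<bar>integral\<^sup>L joint (\<lambda>p. (f p - a) / (b - a)) - integral\<^sup>L indep (\<lambda>p. (f p - a) / (b - a))\<bar> \<le> \<beta>"
      using bd True by (intro integral_diff_unit) (auto simp: field_simps)
    moreover have "integral\<^sup>L P (\<lambda>p. (f p - a) / (b - a)) = (integral\<^sup>L P f - a) / (b - a)"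
      if "prob_space P" "sets P = sets (A \<Otimes>\<^sub>M B)" for P
    proof -
      interpret P: prob_space P by fact
      show ?thesis using int[OF that] by (simp add: P.prob_space)
    qed
    ultimately have "\<bar>(integral\<^sup>L joint f - a) / (b - a) - (integral\<^sup>L indep f - a) / (b - a)\<bar> \<le> \<beta>"
      using joint.prob_space_axioms prob_space_indep sets_joint sets_indep by metis
    then have "\<bar>integral\<^sup>L joint f - integral\<^sup>L indep f\<bar> / (b - a) \<le> \<beta>"
      using True by (simp flip: diff_divide_distrib)
    then show ?thesis
      unfolding 1 2 using True by (simp add: field_simps)
  next
    \<comment> \<open>The values of \<open>f\<close> lie between \<open>a\<close> and
      \<open>b\<close>, so now \<open>a = b\<close> and \<open>f\<close> is constant.\<close>
    case False
    have "f p = b" "a = b" for p using bd[of p] False by auto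
    then have "f = (\<lambda>_. b)" "a = b" by auto
    then show ?thesis by (simp add: prob_space)
  qed
qed

end

section \<open>Mixing coefficients: the suprema are genuine and monotone\<close>

abbreviation dependence :: "'a measure \<Rightarrow> 'a set set \<Rightarrow> 'a set set \<Rightarrow> real" where
  "dependence M P Q \<equiv> (\<Sum>X\<in>P. \<Sum>Y\<in>Q. \<bar>measure M (X \<inter> Y) - measure M X * measure M Y\<bar>)"

lemma partition_sum_measure:
  assumes "finite_measure M" "finite_partition_in M \<F> P" "\<F> \<subseteq> sets M" "E \<in> sets M"
  shows "(\<Sum>X\<in>P. measure M (X \<inter> E)) = measure M E"
proof -
  interpret finite_measure M by fact
  have P: "finite P" "P \<subseteq> sets M" "\<Union>P = space M" and disj: "\<And>X Y. X \<in> P \<Longrightarrow> Y \<in> P \<Longrightarrow> X \<noteq> Y \<Longrightarrow> X \<inter> Y = {}"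
    using assms by (auto simp: finite_partition_in_def)
  have "measure M (\<Union>X\<in>P. X \<inter> E) = (\<Sum>X\<in>P. measure M (X \<inter> E))"
    using P assms(4) by (intro finite_measure_finite_Union) (auto simp: disjoint_family_on_def dest: disj)
  moreover have "(\<Union>X\<in>P. X \<inter> E) = E"
    using P(3) sets.sets_into_space[OF assms(4)] by auto
  ultimately show ?thesis by simp
qed

context prob_space
begin

text \<open>This crude bound makes the set under \<open>Sup\<close> in \<open>beta_coeff\<close>
  bounded above; on the reals \<open>Sup\<close> is informative only for such sets.\<close>

lemma beta_sum_le_2:
  assumes "finite_partition_in M \<F> P" "\<F> \<subseteq> sets M" "finite_partition_in M \<G> Q" "\<G> \<subseteq> sets M"
  shows "dependence M P Q \<le> 2"
proof -
  have PQ: "P \<subseteq> sets M" "Q \<subseteq> sets M" using assms by (auto simp: finite_partition_in_def)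
  have fs: "finite_measure M" by unfold_locales
  have sP: "(\<Sum>X\<in>P. measure M X) = 1"
    using partition_sum_measure[OF fs assms(1,2) sets.top] PQ sets.sets_into_space
    by (simp add: Int_absorb2 subset_iff prob_space cong: sum.cong)
  have sQ: "(\<Sum>X\<in>Q. measure M X) = 1"
    using partition_sum_measure[OF fs assms(3,4) sets.top] PQ sets.sets_into_space
    by (simp add: Int_absorb2 subset_iff prob_space cong: sum.cong)
  have "dependence M P Q
      \<le> (\<Sum>X\<in>P. \<Sum>Y\<in>Q. measure M (Y \<inter> X) + measure M X * measure M Y)"
    by (intro sum_mono) (auto simp: abs_le_iff Int_commute intro: order_trans[OF _ add_increasing])
  also have "\<dots> = (\<Sum>X\<in>P. measure M X + measure M X)"
  proof (intro sum.cong refl)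
    fix X assume "X \<in> P"
    then have "(\<Sum>Y\<in>Q. measure M (Y \<inter> X)) = measure M X"
      using PQ partition_sum_measure[OF fs assms(3,4)] by auto
    then show "(\<Sum>Y\<in>Q. measure M (Y \<inter> X) + measure M X * measure M Y) = measure M X + measure M X"
      by (simp add: sum.distrib sQ flip: sum_distrib_left)
  qed
  also have "\<dots> = 2" by (simp only: sum.distrib sP)
  finally show ?thesis .
qed

lemma beta_coeff_bdd_above:
  assumes "\<F> \<subseteq> sets M" "\<G> \<subseteq> sets M"
  shows "bdd_above {dependence M P Q | P Q.
        finite_partition_in M \<F> P \<and> finite_partition_in M \<G> Q}"
proof (rule bdd_aboveI)
  fix r assume "r \<in> {dependence M P Q | P Q.
        finite_partition_in M \<F> P \<and> finite_partition_in M \<G> Q}"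
  then show "r \<le> 2"
    by (elim CollectE exE conjE) (use beta_sum_le_2 assms in simp)
qed

lemma beta_coeff_upper:
  assumes "\<F> \<subseteq> sets M" "\<G> \<subseteq> sets M" "finite_partition_in M \<F> P" "finite_partition_in M \<G> Q"
  shows "dependence M P Q \<le> 2 * beta_coeff M \<F> \<G>"
proof -
  have "dependence M P Q
     \<le> Sup {dependence M P Q | P Q.
        finite_partition_in M \<F> P \<and> finite_partition_in M \<G> Q}"
  proof (rule cSup_upper[OF _ beta_coeff_bdd_above[OF assms(1,2)]], rule CollectI)
    show "\<exists>P' Q'. dependence M P Q
         = dependence M P' Q'
         \<and> finite_partition_in M \<F> P' \<and> finite_partition_in M \<G> Q'"
      using assms(3,4) by (intro exI[of _ P] exI[of _ Q]) simp
  qed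
  then show ?thesis by (simp add: beta_coeff_def)
qed

lemma beta_coeff_mono:
  assumes "\<F>' \<subseteq> \<F>" "\<G>' \<subseteq> \<G>" "\<F> \<subseteq> sets M" "\<G> \<subseteq> sets M" "space M \<in> \<F>'" "space M \<in> \<G>'"
  shows "beta_coeff M \<F>' \<G>' \<le> beta_coeff M \<F> \<G>"
proof -
  let ?S = "\<lambda>\<F> \<G>. {dependence M P Q | P Q.
        finite_partition_in M \<F> P \<and> finite_partition_in M \<G> Q}"
  have "finite_partition_in M \<F>' {space M}" "finite_partition_in M \<G>' {space M}"
    using assms by (auto simp: finite_partition_in_def)
  then have ne: "?S \<F>' \<G>' \<noteq> {}" by blast
  have mono: "finite_partition_in M \<F>' P \<Longrightarrow> finite_partition_in M \<F> P"
    "finite_partition_in M \<G>' P \<Longrightarrow> finite_partition_in M \<G> P" for P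
    using assms by (auto simp: finite_partition_in_def)
  have "Sup (?S \<F>' \<G>') \<le> 2 * beta_coeff M \<F> \<G>"
  proof (rule cSup_least[OF ne])
    fix r assume "r \<in> ?S \<F>' \<G>'"
    then show "r \<le> 2 * beta_coeff M \<F> \<G>"
      by (elim CollectE exE conjE) (simp only: beta_coeff_upper[OF assms(3,4) mono])
  qed
  then show ?thesis by (simp add: beta_coeff_def)
qed

lemma beta_coeff_bounds:
  assumes "\<F> \<subseteq> sets M" "\<G> \<subseteq> sets M" "space M \<in> \<F>" "space M \<in> \<G>"
  shows "0 \<le> beta_coeff M \<F> \<G>" "beta_coeff M \<F> \<G> \<le> 1"
proof -
  have P: "finite_partition_in M \<F> {space M}" "finite_partition_in M \<G> {space M}"
    using assms by (auto simp: finite_partition_in_def)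
  show "0 \<le> beta_coeff M \<F> \<G>"
    using beta_coeff_upper[OF assms(1,2) P] by (simp add: prob_space)
  show "beta_coeff M \<F> \<G> \<le> 1"
  proof -
    have "Sup {dependence M P Q | P Q.
        finite_partition_in M \<F> P \<and> finite_partition_in M \<G> Q} \<le> 2"
      using P beta_sum_le_2 assms by (intro cSup_least) blast+
    then show ?thesis by (simp add: beta_coeff_def)
  qed
qed

end

lemma gen_sigma_mono: "L \<subseteq> L' \<Longrightarrow> gen_sigma M eps L \<subseteq> gen_sigma M eps L'"
  unfolding gen_sigma_def by (intro sigma_sets_mono') auto

lemma gen_sigma_sets:
  assumes "\<And>i. eps i \<in> borel_measurable M"
  shows "gen_sigma M eps L \<subseteq> sets M"
  unfolding gen_sigma_def using assms by (intro sets.sigma_sets_subset) auto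

lemma space_in_gen_sigma: "space M \<in> gen_sigma M eps L"
  unfolding gen_sigma_def by (rule sigma_sets_top)

locale process = prob_space M for M :: "'a measure" +
  fixes eps :: "int \<Rightarrow> 'a \<Rightarrow> real"
  assumes eps[measurable]: "\<And>i. eps i \<in> borel_measurable M"
begin

lemma beta_mixing_upper:
  assumes "n > 0"
  shows "beta_coeff M (gen_sigma M eps {..k}) (gen_sigma M eps {k + int n..}) \<le> beta_mixing M eps n"
  unfolding beta_mixing_def using assms
  by (auto intro!: cSUP_upper bdd_aboveI2[of _ _ 1] beta_coeff_bounds gen_sigma_sets[OF eps] space_in_gen_sigma)

lemma beta_mixing_nonneg: "0 \<le> beta_mixing M eps n"
proof (cases "n = 0")
  case False
  then show ?thesis
    using beta_mixing_upper[of n 0] beta_coeff_bounds(1)[OF gen_sigma_sets[OF eps] gen_sigma_sets[OF eps]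
        space_in_gen_sigma space_in_gen_sigma] by (meson gr0I order_trans)
qed (simp add: beta_mixing_def)

lemma beta_mixing_antimono:
  assumes "0 < m" "m \<le> n"
  shows "beta_mixing M eps n \<le> beta_mixing M eps m"
proof -
  have "beta_mixing M eps n = (SUP k. beta_coeff M (gen_sigma M eps {..k}) (gen_sigma M eps {k + int n..}))"
    using assms by (simp add: beta_mixing_def)
  also have "\<dots> \<le> beta_mixing M eps m"
  proof (intro cSUP_least)
    fix k :: int
    have "beta_coeff M (gen_sigma M eps {..k}) (gen_sigma M eps {k + int n..})
        \<le> beta_coeff M (gen_sigma M eps {..k}) (gen_sigma M eps {k + int m..})"
      using assms by (intro beta_coeff_mono gen_sigma_mono gen_sigma_sets eps space_in_gen_sigma) auto
    also have "\<dots> \<le> beta_mixing M eps m" by (rule beta_mixing_upper) fact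
    finally show "beta_coeff M (gen_sigma M eps {..k}) (gen_sigma M eps {k + int n..}) \<le> beta_mixing M eps m" .
  qed simp
  finally show ?thesis .
qed

end

section \<open>Path space and mixing across a gap\<close>

abbreviation path_space :: "(int \<Rightarrow> real) measure" where
  "path_space \<equiv> PiM UNIV (\<lambda>_. borel)"

text \<open>Coordinates outside \<open>L\<close> are set to 0 rather than dropped, so that past,
  future and whole path are arguments of the same functionals.\<close>

definition cut :: "int set \<Rightarrow> (int \<Rightarrow> real) \<Rightarrow> int \<Rightarrow> real" where
  "cut L x i = (if i \<in> L then x i else 0)"

text \<open>Gluing a path to an independent one is how dependence across time \<open>t\<close> is
  removed.\<close>

definition glue :: "int \<Rightarrow> (int \<Rightarrow> real) \<Rightarrow> (int \<Rightarrow> real) \<Rightarrow> int \<Rightarrow> real" where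
  "glue t x y i = (if i \<le> t then x i else y i)"

lemma measurable_pathI:
  assumes "\<And>i. (\<lambda>x. f x i) \<in> borel_measurable M"
  shows "f \<in> measurable M path_space"
proof -
  have "(\<lambda>x i. f x i) \<in> measurable M path_space"
    using assms by (intro measurable_PiM_single') auto
  then show ?thesis by simp
qed

lemma measurable_coord[measurable]: "(\<lambda>x. x i) \<in> borel_measurable path_space"
  by (rule measurable_component_singleton) auto

lemma space_path_space: "space path_space = UNIV"
  by (simp add: space_PiM)

lemma measurable_glue[measurable]:
  "(\<lambda>p. glue t (fst p) (snd p)) \<in> measurable (path_space \<Otimes>\<^sub>M path_space) path_space"
  by (rule measurable_pathI) (simp add: glue_def)

lemma cut_preimage_gen_sigma:
  assumes "E \<in> sets path_space"
  shows "{\<omega> \<in> space M. cut L (\<lambda>i. eps i \<omega>) \<in> E} \<in> gen_sigma M eps L"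
proof -
  let ?G = "\<Union>l\<in>L. {eps l -` S \<inter> space M | S. S \<in> sets (borel :: real measure)}"
  let ?N = "sigma (space M) ?G"
  have G: "?G \<subseteq> Pow (space M)" by auto
  have "(\<lambda>\<omega>. cut L (\<lambda>i. eps i \<omega>)) \<in> measurable ?N path_space"
  proof (rule measurable_pathI)
    fix i
    show "(\<lambda>\<omega>. cut L (\<lambda>i. eps i \<omega>) i) \<in> borel_measurable ?N"
    proof (cases "i \<in> L")
      case True
      have "eps i \<in> borel_measurable ?N"
      proof (rule measurableI)
        fix S :: "real set" assume "S \<in> sets borel"
        then show "eps i -` S \<inter> space ?N \<in> sets ?N"
          using True G by (auto simp: sets_measure_of space_measure_of intro!: sigma_sets.Basic)
      qed simp
      then show ?thesis using True by (simp add: cut_def)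
    qed (simp add: cut_def)
  qed
  then have "(\<lambda>\<omega>. cut L (\<lambda>i. eps i \<omega>)) -` E \<inter> space ?N \<in> sets ?N"
    using assms by (rule measurable_sets)
  then show ?thesis
    using G by (simp add: sets_measure_of space_measure_of gen_sigma_def vimage_def Int_def conj_commute)
qed

text \<open>With \<open>c = 0\<close> this says that \<open>F\<close> does not depend on the coordinates in \<open>I\<close>.\<close>
definition osc_le :: "((int \<Rightarrow> real) \<Rightarrow> real) \<Rightarrow> int set \<Rightarrow> real \<Rightarrow> bool" where
  "osc_le F I c \<longleftrightarrow> (\<forall>x y. (\<forall>i. i \<notin> I \<longrightarrow> x i = y i) \<longrightarrow> \<bar>F x - F y\<bar> \<le> c)"

lemma osc_leD: "osc_le F I c \<Longrightarrow> (\<And>i. i \<notin> I \<Longrightarrow> x i = y i) \<Longrightarrow> \<bar>F x - F y\<bar> \<le> c"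
  by (auto simp: osc_le_def)

lemma osc_le_0D: "osc_le F I 0 \<Longrightarrow> (\<And>i. i \<notin> I \<Longrightarrow> x i = y i) \<Longrightarrow> F x = F y"
  using osc_leD[of F I 0 x y] by auto

text \<open>All that the decoupling needs from mixing: for a bounded \<open>F\<close> that ignores
  the gap \<open>{s<..t}\<close>, making its part beyond \<open>t\<close> independent of the rest
  costs \<open>b\<close> times the range, as for a total variation distance
  \<open>b\<close>.\<close>

definition gap_mixing :: "(int \<Rightarrow> real) measure \<Rightarrow> int \<Rightarrow> int \<Rightarrow> real \<Rightarrow> bool" where
  "gap_mixing \<mu> s t b \<longleftrightarrow> (\<forall>F lo hi. F \<in> borel_measurable path_space \<longrightarrow> (\<forall>x. lo \<le> F x \<and> F x \<le> hi) \<longrightarrow>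
     osc_le F {s<..t} 0 \<longrightarrow>
     \<bar>(\<integral>x. F x \<partial>\<mu>) - (\<integral>x. (\<integral>y. F (glue t x y) \<partial>\<mu>) \<partial>\<mu>)\<bar> \<le> (hi - lo) * b)"

context process
begin

definition "path_law = distr M path_space (\<lambda>\<omega> i. eps i \<omega>)"

lemma measurable_path[measurable]: "(\<lambda>\<omega> i. eps i \<omega>) \<in> measurable M path_space"
  by (rule measurable_pathI) measurable

lemma prob_space_path_law: "prob_space path_law"
  unfolding path_law_def by (rule prob_space_distr) measurable

lemma sets_path_law[simp, measurable_cong]: "sets path_law = sets path_space"
  by (simp add: path_law_def)

lemma space_path_law[simp]: "space path_law = UNIV"
  by (simp add: path_law_def space_path_space)

lemma measurable_cut[measurable]: "(\<lambda>\<omega>. cut L (\<lambda>i. eps i \<omega>)) \<in> measurable M path_space"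
  by (rule measurable_pathI) (simp add: cut_def)

lemma finite_partition_simple:
  fixes L :: "int set"
  assumes u: "simple_function path_space (u :: _ \<Rightarrow> nat)"
  defines "X \<equiv> \<lambda>i. {\<omega> \<in> space M. u (cut L (\<lambda>i. eps i \<omega>)) = i}"
  shows "finite_partition_in M (gen_sigma M eps L) (X ` range u)"
proof -
  have "X i \<in> gen_sigma M eps L" for i
    using cut_preimage_gen_sigma[of "u -` {i} \<inter> space path_space" M L eps] simple_functionD(2)[OF u, of "{i}"]
    by (simp add: X_def space_path_space)
  moreover have "finite (range u)"
    using simple_functionD(1)[OF u] by (simp add: space_path_space)
  ultimately show ?thesis
    by (auto simp: finite_partition_in_def X_def)
qed

lemma almost_independent_cut:
  assumes "n > 0"
  shows "almost_independent M path_space path_space (\<lambda>\<omega>. cut {..s} (\<lambda>i. eps i \<omega>))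
     (\<lambda>\<omega>. cut {s + int n..} (\<lambda>i. eps i \<omega>)) (beta_mixing M eps n)"
proof
  fix u v :: "(int \<Rightarrow> real) \<Rightarrow> nat"
  assume u: "simple_function path_space u" and v: "simple_function path_space v"
  define X where "X i = {\<omega> \<in> space M. u (cut {..s} (\<lambda>i. eps i \<omega>)) = i}" for i
  define Y where "Y j = {\<omega> \<in> space M. v (cut {s + int n..} (\<lambda>i. eps i \<omega>)) = j}" for j
  have fin: "finite (range u)" "finite (range v)"
    using simple_functionD(1)[OF u] simple_functionD(1)[OF v] by (simp_all add: space_path_space)
  \<comment> \<open>A partition is a set of sets, so cells with different labels could merge in the
    image. Merging cells are empty and contribute 0, hence the reindexing is lossless.\<close>
  have X0: "X i = {}" if "X i = X i'" "i \<noteq> i'" for i i' using that by (auto simp: X_def)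
  have Y0: "Y i = {}" if "Y i = Y i'" "i \<noteq> i'" for i i' using that by (auto simp: Y_def)
  let ?d = "\<lambda>X Y. \<bar>prob (X \<inter> Y) - prob X * prob Y\<bar>"
  have "(\<Sum>i\<in>range u. \<Sum>j\<in>range v. ?d (X i) (Y j)) = (\<Sum>i\<in>range u. \<Sum>B\<in>Y ` range v. ?d (X i) B)"
  proof (intro sum.cong refl)
    fix i
    show "(\<Sum>j\<in>range v. ?d (X i) (Y j)) = (\<Sum>B\<in>Y ` range v. ?d (X i) B)"
    proof (subst sum.reindex_nontrivial[OF fin(2)])
      fix j j' assume "j \<noteq> j'" "Y j = Y j'"
      then have "Y j = {}" by (intro Y0)
      then show "?d (X i) (Y j) = 0" by simp
    qed simp
  qed
  also have "\<dots> = (\<Sum>A\<in>X ` range u. \<Sum>B\<in>Y ` range v. ?d A B)"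
  proof (subst sum.reindex_nontrivial[OF fin(1)])
    fix i i' assume "i \<noteq> i'" "X i = X i'"
    then have "X i = {}" by (intro X0)
    then show "(\<Sum>B\<in>Y ` range v. ?d (X i) B) = 0" by simp
  qed simp
  also have "\<dots> \<le> 2 * beta_coeff M (gen_sigma M eps {..s}) (gen_sigma M eps {s + int n..})"
    unfolding X_def Y_def
    by (intro beta_coeff_upper finite_partition_simple u v gen_sigma_sets eps)
  also have "\<dots> \<le> 2 * beta_mixing M eps n"
    using beta_mixing_upper[OF assms] by simp
  finally show "(\<Sum>i\<in>u ` space path_space. \<Sum>j\<in>v ` space path_space.
      \<bar>prob {\<omega> \<in> space M. u (cut {..s} (\<lambda>i. eps i \<omega>)) = i \<and> v (cut {s + int n..} (\<lambda>i. eps i \<omega>)) = j}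
      - prob {\<omega> \<in> space M. u (cut {..s} (\<lambda>i. eps i \<omega>)) = i}
        * prob {\<omega> \<in> space M. v (cut {s + int n..} (\<lambda>i. eps i \<omega>)) = j}\<bar>) \<le> 2 * beta_mixing M eps n"
  proof -
    have "{\<omega> \<in> space M. u (cut {..s} (\<lambda>i. eps i \<omega>)) = i \<and> v (cut {s + int n..} (\<lambda>i. eps i \<omega>)) = j} = X i \<inter> Y j"
      for i j by (auto simp: X_def Y_def)
    then show "(\<Sum>i\<in>range u. \<Sum>j\<in>range v. ?d (X i) (Y j)) \<le> 2 * beta_mixing M eps n \<Longrightarrow> ?thesis"
      by (simp only: space_path_space X_def[symmetric] Y_def[symmetric])
  qed
qed measurable

lemma gap_mixing_path_law:
  assumes "s \<le> t"
  shows "gap_mixing path_law s t (beta_mixing M eps (nat (t + 1 - s)))"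
  unfolding gap_mixing_def
proof (intro allI impI)
  fix F :: "(int \<Rightarrow> real) \<Rightarrow> real" and lo hi
  assume F[measurable]: "F \<in> borel_measurable path_space" and bd: "\<forall>x. lo \<le> F x \<and> F x \<le> hi"
    and gap: "osc_le F {s<..t} 0"
  \<comment> \<open>The past ends at \<open>s\<close> and the future starts at \<open>t + 1\<close>,
    so the lag is \<open>t + 1 - s\<close>.\<close>
  define n where "n = nat (t + 1 - s)"
  have n: "n > 0" "s + int n = t + 1" using assms by (auto simp: n_def)
  let ?P = "\<lambda>\<omega> i. eps i \<omega>"
  interpret almost_independent M path_space path_space "\<lambda>\<omega>. cut {..s} (?P \<omega>)" "\<lambda>\<omega>. cut {s + int n..} (?P \<omega>)"
    "beta_mixing M eps n"
    by (rule almost_independent_cut) fact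
  define f where "f p = F (glue s (fst p) (snd p))" for p
  have [measurable]: "f \<in> borel_measurable (path_space \<Otimes>\<^sub>M path_space)" unfolding f_def by measurable
  \<comment> \<open>The glued cut paths differ from the original ones only in the gap, which
    \<open>F\<close> ignores; for the same reason gluing at \<open>s\<close> or at \<open>t\<close>
    makes no difference.\<close>
  have f1: "f (cut {..s} (?P \<omega>), cut {s + int n..} (?P \<omega>)) = F (?P \<omega>)" for \<omega>
    unfolding f_def by (rule osc_le_0D[OF gap]) (auto simp: glue_def cut_def n)
  have f2: "f (cut {..s} (?P \<omega>), cut {s + int n..} (?P \<omega>')) = F (glue t (?P \<omega>) (?P \<omega>'))" for \<omega> \<omega>'
    unfolding f_def using assms by (intro osc_le_0D[OF gap]) (auto simp: glue_def cut_def n)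
  have "\<bar>(\<integral>\<omega>. F (?P \<omega>) \<partial>M) - (\<integral>\<omega>. (\<integral>\<omega>'. F (glue t (?P \<omega>) (?P \<omega>')) \<partial>M) \<partial>M)\<bar> \<le> (hi - lo) * beta_mixing M eps n"
    using integral_diff[of f lo hi] bd unfolding f1 f2 by (simp add: f_def)
  moreover have "(\<integral>x. F x \<partial>path_law) = (\<integral>\<omega>. F (?P \<omega>) \<partial>M)"
    unfolding path_law_def by (rule integral_distr) measurable
  moreover have "(\<integral>x. (\<integral>y. F (glue t x y) \<partial>path_law) \<partial>path_law) = (\<integral>\<omega>. (\<integral>\<omega>'. F (glue t (?P \<omega>) (?P \<omega>')) \<partial>M) \<partial>M)"
  proof -
    interpret L: prob_space path_law by (rule prob_space_path_law)
    have "(\<lambda>p. F (glue t (fst p) (snd p))) \<in> borel_measurable (path_space \<Otimes>\<^sub>M path_law)" by measurable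
    then have "(\<lambda>x. \<integral>y. F (glue t x y) \<partial>path_law) \<in> borel_measurable path_space"
      using L.borel_measurable_lebesgue_integral[of "\<lambda>x y. F (glue t x y)" path_space] by (simp add: case_prod_unfold)
    then have "(\<integral>x. (\<integral>y. F (glue t x y) \<partial>path_law) \<partial>path_law) = (\<integral>\<omega>. (\<integral>y. F (glue t (?P \<omega>) y) \<partial>path_law) \<partial>M)"
      using integral_distr[OF measurable_path, of "\<lambda>x. \<integral>y. F (glue t x y) \<partial>path_law"]
      by (simp only: path_law_def[symmetric])
    also have "\<dots> = (\<integral>\<omega>. (\<integral>\<omega>'. F (glue t (?P \<omega>) (?P \<omega>')) \<partial>M) \<partial>M)"
    proof (intro Bochner_Integration.integral_cong refl)
      fix \<omega>
      have "(\<lambda>y. F (glue t (?P \<omega>) y)) \<in> borel_measurable path_space"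
        by (rule measurable_compose[OF _ F], rule measurable_pathI) (simp add: glue_def)
      then show "(\<integral>y. F (glue t (?P \<omega>) y) \<partial>path_law) = (\<integral>\<omega>'. F (glue t (?P \<omega>) (?P \<omega>')) \<partial>M)"
        unfolding path_law_def by (rule integral_distr[OF measurable_path])
    qed
    finally show ?thesis .
  qed
  ultimately show "\<bar>(\<integral>x. F x \<partial>path_law) - (\<integral>x. (\<integral>y. F (glue t x y) \<partial>path_law) \<partial>path_law)\<bar>
      \<le> (hi - lo) * beta_mixing M eps (nat (t + 1 - s))"
    by (simp add: n_def)
qed

end

section \<open>Decoupling and bounded differences\<close>

text \<open>Under this law the restrictions of the path to the intervals separated by \<open>t 0 < t 1 < \<dots>\<close> are
  independent, each having the law that it has under \<open>\<mu>\<close>.\<close>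
primrec decoupled :: "(int \<Rightarrow> real) measure \<Rightarrow> (nat \<Rightarrow> int) \<Rightarrow> nat \<Rightarrow> (int \<Rightarrow> real) measure" where
  "decoupled \<mu> t 0 = \<mu>"
| "decoupled \<mu> t (Suc k) = distr (decoupled \<mu> t k \<Otimes>\<^sub>M \<mu>) path_space (\<lambda>p. glue (t k) (fst p) (snd p))"

text \<open>Hoeffding's lemma asks for an interval, but only the oscillation is known: the interval
  from the infimum \<open>a\<close> of \<open>f\<close> to \<open>a + c\<close> serves. The bound
  \<open>K\<close> ensures that the infimum is genuine.\<close>

lemma hoeffding_osc:
  fixes f :: "'a \<Rightarrow> real"
  assumes "prob_space P" and [measurable]: "f \<in> borel_measurable P"
    and bd: "\<And>x. \<bar>f x\<bar> \<le> K" and osc: "\<And>x y. \<bar>f x - f y\<bar> \<le> c"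
  shows "(\<integral>x. exp (f x) \<partial>P) \<le> exp ((\<integral>x. f x \<partial>P) + c\<^sup>2 / 8)"
proof -
  interpret P: prob_space P by fact
  have bdd: "bdd_below (range f)" using bd by (intro bdd_belowI[of _ "- K"]) (auto simp: abs_le_iff minus_le_iff)
  define a where "a = (INF x. f x)"
  have a1: "a \<le> f x" for x unfolding a_def using bdd by (rule cINF_lower) simp
  have a2: "f x \<le> a + c" for x
  proof -
    have "f x - c \<le> a" unfolding a_def
    proof (intro cINF_greatest)
      fix y show "f x - c \<le> f y" using osc[of x y] by linarith
    qed simp
    then show ?thesis by simp
  qed
  interpret iv: interval_bounded_random_variable P f a "a + c"
    by unfold_locales (use a1 a2 in auto)
  let ?m = "\<integral>x. f x \<partial>P"
  have "(\<integral>\<^sup>+x. ennreal (exp (1 * (f x - ?m))) \<partial>P) \<le> ennreal (exp (1\<^sup>2 * (a + c - a)\<^sup>2 / 8))"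
    by (rule iv.Hoeffdings_lemma_nn_integral) simp
  moreover have int: "integrable P (\<lambda>x. exp (f x))"
    using bd by (intro P.integrable_const_bound[of _ "exp K"] AE_I2) (auto simp: abs_le_iff)
  then have "(\<integral>\<^sup>+x. ennreal (exp (f x - ?m)) \<partial>P) = ennreal (\<integral>x. exp (f x - ?m) \<partial>P)"
    by (intro nn_integral_eq_integral) (auto simp: exp_diff)
  ultimately have "(\<integral>x. exp (f x - ?m) \<partial>P) \<le> exp (c\<^sup>2 / 8)"
    by simp
  then show ?thesis by (simp add: exp_diff exp_add pos_divide_le_eq mult.commute)
qed

locale path_measure = prob_space \<mu> for \<mu> :: "(int \<Rightarrow> real) measure" +
  assumes sets_mu[simp, measurable_cong]: "sets \<mu> = sets path_space"
begin

text \<open>The conditional expectation of \<open>F\<close> given the coordinates up to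
  \<open>t\<close>, under a law where the later ones are independent of them and distributed as
  under \<open>\<mu>\<close>.\<close>

definition decouple :: "int \<Rightarrow> ((int \<Rightarrow> real) \<Rightarrow> real) \<Rightarrow> (int \<Rightarrow> real) \<Rightarrow> real" where
  "decouple t F x = (\<integral>y. F (glue t x y) \<partial>\<mu>)"

lemma sets_decoupled[simp, measurable_cong]: "sets (decoupled \<mu> t k) = sets path_space"
  by (cases k) auto

lemma prob_space_decoupled: "prob_space (decoupled \<mu> t k)"
proof (induction k)
  case 0
  then show ?case by (simp add: prob_space_axioms)
next
  case (Suc k)
  interpret D: prob_space "decoupled \<mu> t k" by fact
  interpret pair_prob_space "decoupled \<mu> t k" \<mu> ..
  show ?case unfolding decoupled.simps by (rule prob_space_distr) measurable
qed

lemma measurable_glue_snd[measurable (raw)]: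
  assumes "F \<in> borel_measurable path_space"
  shows "(\<lambda>y. F (glue t x y)) \<in> borel_measurable path_space"
  by (rule measurable_compose[OF _ assms], rule measurable_pathI) (simp add: glue_def)

lemma measurable_decouple[measurable (raw)]:
  assumes [measurable]: "F \<in> borel_measurable path_space"
  shows "decouple t F \<in> borel_measurable path_space"
proof -
  have "(\<lambda>p. F (glue t (fst p) (snd p))) \<in> borel_measurable (path_space \<Otimes>\<^sub>M \<mu>)" by measurable
  then show ?thesis
    using borel_measurable_lebesgue_integral[of "\<lambda>x y. F (glue t x y)" path_space]
    unfolding decouple_def[abs_def] by (simp add: case_prod_unfold)
qed

lemma integrable_bounded:
  assumes "prob_space P" "sets P = sets path_space"
    and [measurable]: "F \<in> borel_measurable path_space" and "\<And>x. \<bar>F x\<bar> \<le> (K :: real)"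
  shows "integrable P F"
proof -
  interpret P: prob_space P by fact
  note assms(2)[measurable_cong]
  show ?thesis using assms(4) by (intro P.integrable_const_bound[of _ K]) auto
qed

lemma integrable_glue:
  assumes "F \<in> borel_measurable path_space" "\<And>x. \<bar>F x\<bar> \<le> (K :: real)"
  shows "integrable \<mu> (\<lambda>y. F (glue t x y))"
  using assms by (intro integrable_bounded[OF prob_space_axioms sets_mu]) auto

lemma decouple_mono:
  assumes "F \<in> borel_measurable path_space" "\<And>x. \<bar>F x\<bar> \<le> (K :: real)" "\<And>x. F x \<le> hi"
  shows "decouple t F x \<le> hi"
proof -
  have "decouple t F x \<le> (\<integral>y. hi \<partial>\<mu>)"
    unfolding decouple_def by (intro integral_mono integrable_glue[OF assms(1,2)] assms(3)) auto
  then show ?thesis by (simp add: prob_space)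
qed

lemma decouple_mono':
  assumes "F \<in> borel_measurable path_space" "\<And>x. \<bar>F x\<bar> \<le> (K :: real)" "\<And>x. lo \<le> F x"
  shows "lo \<le> decouple t F x"
proof -
  have "(\<integral>y. lo \<partial>\<mu>) \<le> decouple t F x"
    unfolding decouple_def by (intro integral_mono integrable_glue[OF assms(1,2)] assms(3)) auto
  then show ?thesis by (simp add: prob_space)
qed

lemma decouple_abs_le:
  assumes "F \<in> borel_measurable path_space" "\<And>x. \<bar>F x\<bar> \<le> (K :: real)"
  shows "\<bar>decouple t F x\<bar> \<le> K"
proof -
  have "F x \<le> K" "- K \<le> F x" for x using assms(2)[of x] by linarith+
  then have "decouple t F x \<le> K" "- K \<le> decouple t F x"
    using decouple_mono[OF assms] decouple_mono'[OF assms] by blast+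
  then show ?thesis by linarith
qed

text \<open>Both paths receive the same future \<open>u\<close>, so averaging preserves every
  oscillation bound, including the zero bounds that encode gaps. This keeps the hypotheses of the
  inductions below stable under \<open>decouple\<close>.\<close>

lemma osc_le_decouple:
  assumes "F \<in> borel_measurable path_space" "\<And>x. \<bar>F x\<bar> \<le> (K :: real)" "osc_le F I c"
  shows "osc_le (decouple t F) I c"
  unfolding osc_le_def
proof (intro allI impI)
  fix x y :: "int \<Rightarrow> real" assume xy: "\<forall>i. i \<notin> I \<longrightarrow> x i = y i"
  have d: "\<bar>F (glue t x u) - F (glue t y u)\<bar> \<le> c" for u
    using xy by (intro osc_leD[OF assms(3)]) (auto simp: glue_def)
  have "\<bar>decouple t F x - decouple t F y\<bar> = \<bar>\<integral>u. F (glue t x u) - F (glue t y u) \<partial>\<mu>\<bar>"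
    unfolding decouple_def by (subst Bochner_Integration.integral_diff) (auto intro: integrable_glue assms)
  also have "\<dots> \<le> (\<integral>u. \<bar>F (glue t x u) - F (glue t y u)\<bar> \<partial>\<mu>)" by (rule integral_abs_bound)
  also have "\<dots> \<le> (\<integral>u. c \<partial>\<mu>)"
    using d by (intro integral_mono integrable_abs Bochner_Integration.integrable_diff
        integrable_glue[OF assms(1,2)]) auto
  finally show "\<bar>decouple t F x - decouple t F y\<bar> \<le> c" by (simp add: prob_space)
qed

text \<open>Fubini. It moves the last cut from the law into the functional, so the inductions over
  the number of cuts are run with \<open>F\<close> arbitrary.\<close>

lemma integral_decoupled_Suc:
  assumes [measurable]: "F \<in> borel_measurable path_space" and bd: "\<And>x. \<bar>F x\<bar> \<le> (K :: real)"
  shows "(\<integral>x. F x \<partial>decoupled \<mu> t (Suc k)) = (\<integral>x. decouple (t k) F x \<partial>decoupled \<mu> t k)"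
proof -
  interpret D: prob_space "decoupled \<mu> t k" by (rule prob_space_decoupled)
  interpret P: pair_prob_space "decoupled \<mu> t k" \<mu> ..
  have "(\<integral>x. F x \<partial>decoupled \<mu> t (Suc k)) = (\<integral>p. F (glue (t k) (fst p) (snd p)) \<partial>(decoupled \<mu> t k \<Otimes>\<^sub>M \<mu>))"
    unfolding decoupled.simps by (rule integral_distr) measurable
  also have "\<dots> = (\<integral>x. (\<integral>y. F (glue (t k) (fst (x, y)) (snd (x, y))) \<partial>\<mu>) \<partial>decoupled \<mu> t k)"
    using bd by (intro P.integral_fst'[symmetric] P.integrable_const_bound[of _ K]) auto
  finally show ?thesis by (simp add: decouple_def)
qed

text \<open>One cut at a time. The last cut is compared under \<open>\<mu>\<close> itself by
  \<open>gap_mixing\<close>; the others come from the induction hypothesis for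
  \<open>decouple (t L) F\<close>, which has the same bounds and the same gaps.\<close>

lemma integral_decoupled_close:
  assumes F: "F \<in> borel_measurable path_space" "\<And>x. lo \<le> F x" "\<And>x. F x \<le> hi"
    and gap: "\<And>k. k < L \<Longrightarrow> osc_le F {s k<..t k} 0"
    and mix: "\<And>k. k < L \<Longrightarrow> gap_mixing \<mu> (s k) (t k) b"
  shows "\<bar>(\<integral>x. F x \<partial>decoupled \<mu> t L) - (\<integral>x. F x \<partial>\<mu>)\<bar> \<le> real L * ((hi - lo) * b)"
  using F gap mix
proof (induction L arbitrary: F)
  case 0
  then show ?case by simp
next
  case (Suc L)
  have K: "\<bar>F x\<bar> \<le> \<bar>lo\<bar> + \<bar>hi\<bar>" for x using Suc.prems(2)[of x] Suc.prems(3)[of x] by linarith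
  note F = Suc.prems(1)
  have "\<bar>(\<integral>x. decouple (t L) F x \<partial>decoupled \<mu> t L) - (\<integral>x. decouple (t L) F x \<partial>\<mu>)\<bar> \<le> real L * ((hi - lo) * b)"
    using Suc.prems K by (intro Suc.IH osc_le_decouple[OF F K] measurable_decouple decouple_mono[OF F K] decouple_mono'[OF F K]) auto
  moreover have "\<bar>(\<integral>x. F x \<partial>\<mu>) - (\<integral>x. decouple (t L) F x \<partial>\<mu>)\<bar> \<le> (hi - lo) * b"
    using Suc.prems(5)[of L] Suc.prems(1-4) unfolding gap_mixing_def decouple_def by simp
  ultimately show ?case
    unfolding integral_decoupled_Suc[OF F K] by (simp add: algebra_simps)
qed

text \<open>McDiarmid's exponential moment, by peeling off the last block. With the earlier blocks
  fixed, \<open>F\<close> varies by at most \<open>c\<close>, so Hoeffding's lemma replaces it by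
  its average \<open>H\<close> at the cost of a factor, and \<open>H\<close> no longer reads beyond
  \<open>t L\<close>. \<open>L\<close> cuts separate \<open>Suc L\<close> blocks.\<close>

lemma exp_integral_decoupled:
  assumes F: "F \<in> borel_measurable path_space" "\<And>x. \<bar>F x\<bar> \<le> K"
    and last: "osc_le F {t L<..} 0" and first: "osc_le F {..t 0} c"
    and blocks: "\<And>k. k < L \<Longrightarrow> osc_le F {t k<..t (Suc k)} c"
  shows "(\<integral>x. exp (F x) \<partial>decoupled \<mu> t L) \<le> exp ((\<integral>x. F x \<partial>decoupled \<mu> t L) + real (Suc L) * (c\<^sup>2 / 8))"
  using F last first blocks
proof (induction L arbitrary: F)
  case 0
  have "\<bar>F x - F y\<bar> \<le> c" for x y
  proof -
    have "F (glue (t 0) x y) = F x" by (rule osc_le_0D[OF "0.prems"(3)]) (auto simp: glue_def)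
    moreover have "\<bar>F (glue (t 0) x y) - F y\<bar> \<le> c"
      by (rule osc_leD[OF "0.prems"(4)]) (auto simp: glue_def)
    ultimately show ?thesis by simp
  qed
  then show ?case
    using hoeffding_osc[OF prob_space_axioms, of F K c] "0.prems" by simp
next
  case (Suc L)
  note F = Suc.prems(1,2)
  define H where "H = decouple (t L) F"
  interpret D: prob_space "decoupled \<mu> t L" by (rule prob_space_decoupled)
  have [measurable]: "F \<in> borel_measurable path_space" by fact
  have H[measurable]: "H \<in> borel_measurable path_space" unfolding H_def by measurable
  have HK: "\<bar>H x\<bar> \<le> K" for x unfolding H_def by (rule decouple_abs_le[OF F])
  have expF: "(\<lambda>x. exp (F x)) \<in> borel_measurable path_space" "\<bar>exp (F x)\<bar> \<le> exp K" for x
    using F(2)[of x] by auto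
  have step: "decouple (t L) (\<lambda>x. exp (F x)) x \<le> exp (H x + c\<^sup>2 / 8)" for x
  proof -
    have osc: "\<bar>F (glue (t L) x y) - F (glue (t L) x y')\<bar> \<le> c" for y y'
    proof -
      \<comment> \<open>An intermediate path: from the first glued path to \<open>?w\<close> only
        the block up to \<open>t (Suc L)\<close> changes, at cost \<open>c\<close>; from
        \<open>?w\<close> to the second only coordinates that \<open>F\<close> ignores.\<close>
      let ?w = "\<lambda>i. if i > t (Suc L) then glue (t L) x y i else glue (t L) x y' i"
      have "F ?w = F (glue (t L) x y')"
        by (rule osc_le_0D[OF Suc.prems(3)]) auto
      moreover have "\<bar>F (glue (t L) x y) - F ?w\<bar> \<le> c"
        by (rule osc_leD[OF Suc.prems(5)[of L]]) (auto simp: glue_def)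
      ultimately show ?thesis by simp
    qed
    have "(\<integral>y. exp (F (glue (t L) x y)) \<partial>\<mu>) \<le> exp ((\<integral>y. F (glue (t L) x y) \<partial>\<mu>) + c\<^sup>2 / 8)"
      using measurable_glue_snd[OF F(1)] measurable_cong_sets[OF sets_mu refl]
      by (intro hoeffding_osc[OF prob_space_axioms _ F(2) osc]) blast
    then show ?thesis by (simp add: decouple_def H_def)
  qed
  have "(\<integral>x. exp (F x) \<partial>decoupled \<mu> t (Suc L)) = (\<integral>x. decouple (t L) (\<lambda>x. exp (F x)) x \<partial>decoupled \<mu> t L)"
    by (rule integral_decoupled_Suc[OF expF])
  also have "\<dots> \<le> (\<integral>x. exp (H x + c\<^sup>2 / 8) \<partial>decoupled \<mu> t L)"
  proof (intro integral_mono step)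
    show "integrable (decoupled \<mu> t L) (decouple (t L) (\<lambda>x. exp (F x)))"
      by (rule integrable_bounded[OF D.prob_space_axioms sets_decoupled measurable_decouple[OF expF(1)]
          decouple_abs_le[OF expF]])
    have "\<bar>exp (H x + c\<^sup>2 / 8)\<bar> \<le> exp (K + c\<^sup>2 / 8)" for x using HK[of x] by auto
    then show "integrable (decoupled \<mu> t L) (\<lambda>x. exp (H x + c\<^sup>2 / 8))"
      by (intro integrable_bounded[OF D.prob_space_axioms sets_decoupled, of _ "exp (K + c\<^sup>2 / 8)"]) simp_all
  qed
  also have "\<dots> = exp (c\<^sup>2 / 8) * (\<integral>x. exp (H x) \<partial>decoupled \<mu> t L)"
    by (simp add: exp_add)
  also have "\<dots> \<le> exp (c\<^sup>2 / 8) * exp ((\<integral>x. H x \<partial>decoupled \<mu> t L) + real (Suc L) * (c\<^sup>2 / 8))"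
  proof (intro mult_left_mono Suc.IH H HK)
    show "osc_le H {t L<..} 0"
      unfolding osc_le_def
    proof (intro allI impI)
      fix x y :: "int \<Rightarrow> real" assume "\<forall>i. i \<notin> {t L<..} \<longrightarrow> x i = y i"
      then have "glue (t L) x u = glue (t L) y u" for u by (auto simp: glue_def fun_eq_iff)
      then show "\<bar>H x - H y\<bar> \<le> 0" by (simp add: H_def decouple_def)
    qed
    show "osc_le H {..t 0} c" unfolding H_def by (rule osc_le_decouple[OF F Suc.prems(4)])
    show "osc_le H {t k<..t (Suc k)} c" if "k < L" for k
      unfolding H_def using that by (intro osc_le_decouple[OF F] Suc.prems(5)) auto
  qed auto
  also have "(\<integral>x. H x \<partial>decoupled \<mu> t L) = (\<integral>x. F x \<partial>decoupled \<mu> t (Suc L))"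
    unfolding H_def by (rule integral_decoupled_Suc[OF F, symmetric])
  also have "exp (c\<^sup>2 / 8) * exp ((\<integral>x. F x \<partial>decoupled \<mu> t (Suc L)) + real (Suc L) * (c\<^sup>2 / 8))
      = exp ((\<integral>x. F x \<partial>decoupled \<mu> t (Suc L)) + real (Suc (Suc L)) * (c\<^sup>2 / 8))"
    unfolding exp_add[symmetric] by (simp add: field_simps del: decoupled.simps)
  finally show ?case .
qed

lemma osc_le_cmult:
  assumes "osc_le F I c" "l \<ge> 0"
  shows "osc_le (\<lambda>x. l * F x) I (l * c)"
  using assms unfolding osc_le_def
  by (auto simp: abs_mult mult_left_mono simp flip: right_diff_distrib)

text \<open>Mixing is paid for twice: for the event, which gives \<open>real L * b\<close>, and for
  the mean, which uses up one \<open>\<tau>\<close>. The other \<open>\<tau>\<close> is the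
  deviation under the decoupled law, bounded by Chernoff with the parameter \<open>l\<close> left
  free.\<close>

theorem mcdiarmid_gap_mixing:
  assumes F: "F \<in> borel_measurable path_space" "\<And>x. \<bar>F x\<bar> \<le> K"
    and last: "osc_le F {t L<..} 0" and first: "osc_le F {..t 0} c"
    and blocks: "\<And>k. k < L \<Longrightarrow> osc_le F {t k<..t (Suc k)} c"
    and gap: "\<And>k. k < L \<Longrightarrow> osc_le F {s k<..t k} 0"
    and mix: "\<And>k. k < L \<Longrightarrow> gap_mixing \<mu> (s k) (t k) b"
    and \<tau>: "real L * (2 * K * b) \<le> \<tau>" and l: "l > 0"
  shows "prob {x. F x \<ge> (\<integral>x. F x \<partial>\<mu>) + 2 * \<tau>}
      \<le> exp (real (Suc L) * (l * c)\<^sup>2 / 8 - l * \<tau>) + real L * b"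
proof -
  let ?\<nu> = "decoupled \<mu> t L"
  interpret D: prob_space ?\<nu> by (rule prob_space_decoupled)
  note [measurable] = F(1)
  define m where "m = (\<integral>x. F x \<partial>?\<nu>)"
  have "\<bar>m - (\<integral>x. F x \<partial>\<mu>)\<bar> \<le> real L * ((K - - K) * b)"
    unfolding m_def using F(2)
    by (intro integral_decoupled_close[OF F(1) _ _ gap mix]) (auto simp: abs_le_iff minus_le_iff)
  then have m: "m \<le> (\<integral>x. F x \<partial>\<mu>) + \<tau>" using \<tau> by auto
  define A where "A = {x. F x \<ge> m + \<tau>}"
  have A[measurable]: "A \<in> sets path_space"
    using measurable_sets[OF F(1), of "{m + \<tau>..}"]
    by (simp add: A_def vimage_def space_path_space)
  have sp: "space \<mu> = UNIV" "space ?\<nu> = UNIV"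
    using sets_eq_imp_space_eq[OF sets_mu] sets_eq_imp_space_eq[OF sets_decoupled[of t L]]
    by (auto simp: space_path_space)
  have "prob {x. F x \<ge> (\<integral>x. F x \<partial>\<mu>) + 2 * \<tau>} \<le> prob A"
  proof (rule finite_measure_mono)
    show "{x. (\<integral>x. F x \<partial>\<mu>) + 2 * \<tau> \<le> F x} \<subseteq> A" using m by (auto simp: A_def)
  qed (simp add: A)
  also have "\<dots> \<le> D.prob A + real L * b"
  proof -
    \<comment> \<open>The event depends on the path only through \<open>F\<close>, so it ignores the
      same gaps.\<close>
    have "osc_le (indicat_real A) {s k<..t k} 0" if "k < L" for k
      unfolding osc_le_def
    proof (intro allI impI)
      fix x y :: "int \<Rightarrow> real" assume "\<forall>i. i \<notin> {s k<..t k} \<longrightarrow> x i = y i"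
      then have "F x = F y" by (intro osc_le_0D[OF gap[OF that]]) blast
      then show "\<bar>indicat_real A x - indicat_real A y\<bar> \<le> 0" by (simp add: A_def indicator_def)
    qed
    then have "\<bar>(\<integral>x. indicat_real A x \<partial>?\<nu>) - (\<integral>x. indicat_real A x \<partial>\<mu>)\<bar> \<le> real L * ((1 - 0) * b)"
      by (intro integral_decoupled_close[OF _ _ _ _ mix]) auto
    then show ?thesis by (simp add: sp abs_le_iff)
  qed
  also have "D.prob A \<le> exp (real (Suc L) * (l * c)\<^sup>2 / 8 - l * \<tau>)"
  proof -
    have ex: "\<bar>exp (l * F x)\<bar> \<le> exp (l * K)" for x
      using F(2)[of x] l by auto
    have "D.prob A = (\<integral>x. indicat_real A x \<partial>?\<nu>)" by (simp add: sp)
    also have "\<dots> \<le> (\<integral>x. exp (- l * m - l * \<tau>) * exp (l * F x) \<partial>?\<nu>)"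
    proof (rule integral_mono)
      show "integrable ?\<nu> (indicat_real A)"
        by (intro integrable_real_indicator) (auto simp: D.emeasure_eq_measure)
      show "integrable ?\<nu> (\<lambda>x. exp (- l * m - l * \<tau>) * exp (l * F x))"
        by (intro integrable_mult_right integrable_bounded[OF D.prob_space_axioms sets_decoupled _ ex]) measurable
      fix x
      show "indicat_real A x \<le> exp (- l * m - l * \<tau>) * exp (l * F x)"
      proof (cases "x \<in> A")
        case True
        then have "0 \<le> l * (F x - m - \<tau>)" using l by (auto simp: A_def)
        then have "1 \<le> exp (- l * m - l * \<tau> + l * F x)" by (simp add: algebra_simps)
        with True show ?thesis by (simp add: exp_add)
      qed auto
    qed
    also have "\<dots> = exp (- l * m - l * \<tau>) * (\<integral>x. exp (l * F x) \<partial>?\<nu>)" by simp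
    also have "(\<integral>x. exp (l * F x) \<partial>?\<nu>) \<le> exp ((\<integral>x. l * F x \<partial>?\<nu>) + real (Suc L) * ((l * c)\<^sup>2 / 8))"
    proof (rule exp_integral_decoupled)
      show "\<bar>l * F x\<bar> \<le> l * K" for x using F(2)[of x] l by (simp add: abs_mult)
      show "osc_le (\<lambda>x. l * F x) {t L<..} 0" using osc_le_cmult[OF last, of l] l by simp
    qed (use l in \<open>auto intro!: osc_le_cmult first blocks\<close>)
    also have "exp (- l * m - l * \<tau>) * exp ((\<integral>x. l * F x \<partial>?\<nu>) + real (Suc L) * ((l * c)\<^sup>2 / 8))
        = exp (real (Suc L) * (l * c)\<^sup>2 / 8 - l * \<tau>)"
      by (simp add: m_def exp_add[symmetric])
    finally show ?thesis by (simp add: mult_left_mono)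
  qed
  finally show ?thesis by simp
qed

end

section \<open>Maximal inequality and finite-window approximation\<close>

text \<open>Garsia's argument for \<open>f = Z - l\<close>. Where the maximum \<open>mx\<close> of
  the partial sums is positive, \<open>f\<close> is at least \<open>mx\<close> minus
  \<open>mx\<close> after \<open>T\<close>; elsewhere this difference is at most 0, and its integral
  vanishes by invariance. So \<open>f\<close> has nonnegative integral over that set, which is the
  claimed bound.\<close>

lemma hopf_maximal_inequality:
  fixes Z :: "'a \<Rightarrow> real"
  assumes "prob_space M" and T[measurable]: "T \<in> measurable M M" and inv: "distr M M T = M"
    and Z: "integrable M Z" "\<And>x. 0 \<le> Z x" and l: "l > 0"
  shows "measure M {x \<in> space M. \<exists>n. (\<Sum>k<n. Z ((T ^^ k) x)) > l * real n} \<le> (\<integral>x. Z x \<partial>M) / l"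
proof -
  interpret prob_space M by fact
  have [measurable]: "Z \<in> borel_measurable M" using Z by auto
  define f where "f x = Z x - l" for x
  have f: "integrable M f" unfolding f_def using Z by auto
  then have [measurable]: "f \<in> borel_measurable M" by auto
  \<comment> \<open>The maximum of the partial sums of \<open>f\<close> along the orbit, up to time \<open>n\<close>.\<close>
  define mx where "mx = rec_nat (\<lambda>x. 0 :: real) (\<lambda>n m x. max 0 (f x + m (T x)))"
  have mx0: "mx 0 x = 0" and mxS: "mx (Suc n) x = max 0 (f x + mx n (T x))" for n x
    by (simp_all add: mx_def)
  have mx_int: "integrable M (mx n)" for n
  proof (induction n)
    case (Suc n)
    have "integrable M (\<lambda>x. mx n (T x))"
      by (rule integrable_distr[OF T]) (simp add: inv Suc)
    then have "integrable M (\<lambda>x. max 0 (f x + mx n (T x)))" using f by auto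
    moreover have "mx (Suc n) = (\<lambda>x. max 0 (f x + mx n (T x)))" by (rule ext) (rule mxS)
    ultimately show ?case by simp
  next
    case 0
    have "mx 0 = (\<lambda>x. 0)" by (rule ext) (rule mx0)
    then show ?case by simp
  qed
  have mx_nonneg: "0 \<le> mx n x" for n x by (cases n) (auto simp: mx0 mxS)
  have mx_mono: "mx n x \<le> mx (Suc n) x" for n x
    by (induction n arbitrary: x) (auto simp: mx0 mxS max.coboundedI2)
  have mx_ge: "(\<Sum>k<j. f ((T ^^ k) x)) \<le> mx n x" if "j \<le> n" for j n x
    using that
  proof (induction n arbitrary: j x)
    case (Suc n)
    show ?case
    proof (cases j)
      case (Suc i)
      have "(\<Sum>k<Suc i. f ((T ^^ k) x)) = f x + (\<Sum>k<i. f ((T ^^ k) (T x)))"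
        by (subst sum.lessThan_Suc_shift) (simp add: funpow_swap1)
      also have "\<dots> \<le> f x + mx n (T x)" using Suc.IH[of i "T x"] Suc.prems Suc by simp
      finally show ?thesis using Suc by (simp add: mxS)
    qed (simp add: mx_nonneg)
  qed (simp add: mx0)
  define A where "A n = {x \<in> space M. mx n x > 0}" for n
  have mx_meas[measurable]: "mx n \<in> borel_measurable M" for n using mx_int by auto
  have A[measurable]: "A n \<in> sets M" for n unfolding A_def by measurable
  have bound: "prob (A (Suc n)) \<le> (\<integral>x. Z x \<partial>M) / l" for n
  proof -
    have iT: "integrable M (\<lambda>x. mx (Suc n) (T x))"
      by (rule integrable_distr[OF T]) (simp add: inv mx_int)
    have "(\<integral>x. mx (Suc n) (T x) \<partial>M) = (\<integral>x. mx (Suc n) x \<partial>M)"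
      using integral_distr[OF T mx_meas[of "Suc n"]] by (simp add: inv)
    then have "0 = (\<integral>x. mx (Suc n) x - mx (Suc n) (T x) \<partial>M)"
      using iT mx_int by simp
    also have "\<dots> \<le> (\<integral>x. indicat_real (A (Suc n)) x * f x \<partial>M)"
    proof (rule integral_mono)
      show "integrable M (\<lambda>x. indicat_real (A (Suc n)) x * f x)"
        using integrable_real_mult_indicator[OF A f] by (simp add: mult.commute)
      fix x assume x: "x \<in> space M"
      show "mx (Suc n) x - mx (Suc n) (T x) \<le> indicat_real (A (Suc n)) x * f x"
      proof (cases "x \<in> A (Suc n)")
        case True
        then have "mx (Suc n) x = f x + mx n (T x)" by (auto simp: A_def mxS max_def split: if_splits)
        then show ?thesis using True mx_mono[of n "T x"] by simp
      next
        case False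
        then have "mx (Suc n) x = 0" using x mx_nonneg[of "Suc n" x] by (auto simp: A_def)
        then show ?thesis using False mx_nonneg[of "Suc n" "T x"] by simp
      qed
    qed (use iT mx_int in auto)
    also have "\<dots> = (\<integral>x. indicat_real (A (Suc n)) x * Z x \<partial>M) - l * prob (A (Suc n))"
    proof -
      have "(\<lambda>x. indicat_real (A (Suc n)) x * f x) = (\<lambda>x. indicat_real (A (Suc n)) x * Z x - l * indicat_real (A (Suc n)) x)"
        by (auto simp: f_def fun_eq_iff algebra_simps)
      moreover have "integrable M (\<lambda>x. indicat_real (A (Suc n)) x * Z x)"
        using integrable_real_mult_indicator[OF A Z(1)] by (simp add: mult.commute)
      moreover have "integrable M (indicat_real (A (Suc n)))"
        by (rule integrable_real_indicator) (auto simp: emeasure_eq_measure)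
      ultimately show ?thesis using A by simp
    qed
    also have "(\<integral>x. indicat_real (A (Suc n)) x * Z x \<partial>M) \<le> (\<integral>x. Z x \<partial>M)"
      using Z integrable_real_mult_indicator[OF A Z(1)]
      by (intro integral_mono) (auto simp: mult.commute indicator_def)
    finally show ?thesis using l by (simp add: field_simps)
  qed
  have "incseq (\<lambda>n. A (Suc n))"
    using mx_mono by (intro incseq_SucI) (force simp: A_def intro: less_le_trans)
  then have "(\<lambda>n. prob (A (Suc n))) \<longlonglongrightarrow> prob (\<Union>n. A (Suc n))"
    by (intro finite_Lim_measure_incseq) auto
  then have "prob (\<Union>n. A (Suc n)) \<le> (\<integral>x. Z x \<partial>M) / l"
    using bound by (intro LIMSEQ_le_const2) auto
  moreover have "{x \<in> space M. \<exists>n. (\<Sum>k<n. Z ((T ^^ k) x)) > l * real n} \<subseteq> (\<Union>n. A (Suc n))"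
  proof
    fix x assume "x \<in> {x \<in> space M. \<exists>n. (\<Sum>k<n. Z ((T ^^ k) x)) > l * real n}"
    then obtain n where x: "x \<in> space M" and n: "(\<Sum>k<n. Z ((T ^^ k) x)) > l * real n" by auto
    have "(\<Sum>k<n. f ((T ^^ k) x)) = (\<Sum>k<n. Z ((T ^^ k) x)) - l * real n"
      by (simp add: f_def sum_subtractf)
    then have "mx (Suc n) x > 0" using n mx_ge[of n "Suc n" x] by simp
    then show "x \<in> (\<Union>n. A (Suc n))" using x by (auto simp: A_def)
  qed
  ultimately show ?thesis
    by (meson finite_measure_mono order_trans sets.countable_UN A range_subsetD subsetI sets.countable_nat_UN image_subsetI)
qed

section \<open>Density of finite-window functions among square-integrable ones\<close>

definition sq_integrable :: "'a measure \<Rightarrow> ('a \<Rightarrow> real) \<Rightarrow> bool" where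
  "sq_integrable M f \<longleftrightarrow> f \<in> borel_measurable M \<and> integrable M (\<lambda>x. (f x)\<^sup>2)"

lemma sq_integrable_le:
  assumes "f \<in> borel_measurable M" "integrable M h" "\<And>x. x \<in> space M \<Longrightarrow> (f x)\<^sup>2 \<le> h x"
  shows "sq_integrable M f"
  unfolding sq_integrable_def
proof
  show "integrable M (\<lambda>x. (f x)\<^sup>2)"
    using assms by (intro Bochner_Integration.integrable_bound[OF assms(2)] AE_I2) (auto intro: order_trans[OF _ abs_ge_self])
qed fact

lemma sq_integrable_add:
  assumes "sq_integrable M f" "sq_integrable M h"
  shows "sq_integrable M (\<lambda>x. f x + h x)"
proof (rule sq_integrable_le[where h = "\<lambda>x. 2 * (f x)\<^sup>2 + 2 * (h x)\<^sup>2"])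
  show "(f x + h x)\<^sup>2 \<le> 2 * (f x)\<^sup>2 + 2 * (h x)\<^sup>2" for x
    using zero_le_power2[of "f x - h x"] by (simp add: power2_eq_square algebra_simps)
qed (use assms in \<open>auto simp: sq_integrable_def\<close>)

lemma sq_integrable_cmult: "sq_integrable M f \<Longrightarrow> sq_integrable M (\<lambda>x. c * f x)"
  by (auto simp: sq_integrable_def power_mult_distrib)

lemma sq_integrable_diff:
  assumes "sq_integrable M f" "sq_integrable M h"
  shows "sq_integrable M (\<lambda>x. f x - h x)"
  using sq_integrable_add[OF assms(1) sq_integrable_cmult[OF assms(2), of "-1"]] by simp

lemma integral_sq_add_le:
  assumes "sq_integrable M f" "sq_integrable M h"
  shows "(\<integral>x. (f x + h x)\<^sup>2 \<partial>M) \<le> 2 * (\<integral>x. (f x)\<^sup>2 \<partial>M) + 2 * (\<integral>x. (h x)\<^sup>2 \<partial>M)"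
proof -
  have "(\<integral>x. (f x + h x)\<^sup>2 \<partial>M) \<le> (\<integral>x. 2 * (f x)\<^sup>2 + 2 * (h x)\<^sup>2 \<partial>M)"
  proof (rule integral_mono)
    show "(f x + h x)\<^sup>2 \<le> 2 * (f x)\<^sup>2 + 2 * (h x)\<^sup>2" for x
      using zero_le_power2[of "f x - h x"] by (simp add: power2_eq_square algebra_simps)
  qed (use assms sq_integrable_add[OF assms] in \<open>auto simp: sq_integrable_def\<close>)
  then show ?thesis using assms by (simp add: sq_integrable_def)
qed

text \<open>The range type is left open so that the notion also covers the membership predicate of
  an event.\<close>

definition finite_window :: "nat \<Rightarrow> ((int \<Rightarrow> real) \<Rightarrow> 'b) \<Rightarrow> bool" where
  "finite_window m h \<longleftrightarrow> (\<forall>x y. (\<forall>i. \<bar>i\<bar> \<le> int m \<longrightarrow> x i = y i) \<longrightarrow> h x = h y)"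

lemma finite_window_mono: "finite_window m h \<Longrightarrow> m \<le> m' \<Longrightarrow> finite_window m' h"
  unfolding finite_window_def by (meson of_nat_mono order_trans)

lemma finite_window_comp2:
  assumes "finite_window m h" "finite_window m' h'"
  shows "finite_window (max m m') (\<lambda>x. f (h x) (h' x))"
proof -
  have "finite_window (max m m') h" "finite_window (max m m') h'"
    using assms by (auto elim: finite_window_mono)
  then show ?thesis unfolding finite_window_def by metis
qed

definition window_approx :: "(int \<Rightarrow> real) measure \<Rightarrow> ((int \<Rightarrow> real) \<Rightarrow> real) \<Rightarrow> bool" where
  "window_approx \<mu> f \<longleftrightarrow> (\<forall>e>0. \<exists>m h. h \<in> borel_measurable path_space \<and> finite_window m h \<and> sq_integrable \<mu> h
      \<and> (\<integral>x. (f x - h x)\<^sup>2 \<partial>\<mu>) < e)"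

lemma window_approx_add:
  assumes "sq_integrable \<mu> u" "sq_integrable \<mu> v" "window_approx \<mu> u" "window_approx \<mu> v"
  shows "window_approx \<mu> (\<lambda>x. u x + v x)"
  unfolding window_approx_def
proof (intro allI impI)
  fix e :: real assume "e > 0"
  then have "e / 4 > 0" by simp
  then obtain m h m' h' where
    h: "h \<in> borel_measurable path_space" "finite_window m h" "sq_integrable \<mu> h" "(\<integral>x. (u x - h x)\<^sup>2 \<partial>\<mu>) < e / 4" and
    h': "h' \<in> borel_measurable path_space" "finite_window m' h'" "sq_integrable \<mu> h'" "(\<integral>x. (v x - h' x)\<^sup>2 \<partial>\<mu>) < e / 4"
    using assms(3,4) unfolding window_approx_def by meson
  have "(\<integral>x. (u x + v x - (h x + h' x))\<^sup>2 \<partial>\<mu>) = (\<integral>x. ((u x - h x) + (v x - h' x))\<^sup>2 \<partial>\<mu>)"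
    by (simp add: algebra_simps)
  also have "\<dots> \<le> 2 * (\<integral>x. (u x - h x)\<^sup>2 \<partial>\<mu>) + 2 * (\<integral>x. (v x - h' x)\<^sup>2 \<partial>\<mu>)"
    by (intro integral_sq_add_le sq_integrable_diff assms h h')
  also have "\<dots> < e" using h(4) h'(4) by simp
  finally show "\<exists>m h. h \<in> borel_measurable path_space \<and> finite_window m h \<and> sq_integrable \<mu> h
      \<and> (\<integral>x. (u x + v x - h x)\<^sup>2 \<partial>\<mu>) < e"
    using h h' by (intro exI[of _ "max m m'"] exI[of _ "\<lambda>x. h x + h' x"] conjI finite_window_comp2 sq_integrable_add) auto
qed

lemma window_approx_cmult:
  assumes "window_approx \<mu> u"
  shows "window_approx \<mu> (\<lambda>x. c * u x)"
  unfolding window_approx_def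
proof (intro allI impI)
  fix e :: real assume "e > 0"
  then have "e / (c\<^sup>2 + 1) > 0" by (simp add: add_nonneg_pos)
  then obtain m h where h: "h \<in> borel_measurable path_space" "finite_window m h" "sq_integrable \<mu> h"
      "(\<integral>x. (u x - h x)\<^sup>2 \<partial>\<mu>) < e / (c\<^sup>2 + 1)"
    using assms unfolding window_approx_def by meson
  have "(\<integral>x. (c * u x - c * h x)\<^sup>2 \<partial>\<mu>) = c\<^sup>2 * (\<integral>x. (u x - h x)\<^sup>2 \<partial>\<mu>)"
    by (simp add: power_mult_distrib flip: right_diff_distrib)
  also have "\<dots> \<le> (c\<^sup>2 + 1) * (\<integral>x. (u x - h x)\<^sup>2 \<partial>\<mu>)"
    by (intro mult_right_mono) auto
  also have "\<dots> < e"
    using h(4) by (subst (asm) pos_less_divide_eq) (auto simp: add_nonneg_pos mult.commute)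
  finally show "\<exists>m h. h \<in> borel_measurable path_space \<and> finite_window m h \<and> sq_integrable \<mu> h
      \<and> (\<integral>x. (c * u x - h x)\<^sup>2 \<partial>\<mu>) < e"
    using h finite_window_comp2[OF h(2) h(2), of "\<lambda>a b. c * a"]
    by (intro exI[of _ "max m m"] exI[of _ "\<lambda>x. c * h x"] conjI sq_integrable_cmult) auto
qed

text \<open>Events with a finite window form an algebra that contains the one-coordinate events, so
  \<open>sigma_sets_approx\<close> applies, with both measures equal to \<open>\<mu>\<close>. The
  squared difference of two indicators is the indicator of the symmetric difference.\<close>

lemma window_approx_indicator:
  assumes "prob_space \<mu>" and sets[simp, measurable_cong]: "sets \<mu> = sets path_space" and A: "A \<in> sets path_space"
  shows "window_approx \<mu> (indicat_real A)"
  unfolding window_approx_def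
proof (intro allI impI)
  fix e :: real assume "e > 0"
  interpret prob_space \<mu> by fact
  have sp: "space \<mu> = UNIV" using sets_eq_imp_space_eq[OF sets] by (simp add: space_path_space)
  define \<W> where "\<W> = {A \<in> sets path_space. \<exists>m. finite_window m (\<lambda>x. x \<in> A)}"
  have "\<exists>B\<in>\<W>. measure \<mu> (sym_diff A B) + measure \<mu> (sym_diff A B) < e"
  proof (rule sigma_sets_approx[where G = "{{f \<in> \<Pi>\<^sub>E i\<in>UNIV. space borel. f i \<in> A} |i A. i \<in> UNIV \<and> A \<in> sets borel}"])
    show "A \<in> sigma_sets (space \<mu>) {{f \<in> \<Pi>\<^sub>E i\<in>UNIV. space borel. f i \<in> A} |i A. i \<in> UNIV \<and> A \<in> sets borel}"
      using A unfolding sets_PiM_single by (simp add: sp)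
    show "\<W> \<subseteq> sets \<mu>" by (auto simp: \<W>_def)
    show "space \<mu> - B \<in> \<W>" if "B \<in> \<W>" for B
      using that sets.Diff[OF sets.top, of B path_space] unfolding \<W>_def finite_window_def
      by (auto simp: sp space_path_space)
    show "B \<union> C \<in> \<W>" if BC: "B \<in> \<W>" "C \<in> \<W>" for B C
    proof -
      obtain m m' where "finite_window m (\<lambda>x. x \<in> B)" "finite_window m' (\<lambda>x. x \<in> C)"
        using BC by (auto simp: \<W>_def)
      from finite_window_comp2[OF this, of "(\<or>)"] show ?thesis
        using that by (auto simp: \<W>_def)
    qed
    show "{{f \<in> \<Pi>\<^sub>E i\<in>UNIV. space borel. f i \<in> A} |i A. i \<in> UNIV \<and> A \<in> sets borel} \<subseteq> \<W>"
    proof safe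
      fix i :: int and A :: "real set" assume "A \<in> sets borel"
      then have "(\<lambda>x. x i) -` A \<inter> space path_space \<in> sets path_space"
        by (rule measurable_sets[OF measurable_coord])
      then have "{f \<in> \<Pi>\<^sub>E i\<in>UNIV. space borel. f i \<in> A} \<in> sets path_space"
        by (simp add: space_path_space vimage_def)
      moreover have "finite_window (nat \<bar>i\<bar>) (\<lambda>x. x \<in> {f \<in> \<Pi>\<^sub>E i\<in>UNIV. space borel. f i \<in> A})"
        by (auto simp: finite_window_def)
      ultimately show "{f \<in> \<Pi>\<^sub>E i\<in>UNIV. space borel. f i \<in> A} \<in> \<W>" by (auto simp: \<W>_def)
    qed
    show "{} \<in> \<W>" by (auto simp: \<W>_def finite_window_def)
  qed (use \<open>e > 0\<close> finite_measure_axioms in auto)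
  then obtain B m where B: "B \<in> sets path_space" "finite_window m (\<lambda>x. x \<in> B)" "2 * measure \<mu> (sym_diff A B) < e"
    by (auto simp: \<W>_def)
  have "(indicat_real A x - indicat_real B x)\<^sup>2 = indicat_real (sym_diff A B) x" for x
    by (auto simp: indicator_def)
  then have "(\<integral>x. (indicat_real A x - indicat_real B x)\<^sup>2 \<partial>\<mu>) = measure \<mu> (sym_diff A B)"
    by (simp add: sp)
  also have "\<dots> < e" using B(3) measure_nonneg[of \<mu> "sym_diff A B"] by linarith
  finally have "(\<integral>x. (indicat_real A x - indicat_real B x)\<^sup>2 \<partial>\<mu>) < e" .
  moreover have "sq_integrable \<mu> (indicat_real B)"
    using B by (intro sq_integrable_le[of _ _ "\<lambda>_. 1"]) (auto simp: indicator_def)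
  moreover have "finite_window m (indicat_real B)"
    using B(2) unfolding finite_window_def indicator_def by (simp add: of_bool_eq_iff)
  ultimately show "\<exists>m h. h \<in> borel_measurable path_space \<and> finite_window m h \<and> sq_integrable \<mu> h
      \<and> (\<integral>x. (indicat_real A x - h x)\<^sup>2 \<partial>\<mu>) < e"
    using B by (intro exI[of _ m] exI[of _ "indicat_real B"]) auto
qed

lemma window_approx_nonneg:
  assumes "prob_space \<mu>" and sets[simp, measurable_cong]: "sets \<mu> = sets path_space"
    and "f \<in> borel_measurable path_space" "\<And>x. 0 \<le> f x" "sq_integrable \<mu> f"
  shows "window_approx \<mu> f"
  using assms(3-5)
proof (induction f rule: borel_measurable_induct_real)
  case (set A)
  then show ?case using window_approx_indicator[OF assms(1,2)] by simp
next
  case (mult u c)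
  show ?case
  proof (cases "c = 0")
    \<comment> \<open>Square integrability of \<open>u\<close> cannot be recovered from that of
      \<open>0 * u\<close>; the zero function is treated as the indicator of the empty set.\<close>
    case True
    have "window_approx \<mu> (indicat_real {})" by (rule window_approx_indicator[OF assms(1,2)]) simp
    moreover have "indicat_real {} = (\<lambda>x. c * u x)" using True by (simp add: fun_eq_iff)
    ultimately show ?thesis by simp
  next
    case False
    have "sq_integrable \<mu> (\<lambda>x. (1 / c) * (c * u x))" by (rule sq_integrable_cmult) fact
    then have "sq_integrable \<mu> u" using False by simp
    then show ?thesis using mult by (intro window_approx_cmult) auto
  qed
next
  case (add u v)
  have int: "integrable \<mu> (\<lambda>x. (v x + u x)\<^sup>2)" using add.prems by (simp add: sq_integrable_def)
  \<comment> \<open>The summands are nonnegative, so the square of each is dominated by the square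
    of the sum.\<close>
  have "sq_integrable \<mu> u" "sq_integrable \<mu> v"
    by (rule sq_integrable_le[OF _ int], use add in \<open>auto intro!: power_mono simp: add_increasing add_increasing2\<close>)+
  then show ?case using add by (intro window_approx_add) auto
next
  case (seq U)
  interpret prob_space \<mu> by fact
  have sp: "space \<mu> = UNIV" using sets_eq_imp_space_eq[OF sets] by (simp add: space_path_space)
  have lim: "(\<lambda>i. U i x) \<longlonglongrightarrow> f x" for x using seq by (simp add: space_path_space)
  have f[measurable]: "f \<in> borel_measurable path_space" using seq by (auto simp: sq_integrable_def measurable_cong_sets[OF sets refl])
  have U[measurable]: "U i \<in> borel_measurable path_space" for i by fact
  have le: "U i x \<le> f x" for i x
    using incseq_le[OF _ lim[of x]] seq.hyps by (auto simp: incseq_def le_fun_def)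
  have sqU: "sq_integrable \<mu> (U i)" for i
    using le seq by (intro sq_integrable_le[of _ _ "\<lambda>x. (f x)\<^sup>2"]) (auto simp: sq_integrable_def measurable_cong_sets[OF sets refl] intro!: power_mono)
  have conv: "(\<lambda>i. \<integral>x. (f x - U i x)\<^sup>2 \<partial>\<mu>) \<longlonglongrightarrow> (\<integral>x. 0 \<partial>\<mu>)"
  proof (rule integral_dominated_convergence[where w = "\<lambda>x. (f x)\<^sup>2"])
    show "integrable \<mu> (\<lambda>x. (f x)\<^sup>2)" using seq by (simp add: sq_integrable_def)
    show "AE x in \<mu>. (\<lambda>i. (f x - U i x)\<^sup>2) \<longlonglongrightarrow> 0"
    proof (rule AE_I2)
      fix x show "(\<lambda>i. (f x - U i x)\<^sup>2) \<longlonglongrightarrow> 0"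
        using tendsto_power[OF tendsto_diff[OF tendsto_const lim[of x]], of "f x" 2] by simp
    qed
    show "AE x in \<mu>. norm ((f x - U i x)\<^sup>2) \<le> (f x)\<^sup>2" for i
      using le seq.hyps by (auto intro!: power_mono)
  qed auto
  show ?case
    unfolding window_approx_def
  proof (intro allI impI)
    fix e :: real assume "e > 0"
    have "eventually (\<lambda>i. (\<integral>x. (f x - U i x)\<^sup>2 \<partial>\<mu>) < e / 4) sequentially"
      using conv \<open>e > 0\<close> by (intro order_tendstoD) auto
    then obtain i where i: "(\<integral>x. (f x - U i x)\<^sup>2 \<partial>\<mu>) < e / 4" by (auto simp: eventually_sequentially)
    have "window_approx \<mu> (U i)" using seq.IH sqU by blast
    moreover have "e / 4 > 0" using \<open>e > 0\<close> by simp
    ultimately obtain m h where h: "h \<in> borel_measurable path_space" "finite_window m h" "sq_integrable \<mu> h"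
        "(\<integral>x. (U i x - h x)\<^sup>2 \<partial>\<mu>) < e / 4"
      unfolding window_approx_def by meson
    have "(\<integral>x. (f x - h x)\<^sup>2 \<partial>\<mu>) = (\<integral>x. ((f x - U i x) + (U i x - h x))\<^sup>2 \<partial>\<mu>)" by simp
    also have "\<dots> \<le> 2 * (\<integral>x. (f x - U i x)\<^sup>2 \<partial>\<mu>) + 2 * (\<integral>x. (U i x - h x)\<^sup>2 \<partial>\<mu>)"
      by (intro integral_sq_add_le sq_integrable_diff h sqU seq.prems)
    also have "\<dots> < e" using i h(4) by simp
    finally show "\<exists>m h. h \<in> borel_measurable path_space \<and> finite_window m h \<and> sq_integrable \<mu> h \<and> (\<integral>x. (f x - h x)\<^sup>2 \<partial>\<mu>) < e"
      using h by blast
  qed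
qed

lemma window_approx_sq_integrable:
  assumes "prob_space \<mu>" and sets: "sets \<mu> = sets path_space" and f: "sq_integrable \<mu> f"
  shows "window_approx \<mu> f"
proof -
  have [measurable]: "f \<in> borel_measurable path_space"
    using f by (simp add: sq_integrable_def measurable_cong_sets[OF sets refl])
  have p: "sq_integrable \<mu> (\<lambda>x. max 0 (f x))" "sq_integrable \<mu> (\<lambda>x. max 0 (- f x))"
    subgoal by (rule sq_integrable_le[of _ _ "\<lambda>x. (f x)\<^sup>2"]) (use f in \<open>auto simp: sq_integrable_def max_def\<close>)
    subgoal by (rule sq_integrable_le[of _ _ "\<lambda>x. (f x)\<^sup>2"]) (use f in \<open>auto simp: sq_integrable_def max_def\<close>)
    done
  then have "window_approx \<mu> (\<lambda>x. max 0 (f x))" "window_approx \<mu> (\<lambda>x. max 0 (- f x))"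
    by (auto intro!: window_approx_nonneg[OF assms(1,2)])
  then have "window_approx \<mu> (\<lambda>x. max 0 (f x) + (-1) * max 0 (- f x))"
    by (intro window_approx_add window_approx_cmult sq_integrable_cmult p)
  moreover have "(\<lambda>x. max 0 (f x) + (-1) * max 0 (- f x)) = f" by (auto simp: fun_eq_iff max_def)
  ultimately show ?thesis by simp
qed

section \<open>Summability of the mixing errors\<close>

text \<open>The change of variable from \<open>n\<close> to \<open>k = \<phi> n\<close>: the
  increment of \<open>\<phi>\<close> is about \<open>2 * \<kappa> * n / ln n\<close>, and
  \<open>\<phi> n powr (-1/2)\<close> is about \<open>sqrt (ln n) / (sqrt \<kappa> * n)\<close>. The
  right-hand side grows like \<open>ln n powr ((3 * \<alpha> - 1) / 2)\<close>, an exponent above 1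
  for \<open>\<alpha> > 1\<close>. The subtracted 1 pays for rounding.\<close>

lemma block_growth:
  fixes \<kappa> \<alpha> :: real
  assumes "\<kappa> > 0" "\<alpha> > 1"
  defines "\<phi> \<equiv> \<lambda>x. \<kappa> * x\<^sup>2 / ln x"
  shows "eventually (\<lambda>n::nat. ln (real n) \<le> (2 / sqrt \<kappa>) * ((\<phi> (real n) - \<phi> (real n - 1) - 1)
     * (ln (\<phi> (real n - 1)) powr (3 * \<alpha> / 2) * \<phi> (real n) powr (-1/2)))) sequentially"
  unfolding \<phi>_def using assms(1,2) by real_asymp

lemma block_growth2:
  fixes \<kappa> :: real
  assumes "\<kappa> > 0"
  defines "\<phi> \<equiv> \<lambda>x. \<kappa> * x\<^sup>2 / ln x"
  shows "eventually (\<lambda>n::nat. \<phi> (real n - 1) + 1 \<le> \<phi> (real n) \<and> \<phi> (real n - 1) > 3) sequentially"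
  unfolding \<phi>_def using assms(1) by (intro eventually_conj; real_asymp)

text \<open>Cauchy condensation along \<open>P\<close>: by \<open>block_growth\<close>, the stretch
  of the given series after \<open>P n\<close> and up to \<open>P (Suc n)\<close>, times a constant,
  dominates one term of the new series. The stretches are disjoint, so the bounds telescope.\<close>

lemma summable_condensed:
  fixes \<beta> :: "nat \<Rightarrow> real" and \<kappa> \<alpha> :: real
  assumes nonneg: "\<And>n. 0 \<le> \<beta> n" and anti: "\<And>m n. 0 < m \<Longrightarrow> m \<le> n \<Longrightarrow> \<beta> n \<le> \<beta> m"
    and sm: "summable (\<lambda>n. ln (real (Suc n)) powr (3 * \<alpha> / 2) * real (Suc n) powr (-1/2) * \<beta> (Suc n))"
    and \<kappa>: "\<kappa> > 0" and \<alpha>: "\<alpha> > 1"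
  shows "summable (\<lambda>n. ln (real n) * \<beta> (nat \<lfloor>\<kappa> * (real n)\<^sup>2 / ln (real n)\<rfloor>))"
proof -
  define \<phi> where "\<phi> x = \<kappa> * x\<^sup>2 / ln x" for x :: real
  define P where "P n = nat \<lfloor>\<phi> (real n)\<rfloor>" for n :: nat
  define a where "a k = ln (real k) powr (3 * \<alpha> / 2) * real k powr (-1/2) * \<beta> k" for k :: nat
  define A where "A m = (\<Sum>k<m. a k)" for m
  define C where "C = 2 / sqrt \<kappa>"
  have a_nonneg: "0 \<le> a k" for k using nonneg by (simp add: a_def)
  have "summable a" using sm by (subst summable_Suc_iff[symmetric]) (simp add: a_def)
  have C: "C > 0" using \<kappa> by (simp add: C_def)
  have "eventually (\<lambda>n::nat. ln (real n) \<le> C * ((\<phi> (real n) - \<phi> (real n - 1) - 1)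
     * (ln (\<phi> (real n - 1)) powr (3 * \<alpha> / 2) * \<phi> (real n) powr (-1/2)))
     \<and> (\<phi> (real n - 1) + 1 \<le> \<phi> (real n) \<and> \<phi> (real n - 1) > 3)) sequentially"
    using block_growth[OF \<kappa> \<alpha>] block_growth2[OF \<kappa>]
    unfolding \<phi>_def C_def by (rule eventually_conj)
  then obtain n0 where n0: "\<And>n. n \<ge> n0 \<Longrightarrow> ln (real n) \<le> C * ((\<phi> (real n) - \<phi> (real n - 1) - 1)
     * (ln (\<phi> (real n - 1)) powr (3 * \<alpha> / 2) * \<phi> (real n) powr (-1/2)))"
     "\<And>n. n \<ge> n0 \<Longrightarrow> \<phi> (real n - 1) + 1 \<le> \<phi> (real n)" "\<And>n. n \<ge> n0 \<Longrightarrow> \<phi> (real n - 1) > 3"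
    unfolding eventually_sequentially by blast
  have key: "ln (real (Suc n)) * \<beta> (P (Suc n)) \<le> C * (A (Suc (P (Suc n))) - A (Suc (P n)))"
    and inc: "P n \<le> P (Suc n)" if n: "n \<ge> n0" for n
  proof -
    have n': "Suc n \<ge> n0" using n by simp
    note f = n0[OF n', simplified]
    define u where "u = \<phi> (real n)"
    define v where "v = \<phi> (real (Suc n))"
    have uv: "u + 1 \<le> v" "u > 3" "ln (real (Suc n)) \<le> C * ((v - u - 1) * (ln u powr (3 * \<alpha> / 2) * v powr (-1/2)))"
      using f by (simp_all add: u_def v_def add.commute)
    have Pu: "P n = nat \<lfloor>u\<rfloor>" and Pv: "P (Suc n) = nat \<lfloor>v\<rfloor>" by (simp_all add: P_def u_def v_def)
    have Pu': "real (P n) \<le> u" "u < real (P n) + 1" and Pv': "real (P (Suc n)) \<le> v" "v < real (P (Suc n)) + 1"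
      unfolding Pu Pv using uv by linarith+
    show le: "P n \<le> P (Suc n)" unfolding Pu Pv using uv by (intro nat_mono floor_mono) linarith
    \<comment> \<open>A lower bound for \<open>a\<close> on the whole stretch: the logarithm is
      estimated at its start, the decreasing power and \<open>\<beta>\<close> at its end.\<close>
    define c where "c = ln u powr (3 * \<alpha> / 2) * v powr (-1/2) * \<beta> (P (Suc n))"
    have c0: "c \<ge> 0" using nonneg by (simp add: c_def)
    have ak: "c \<le> a k" if k: "k \<in> {Suc (P n)..<Suc (P (Suc n))}" for k
    proof -
      have k1: "real (P n) + 1 \<le> real k" using k by (simp flip: of_nat_Suc)
      have k2: "real k \<le> real (P (Suc n))" using k by simp
      have ku: "u \<le> real k" and kv: "real k \<le> v" using k1 k2 Pu' Pv' by linarith+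
      have "ln u powr (3 * \<alpha> / 2) \<le> ln (real k) powr (3 * \<alpha> / 2)"
        using ku uv(2) \<alpha> by (intro powr_mono2) (auto intro: ln_ge_zero)
      moreover have "v powr (-1/2) \<le> real k powr (-1/2)"
        using ku kv uv(2) by (intro powr_mono2') auto
      moreover have "\<beta> (P (Suc n)) \<le> \<beta> k" using k by (intro anti) auto
      ultimately show ?thesis
        unfolding c_def a_def by (intro mult_mono) (auto simp: nonneg)
    qed
    have "A (Suc (P (Suc n))) - A (Suc (P n)) = (\<Sum>k\<in>{Suc (P n)..<Suc (P (Suc n))}. a k)"
      unfolding A_def lessThan_atLeast0
      by (rule sum_diff_nat_ivl) (use le in auto)
    also have "\<dots> \<ge> (\<Sum>k\<in>{Suc (P n)..<Suc (P (Suc n))}. c)"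
      by (rule sum_mono) (rule ak)
    finally have "real (P (Suc n) - P n) * c \<le> A (Suc (P (Suc n))) - A (Suc (P n))" by simp
    moreover have "(v - u - 1) * c \<le> real (P (Suc n) - P n) * c"
    proof (rule mult_right_mono[OF _ c0])
      show "v - u - 1 \<le> real (P (Suc n) - P n)" using le Pu' Pv' by (simp add: of_nat_diff)
    qed
    ultimately have "(v - u - 1) * c \<le> A (Suc (P (Suc n))) - A (Suc (P n))" by linarith
    then have "C * ((v - u - 1) * c) \<le> C * (A (Suc (P (Suc n))) - A (Suc (P n)))"
      using C by (intro mult_left_mono) auto
    moreover have "ln (real (Suc n)) * \<beta> (P (Suc n)) \<le> C * ((v - u - 1) * (ln u powr (3 * \<alpha> / 2) * v powr (-1/2))) * \<beta> (P (Suc n))"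
      using uv(3) nonneg by (rule mult_right_mono)
    ultimately show "ln (real (Suc n)) * \<beta> (P (Suc n)) \<le> C * (A (Suc (P (Suc n))) - A (Suc (P n)))"
      by (simp add: c_def mult.assoc)
  qed
  have "summable (\<lambda>n. ln (real (Suc (n + n0))) * \<beta> (P (Suc (n + n0))))"
  proof (rule summableI_nonneg_bounded)
    show "0 \<le> ln (real (Suc (n + n0))) * \<beta> (P (Suc (n + n0)))" for n
      by (intro mult_nonneg_nonneg nonneg) simp
    fix m
    have "(\<Sum>n<m. ln (real (Suc (n + n0))) * \<beta> (P (Suc (n + n0))))
        \<le> (\<Sum>n<m. C * (A (Suc (P (Suc (n + n0)))) - A (Suc (P (n + n0)))))"
      by (rule sum_mono) (rule key, simp)
    also have "\<dots> = C * (A (Suc (P (m + n0))) - A (Suc (P n0)))"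
      using sum_lessThan_telescope[of "\<lambda>n. A (Suc (P (n + n0)))" m] by (simp flip: sum_distrib_left)
    also have "\<dots> \<le> C * suminf a"
    proof -
      have "A (Suc (P (m + n0))) \<le> suminf a"
        unfolding A_def by (rule sum_le_suminf[OF \<open>summable a\<close>]) (auto simp: a_nonneg)
      moreover have "0 \<le> A (Suc (P n0))" unfolding A_def by (intro sum_nonneg a_nonneg)
      ultimately show ?thesis using C by (intro mult_left_mono) auto
    qed
    finally show "(\<Sum>n<m. ln (real (Suc (n + n0))) * \<beta> (P (Suc (n + n0)))) \<le> C * suminf a" .
  qed
  then have "summable (\<lambda>n. ln (real (n + Suc n0)) * \<beta> (P (n + Suc n0)))" by simp
  then show ?thesis
    by (subst (asm) summable_iff_shift) (simp add: P_def \<phi>_def)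
qed

section \<open>Blocks of columns\<close>

lemma real_div_bounds:
  "real (n div d) \<le> real n / real d" "real n / real d \<le> real (n div d) + 1"
  using floor_divide_of_nat_eq[of n d, where 'a = real] by linarith+

text \<open>\<open>B\<close> blocks of \<open>r\<close> columns cover all \<open>n\<close> columns,
  and the last \<open>q\<close> of each, about one in \<open>D\<close>, are erased. The main
  conjuncts say that the gaps survive windows of radius \<open>m\<close> and are of order
  \<open>n^2 / ln n\<close>, that erasing is cheap, that the McDiarmid exponent is at least of order
  \<open>ln n\<close>, and that the number of blocks is at most of that order.\<close>

lemma block_parameters:
  fixes N :: "nat \<Rightarrow> nat" and c A :: real and D m :: nat
  assumes lim: "(\<lambda>n. real (N n) / real n) \<longlonglongrightarrow> c" and c: "c > 0" and A: "A > 0" and D2: "D \<ge> 2"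
  defines "B \<equiv> \<lambda>n. nat \<lceil>A * ln (real n)\<rceil>"
  defines "r \<equiv> \<lambda>n. n div B n + 1"
  defines "q \<equiv> \<lambda>n. r n div D + 1"
  shows "eventually (\<lambda>n. n > 1 \<and> B n > 0 \<and> n \<le> B n * r n \<and> q n < r n \<and> N n > 0 \<and> 2 * m \<le> q n * N n
      \<and> nat \<lfloor>c / (8 * real D * A) * (real n)\<^sup>2 / ln (real n)\<rfloor> \<le> q n * N n - 2 * m + 1
      \<and> 1 \<le> c / (8 * real D * A) * (real n)\<^sup>2 / ln (real n)
      \<and> 2 * real (B n * q n) / real (N n) \<le> 8 / (c * real D)
      \<and> A * c\<^sup>2 / 16 * ln (real n) \<le> (real (N n))\<^sup>2 / (real (B n) * (real (r n))\<^sup>2)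
      \<and> real (B n) \<le> 2 * A * ln (real n)) sequentially"
proof -
  define \<kappa> where "\<kappa> = c / (8 * real D * A)"
  have D: "D > 0" using D2 by simp
  have \<kappa>: "\<kappa> > 0" using c A D by (simp add: \<kappa>_def)
  have ev1: "eventually (\<lambda>n. real (N n) / real n > c / 2) sequentially"
    using lim c by (intro order_tendstoD) auto
  have ev2: "eventually (\<lambda>n::nat. A * ln (real n) \<ge> 1) sequentially" using A by real_asymp
  have ev3: "eventually (\<lambda>n::nat. 4 * real D * A * ln (real n) \<le> real n) sequentially" by real_asymp
  have ev4: "eventually (\<lambda>n::nat. 2 * real m + 1 \<le> \<kappa> * (real n)\<^sup>2 / ln (real n)) sequentially"
    using \<kappa> by real_asymp
  show ?thesis
    using ev1 ev2 ev3 ev4 eventually_gt_at_top[of 1]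
  proof eventually_elim
    case (elim n)
    define \<l> where "\<l> = ln (real n)"
    have n: "real n > 1" using elim by simp
    have \<l>: "\<l> > 0" using n by (simp add: \<l>_def)
    have Nn: "real (N n) > c / 2 * real n" using elim(1) n by (simp add: field_simps)
    then have N0: "real (N n) > 0" using c n by (smt (verit) divide_pos_pos mult_pos_pos)
    have B1: "A * \<l> \<le> real (B n)" unfolding B_def \<l>_def by linarith
    have B2: "real (B n) \<le> A * \<l> + 1" unfolding B_def \<l>_def using elim(2) by linarith
    then have B3: "real (B n) \<le> 2 * A * \<l>" using elim(2) by (simp add: \<l>_def)
    have B0: "real (B n) > 0" using B1 elim(2) by (simp add: \<l>_def)
    have BD: "2 * real (B n) * real D \<le> real n"
    proof -
      have "2 * real (B n) * real D \<le> 2 * (2 * A * \<l>) * real D" using B3 by (intro mult_right_mono) auto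
      also have "\<dots> \<le> real n" using elim(3) by (simp add: \<l>_def mult_ac)
      finally show ?thesis .
    qed
    have "real (B n) * 1 \<le> real (B n) * real D" using D by (intro mult_left_mono) auto
    then have Bn: "real (B n) \<le> real n" using BD B0 by linarith
    have r1: "real n / real (B n) \<le> real (r n)"
      unfolding r_def using real_div_bounds(2)[of n "B n"] by simp
    have r2: "real (r n) \<le> real n / real (B n) + 1"
      unfolding r_def using real_div_bounds(1)[of n "B n"] by simp
    have r3: "real (r n) \<le> 2 * real n / real (B n)"
    proof -
      have "1 \<le> real n / real (B n)" using Bn B0 by simp
      then show ?thesis using r2 by simp
    qed
    have q1: "real (r n) / real D \<le> real (q n)"
      using real_div_bounds(2)[of "r n" D] by (simp add: q_def)
    have q2: "real (q n) \<le> real (r n) / real D + 1"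
      using real_div_bounds(1)[of "r n" D] by (simp add: q_def)
    have qr: "q n < r n"
    proof -
      have "4 * real (B n) \<le> 2 * real (B n) * real D" using D2 B0 by simp
      then have "4 * real (B n) \<le> real n" using BD by linarith
      then have "4 \<le> real n / real (B n)" using B0 by (simp add: field_simps)
      then have "4 \<le> real (r n)" using r1 by linarith
      moreover have "real (r n) / real D \<le> real (r n) / 2" using D2 by (intro divide_left_mono) auto
      ultimately have "real (q n) < real (r n)" using q2 by linarith
      then show ?thesis by simp
    qed
    have "real n / (2 * A * \<l>) \<le> real n / real (B n)"
      using B3 B0 by (intro divide_left_mono) (auto intro!: mult_pos_pos simp: A \<l>)
    then have "real n / (2 * A * \<l>) / real D \<le> real (q n)"
      using r1 q1 divide_right_mono[of "real n / (2 * A * \<l>)" "real (r n)" "real D"] by linarith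
    then have "real n / (2 * A * \<l>) / real D * (c / 2 * real n) \<le> real (q n) * real (N n)"
      using Nn A \<l> c by (intro mult_mono) auto
    \<comment> \<open>\<open>\<kappa>\<close> takes only half of the available gap length; the other
      half absorbs the \<open>2 * m\<close> coordinates read by windows from both sides.\<close>
    moreover have "real n / (2 * A * \<l>) / real D * (c / 2 * real n) = 2 * (\<kappa> * (real n)\<^sup>2 / \<l>)"
      using A \<l> D by (simp add: \<kappa>_def field_simps power2_eq_square)
    ultimately have qN: "2 * (\<kappa> * (real n)\<^sup>2 / \<l>) \<le> real (q n * N n)" by simp
    have m: "2 * real m + 1 \<le> \<kappa> * (real n)\<^sup>2 / \<l>" using elim(4) by (simp add: \<l>_def)
    have "real (2 * m) \<le> real (q n * N n)" using qN m by simp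
    then have m2: "2 * m \<le> q n * N n" by (simp only: of_nat_le_iff)
    have p: "nat \<lfloor>\<kappa> * (real n)\<^sup>2 / \<l>\<rfloor> \<le> q n * N n - 2 * m + 1"
    proof -
      have "\<kappa> * (real n)\<^sup>2 / \<l> \<le> real (q n * N n - 2 * m + 1)"
        using qN m m2 by (simp add: of_nat_diff)
      then show ?thesis by linarith
    qed
    have rem: "2 * real (B n * q n) / real (N n) \<le> 8 / (c * real D)"
    proof -
      have "real (B n) * real (q n) \<le> real (B n) * ((real n / real (B n) + 1) / real D + 1)"
      proof (intro mult_left_mono)
        have "real (r n) / real D \<le> (real n / real (B n) + 1) / real D"
          using r2 by (intro divide_right_mono) auto
        then show "real (q n) \<le> (real n / real (B n) + 1) / real D + 1" using q2 by linarith
      qed simp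
      also have "\<dots> = real n / real D + real (B n) / real D + real (B n)"
        using B0 D by (simp add: field_simps)
      also have "\<dots> \<le> real n / real D + real (B n) + real (B n)"
        using D B0 by (simp add: divide_le_eq mult_le_cancel_left1)
      also have "\<dots> \<le> 2 * (real n / real D)"
        using BD D by (simp add: field_simps)
      finally have "2 * real (B n * q n) \<le> 4 * (real n / real D)" by simp
      then have "2 * real (B n * q n) / real (N n) \<le> 4 * (real n / real D) / real (N n)"
        by (intro divide_right_mono) auto
      also have "\<dots> \<le> 4 * (real n / real D) / (c / 2 * real n)"
        using Nn N0 c n D by (intro divide_left_mono) auto
      also have "\<dots> = 8 / (c * real D)" using n c by (simp add: field_simps)
      finally show ?thesis .
    qed
    have ex: "A * c\<^sup>2 / 16 * \<l> \<le> (real (N n))\<^sup>2 / (real (B n) * (real (r n))\<^sup>2)"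
    proof -
      have rpos: "real (r n) > 0" by (simp add: r_def)
      have "A * c\<^sup>2 / 16 * \<l> \<le> c\<^sup>2 / 16 * real (B n)"
        using mult_left_mono[OF B1, of "c\<^sup>2 / 16"] by (simp add: mult_ac)
      also have "\<dots> = (c / 2 * real n)\<^sup>2 / (real (B n) * (2 * real n / real (B n))\<^sup>2)"
        using n B0 by (simp add: power2_eq_square field_simps)
      also have "\<dots> \<le> (real (N n))\<^sup>2 / (real (B n) * (real (r n))\<^sup>2)"
        using Nn c n r3 B0 rpos by (intro frac_le mult_left_mono power_mono mult_pos_pos) auto
      finally show ?thesis .
    qed
    have "n \<le> B n * r n"
    proof -
      have "real n \<le> real (B n * r n)" using r1 B0 by (simp add: field_simps)
      then show ?thesis by (simp only: of_nat_le_iff)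
    qed
    then show ?case
      using elim B0 N0 m2 p rem ex B3 m qr by (simp add: \<l>_def \<kappa>_def)
  qed
qed

section \<open>The block functional: which coordinates its columns read\<close>

definition shift :: "int \<Rightarrow> (int \<Rightarrow> real) \<Rightarrow> int \<Rightarrow> real" where
  "shift k x i = x (k + i)"

definition cols :: "((int \<Rightarrow> real) \<Rightarrow> real) \<Rightarrow> nat \<Rightarrow> (int \<Rightarrow> real) \<Rightarrow> nat \<Rightarrow> nat \<Rightarrow> real" where
  "cols h N x l i = h (shift (int (l * N + i + 1)) x)"

text \<open>Erased columns are set to 0 rather than deleted, which leaves the dimensions and the
  normalisation by \<open>n\<close> untouched.\<close>

definition mask :: "nat set \<Rightarrow> (nat \<Rightarrow> nat \<Rightarrow> real) \<Rightarrow> nat \<Rightarrow> nat \<Rightarrow> real" where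
  "mask J w l i = (if l \<in> J then w l i else 0)"

lemma measurable_shift[measurable]: "shift k \<in> measurable path_space path_space"
  by (rule measurable_pathI) (simp add: shift_def)

lemma measurable_cols[measurable (raw)]:
  assumes "h \<in> borel_measurable path_space"
  shows "(\<lambda>x. cols h N x l i) \<in> borel_measurable path_space"
  unfolding cols_def by (rule measurable_compose[OF measurable_shift assms])

lemma measurable_masked:
  assumes "Im z > 0" "h \<in> borel_measurable path_space"
  shows "(\<lambda>x. gram_stieltjes N n z (mask J (cols h N x))) \<in> borel_measurable path_space"
proof (rule measurable_gram_stieltjes[OF assms(1)])
  fix l i
  show "(\<lambda>x. mask J (cols h N x) l i) \<in> borel_measurable path_space"
    using measurable_cols[OF assms(2)] by (simp add: mask_def)
qed

text \<open>The entries of column \<open>l\<close> sit at times \<open>l * N + 1\<close> to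
  \<open>l * N + N\<close>, and a window of radius \<open>m\<close> reads \<open>m\<close> further
  on either side.\<close>

abbreviation reading_columns :: "nat set \<Rightarrow> nat \<Rightarrow> nat \<Rightarrow> nat \<Rightarrow> int set \<Rightarrow> nat set" where
  "reading_columns J n N m I \<equiv>
     {l \<in> J. l < n \<and> (\<exists>j\<in>I. int (l * N) + 1 - int m \<le> j \<and> j \<le> int (l * N) + int N + int m)}"

text \<open>Changing the path on \<open>I\<close> alters only the columns that read it, each at
  rank-one cost. The unit factor \<open>\<zeta>\<close> selects a real component of the transform,
  since the concentration bound is for real functionals.\<close>

lemma osc_le_masked:
  assumes z: "Im z > 0" and h: "finite_window m h" and \<zeta>: "cmod \<zeta> = 1"
    and K: "card (reading_columns J n N m I) \<le> k"
      (is "card ?K \<le> k")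
  shows "osc_le (\<lambda>x. Re (\<zeta> * gram_stieltjes N n z (mask J (cols h N x)))) I (2 * real k / (real N * Im z))"
  unfolding osc_le_def
proof (intro allI impI)
  fix x y :: "int \<Rightarrow> real" assume xy: "\<forall>i. i \<notin> I \<longrightarrow> x i = y i"
  let ?Y = "\<lambda>x. gram_stieltjes N n z (mask J (cols h N x))"
  have "cmod (?Y x - ?Y y) \<le> 2 * real (card ?K) / (real N * Im z)"
  proof (rule gram_stieltjes_change_columns[OF z])
    fix l i assume l: "l < n" "l \<notin> ?K" and i: "i < N"
    show "mask J (cols h N x) l i = mask J (cols h N y) l i"
    proof (cases "l \<in> J")
      case True
      have "h (shift (int (l * N + i + 1)) x) = h (shift (int (l * N + i + 1)) y)"
      proof -
        have "shift (int (l * N + i + 1)) x j = shift (int (l * N + i + 1)) y j" if j: "\<bar>j\<bar> \<le> int m" for j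
        proof -
          have "int (l * N + i + 1) + j \<notin> I"
          proof
            assume "int (l * N + i + 1) + j \<in> I"
            moreover have "int (l * N) + 1 - int m \<le> int (l * N + i + 1) + j"
              "int (l * N + i + 1) + j \<le> int (l * N) + int N + int m"
              using i j by linarith+
            ultimately have "l \<in> ?K" using True l(1) by blast
            then show False using l(2) by blast
          qed
          then show ?thesis using xy by (simp add: shift_def)
        qed
        then show ?thesis using h unfolding finite_window_def by blast
      qed
      then show ?thesis by (simp add: mask_def cols_def)
    qed (simp add: mask_def)
  qed auto
  also have "\<dots> \<le> 2 * real k / (real N * Im z)"
    using K z by (intro divide_right_mono) auto
  finally have d: "cmod (?Y x - ?Y y) \<le> 2 * real k / (real N * Im z)" .
  have "Re (\<zeta> * ?Y x) - Re (\<zeta> * ?Y y) = Re (\<zeta> * (?Y x - ?Y y))" by (simp add: algebra_simps)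
  also have "\<bar>\<dots>\<bar> \<le> cmod (\<zeta> * (?Y x - ?Y y))" by (rule abs_Re_le_cmod)
  also have "\<dots> = cmod (?Y x - ?Y y)" using \<zeta> by (simp add: norm_mult)
  finally show "\<bar>Re (\<zeta> * ?Y x) - Re (\<zeta> * ?Y y)\<bar> \<le> 2 * real k / (real N * Im z)" using d by linarith
qed

sublocale process \<subseteq> path: path_measure path_law
  using prob_space_path_law sets_path_law by (simp add: path_measure_def path_measure_axioms_def)

text \<open>The block containing \<open>l\<close> is complete before column \<open>k * r\<close>,
  and a kept column has at least \<open>q\<close> columns after it in its block.\<close>

lemma kept_columns_bound:
  assumes "l mod r + q < r" "l < k * r"
  shows "l + 1 + q \<le> k * (r::nat)"
proof -
  have "l = r * (l div r) + l mod r" by simp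
  moreover have "l div r < k" using assms(2) by (simp add: less_mult_imp_div_less)
  then have "r * (l div r + 1) \<le> r * k" by (intro mult_le_mono2) simp
  then have "r * (l div r) + r \<le> k * r" by (simp add: mult.commute)
  ultimately show ?thesis using assms(1) by linarith
qed

text \<open>McDiarmid for \<open>Suc L\<close> blocks of \<open>r\<close> columns. Windows spill
  over by \<open>m\<close> on both sides, so the next block reads from \<open>t k + 1\<close> on and
  the kept columns read up to \<open>s k\<close>. This leaves \<open>q * N - 2 * m\<close> unread
  coordinates, hence a lag of one more.\<close>

lemma (in process) block_concentration:
  fixes h :: "(int \<Rightarrow> real) \<Rightarrow> real" and m N n r q L :: nat
  assumes z: "Im z > 0" and h: "h \<in> borel_measurable path_space" "finite_window m h" and \<zeta>: "cmod \<zeta> = 1"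
    and N: "N > 0" and n: "n \<le> Suc L * r" and q: "2 * m \<le> q * N" and qr: "q < r"
  defines "F \<equiv> \<lambda>x. Re (\<zeta> * gram_stieltjes N n z (mask {l. l mod r + q < r} (cols h N x)))"
  defines "b \<equiv> beta_mixing M eps (q * N - 2 * m + 1)"
  assumes \<tau>: "real L * (2 * (1 / Im z) * b) \<le> \<tau>" and l: "l > 0"
  shows "measure path_law {x. F x \<ge> (\<integral>x. F x \<partial>path_law) + 2 * \<tau>}
      \<le> exp (real (Suc L) * (l * (2 * real r / (real N * Im z)))\<^sup>2 / 8 - l * \<tau>) + real L * b"
proof -
  define J where "J = {l. l mod r + q < r}"
  \<comment> \<open>The kept columns of block \<open>k\<close> read only coordinates in \<open>(t (k - 1), s k]\<close>; the \<open>q\<close> erased columns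
    leave the gap \<open>(s k, t k]\<close>.\<close>
  define t where "t k = int (Suc k * r * N) - int m" for k :: nat
  define s where "s k = int ((Suc k * r - q) * N) + int m" for k :: nat
  have qle: "q \<le> Suc k * r" for k using qr by (simp add: trans_le_add1)
  have s_eq: "s k = int (Suc k * r * N) - int (q * N) + int m" for k
    using qle[of k] by (simp add: s_def diff_mult_distrib of_nat_diff mult_le_mono1 del: mult_Suc of_nat_mult)
  have st: "s k \<le> t k" "nat (t k + 1 - s k) = q * N - 2 * m + 1" for k
  proof -
    have "int (2 * m) \<le> int (q * N)" using q by (simp only: of_nat_le_iff)
    then show "s k \<le> t k" "nat (t k + 1 - s k) = q * N - 2 * m + 1"
      unfolding s_eq t_def by linarith+
  qed
  have left: "l < Suc k * r" if "int (l * N) + 1 - int m \<le> j" "j \<le> t k" for l k j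
  proof (rule ccontr)
    assume "\<not> l < Suc k * r"
    then have "Suc k * r * N \<le> l * N" by (intro mult_le_mono1) simp
    then have "int (Suc k * r * N) \<le> int (l * N)" by (simp only: of_nat_le_iff)
    then show False using that unfolding t_def by linarith
  qed
  have right: "j \<le> s k" if "l \<in> J" "l < Suc k * r" "j \<le> int (l * N) + int N + int m" for l k j
  proof -
    have "l + 1 + q \<le> Suc k * r" using that kept_columns_bound[of l r q "Suc k"] by (simp add: J_def)
    then have "(l + 1 + q) * N \<le> Suc k * r * N" by (rule mult_le_mono1)
    then have "l * N + N + q * N \<le> Suc k * r * N" by (simp add: add_mult_distrib)
    then have "int (l * N) + int N + int (q * N) \<le> int (Suc k * r * N)" by (simp only: of_nat_le_iff flip: of_nat_add)
    then show ?thesis using that unfolding s_eq by linarith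
  qed
  let ?c = "2 * real r / (real N * Im z)"
  have F_osc: "osc_le F I (2 * real k / (real N * Im z))"
    if "reading_columns J n N m I \<subseteq> S"
      "finite S" "card S \<le> k" for I S k
    unfolding F_def J_def[symmetric]
    by (intro osc_le_masked[OF z h(2) \<zeta>] order_trans[OF card_mono[OF that(2,1)] that(3)])
  have F_osc0: "osc_le F I 0"
    if "reading_columns J n N m I \<subseteq> {}" for I
    using F_osc[OF that, of 0] by simp
  show ?thesis
  proof (rule path.mcdiarmid_gap_mixing[where K = "1 / Im z" and t = t and s = s])
    show "F \<in> borel_measurable path_space"
      unfolding F_def using measurable_masked[OF z h(1)] by measurable
    show "\<bar>F x\<bar> \<le> 1 / Im z" for x
    proof -
      have "\<bar>F x\<bar> \<le> cmod (\<zeta> * gram_stieltjes N n z (mask J (cols h N x)))"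
        unfolding F_def J_def by (rule abs_Re_le_cmod)
      also have "\<dots> \<le> 1 / Im z" using norm_gram_stieltjes_le[OF z] \<zeta> by (simp add: norm_mult)
      finally show ?thesis .
    qed
    show "osc_le F {t L<..} 0"
    proof (rule F_osc0, rule subsetI)
      fix l assume "l \<in> reading_columns J n N m {t L<..}"
      then obtain j where l: "l \<in> J" "l < n" "j \<in> {t L<..}" "int (l * N) + 1 - int m \<le> j"
          "j \<le> int (l * N) + int N + int m" by blast
      have "j \<le> s L" using l n by (intro right[of l]) auto
      then show "l \<in> {}" using l(3) st(1)[of L] by simp
    qed
    show "osc_le F {..t 0} ?c"
    proof (rule F_osc[of _ "{..<r}"], rule subsetI)
      fix l assume "l \<in> reading_columns J n N m {..t 0}"
      then obtain j where l: "l \<in> J" "l < n" "j \<in> {..t 0}" "int (l * N) + 1 - int m \<le> j"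
          "j \<le> int (l * N) + int N + int m" by blast
      then show "l \<in> {..<r}" using left[of l j 0] by simp
    qed auto
    show "osc_le F {t k<..t (Suc k)} ?c" for k
    proof (rule F_osc[of _ "{Suc k * r..<Suc (Suc k) * r}"], rule subsetI)
      fix l assume "l \<in> reading_columns J n N m {t k<..t (Suc k)}"
      then obtain j where l: "l \<in> J" "l < n" "j \<in> {t k<..t (Suc k)}" "int (l * N) + 1 - int m \<le> j"
          "j \<le> int (l * N) + int N + int m" by blast
      have "l < Suc (Suc k) * r" using left[of l j "Suc k"] l by simp
      moreover have "\<not> l < Suc k * r"
      proof
        assume "l < Suc k * r"
        then have "j \<le> s k" using l by (intro right[of l]) auto
        then show False using st(1)[of k] l(3) by simp
      qed
      ultimately show "l \<in> {Suc k * r..<Suc (Suc k) * r}" by simp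
    qed auto
    show "osc_le F {s k<..t k} 0" for k
    proof (rule F_osc0, rule subsetI)
      fix l assume "l \<in> reading_columns J n N m {s k<..t k}"
      then obtain j where l: "l \<in> J" "l < n" "j \<in> {s k<..t k}" "int (l * N) + 1 - int m \<le> j"
          "j \<le> int (l * N) + int N + int m" by blast
      have "l < Suc k * r" using left[of l j k] l by simp
      then have "j \<le> s k" using l by (intro right[of l]) auto
      then show "l \<in> {}" using l(3) by simp
    qed
    show "gap_mixing path_law (s k) (t k) b" for k
      using gap_mixing_path_law[OF st(1)[of k]] unfolding st(2) b_def .
  qed fact+
qed

text \<open>An erased column is determined by its block and its place among the last
  \<open>q\<close> slots there, so \<open>B * q\<close> pairs cover all of them.\<close>

lemma card_removed_columns:
  assumes "n \<le> B * r" "q < r"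
  shows "card {l. l < n \<and> \<not> l mod r + q < r} \<le> B * (q :: nat)"
proof -
  have "{l. l < n \<and> \<not> l mod r + q < r} \<subseteq> (\<lambda>(a, b). a * r + (r - q + b)) ` ({..<B} \<times> {..<q})"
  proof
    fix l assume "l \<in> {l. l < n \<and> \<not> l mod r + q < r}"
    then have l: "l < B * r" "r \<le> l mod r + q" using assms by auto
    have "l mod r < r" using assms by simp
    have "l mod r - (r - q) < q" using l \<open>l mod r < r\<close> assms(2) by linarith
    then have "(l div r, l mod r - (r - q)) \<in> {..<B} \<times> {..<q}"
      using l(1) by (simp add: less_mult_imp_div_less)
    moreover have "l = (l div r) * r + (r - q + (l mod r - (r - q)))"
      using l assms(2) by simp
    ultimately show "l \<in> (\<lambda>(a, b). a * r + (r - q + b)) ` ({..<B} \<times> {..<q})"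
      by (intro image_eqI[where x = "(l div r, l mod r - (r - q))"]) auto
  qed
  then have "card {l. l < n \<and> \<not> l mod r + q < r} \<le> card ((\<lambda>(a, b). a * r + (r - q + b)) ` ({..<B} \<times> {..<q}))"
    by (intro card_mono) auto
  also have "\<dots> \<le> card ({..<B} \<times> {..<q})" by (rule card_image_le) auto
  finally show ?thesis by simp
qed

text \<open>The tail bound is one-sided and real; four rotations recover the modulus. The factor 2
  comes from adding the bounds for the real and imaginary parts.\<close>

lemma cmod_le_of_Re_mult:
  assumes "\<And>\<zeta>. \<zeta> \<in> {1, -1, \<i>, -\<i>} \<Longrightarrow> Re (\<zeta> * w) \<le> a"
  shows "cmod w \<le> 2 * a"
proof -
  have "Re w \<le> a" "- Re w \<le> a" "- Im w \<le> a" "Im w \<le> a"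
    using assms[of 1] assms[of "-1"] assms[of \<i>] assms[of "-\<i>"] by auto
  then have "\<bar>Re w\<bar> \<le> a" "\<bar>Im w\<bar> \<le> a" by auto
  then show ?thesis using cmod_le[of w] by linarith
qed

context path_measure
begin

lemma integrable_cmod_bounded:
  fixes f :: "(int \<Rightarrow> real) \<Rightarrow> complex"
  assumes "f \<in> borel_measurable path_space" "\<And>x. cmod (f x) \<le> K"
  shows "integrable \<mu> f"
  using assms by (intro integrable_const_bound[of _ K]) (auto simp: measurable_cong_sets[OF sets_mu refl])

lemma cmod_integral_diff_le:
  fixes f g :: "(int \<Rightarrow> real) \<Rightarrow> complex"
  assumes "integrable \<mu> f" "integrable \<mu> g" "integrable \<mu> w" "\<And>x. cmod (f x - g x) \<le> w x"
  shows "cmod ((\<integral>x. f x \<partial>\<mu>) - (\<integral>x. g x \<partial>\<mu>)) \<le> (\<integral>x. w x \<partial>\<mu>)"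
proof -
  have "cmod ((\<integral>x. f x \<partial>\<mu>) - (\<integral>x. g x \<partial>\<mu>)) = cmod (\<integral>x. f x - g x \<partial>\<mu>)"
    using assms by simp
  also have "\<dots> \<le> (\<integral>x. cmod (f x - g x) \<partial>\<mu>)" by (rule integral_norm_bound)
  also have "\<dots> \<le> (\<integral>x. w x \<partial>\<mu>)"
    using assms by (intro integral_mono) auto
  finally show ?thesis .
qed

end

text \<open>Given the accuracy \<open>e\<close>, \<open>D\<close> is taken large enough to make the
  erasure harmless and \<open>A\<close> is set to make the tail summable. Both make
  \<open>\<kappa>\<close> small, which is allowed because \<open>summable_condensed\<close> holds
  for every positive \<open>\<kappa>\<close>.\<close>

lemma (in process) window_concentration:
  fixes h :: "(int \<Rightarrow> real) \<Rightarrow> real" and N :: "nat \<Rightarrow> nat" and c \<alpha> e :: real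
  assumes z: "Im z > 0" and h: "h \<in> borel_measurable path_space" "finite_window m h"
    and c: "c > 0" and lim: "(\<lambda>n. real (N n) / real n) \<longlonglongrightarrow> c"
    and \<alpha>: "\<alpha> > 1"
    and sm: "summable (\<lambda>n. ln (real (Suc n)) powr (3 * \<alpha> / 2) * real (Suc n) powr (-1/2)
                        * beta_mixing M eps (Suc n))"
    and e: "e > 0"
  defines "Y \<equiv> \<lambda>n x. gram_stieltjes (N n) n z (cols h (N n) x)"
  shows "AE x in path_law. eventually (\<lambda>n. cmod (Y n x - (\<integral>x. Y n x \<partial>path_law)) \<le> e) sequentially"
proof -
  define v where "v = Im z"
  have v: "v > 0" using z by (simp add: v_def)
  obtain D0 :: nat where D0: "32 / (c * v * e) < real D0" using reals_Archimedean2 by blast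
  define D where "D = max 2 D0"
  have D2: "D \<ge> 2" by (simp add: D_def)
  have De: "8 / (c * real D) / v \<le> e / 4"
  proof -
    have "32 / (c * v * e) \<le> real D" using D0 by (simp add: D_def)
    then have "32 \<le> real D * (c * v * e)" using c v e by (simp add: field_simps)
    then show ?thesis using c v e D2 by (simp add: field_simps)
  qed
  \<comment> \<open>The four directions together will give \<open>4 * \<tau> = e / 4\<close>;
    erasing costs another \<open>e / 4\<close> for the transform and \<open>e / 4\<close> for its
    mean.\<close>
  define \<tau> where "\<tau> = e / 16"
  have \<tau>: "\<tau> > 0" using e by (simp add: \<tau>_def)
  \<comment> \<open>This value turns the McDiarmid exponent into \<open>-2 ln n\<close>.\<close>
  define A where "A = 64 / (\<tau>\<^sup>2 * v\<^sup>2 * c\<^sup>2)"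
  have A: "A > 0" using \<tau> v c by (simp add: A_def)
  define \<kappa> where "\<kappa> = c / (8 * real D * A)"
  have \<kappa>: "\<kappa> > 0" using c A D2 by (simp add: \<kappa>_def)
  define B where "B n = nat \<lceil>A * ln (real n)\<rceil>" for n :: nat
  define r where "r n = n div B n + 1" for n
  define q where "q n = r n div D + 1" for n
  define P where "P n = nat \<lfloor>\<kappa> * (real n)\<^sup>2 / ln (real n)\<rfloor>" for n :: nat
  define R where "R n = 2 * A * (ln (real n) * beta_mixing M eps (P n))" for n
  have "summable (\<lambda>n. ln (real n) * beta_mixing M eps (P n))"
    unfolding P_def by (rule summable_condensed[OF beta_mixing_nonneg beta_mixing_antimono sm \<kappa> \<alpha>])
  then have R: "summable R" unfolding R_def by (rule summable_mult)
  \<comment> \<open>\<open>R\<close> bounds the number of gaps times their mixing coefficient. Its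
    summability feeds Borel-Cantelli; its smallness keeps the shift of the mean under decoupling
    below \<open>\<tau>\<close>.\<close>
  have R_small: "eventually (\<lambda>n. R n < \<tau> * v / 2) sequentially"
    using summable_LIMSEQ_zero[OF R] \<tau> v by (intro order_tendstoD) auto
  note params = block_parameters[OF lim c A D2, of m, folded B_def, folded r_def, folded q_def, folded \<kappa>_def, folded P_def]
  define Y' where "Y' n x = gram_stieltjes (N n) n z (mask {l. l mod r n + q n < r n} (cols h (N n) x))" for n x
  have Y'_meas: "Y' n \<in> borel_measurable path_space" for n
    unfolding Y'_def by (rule measurable_masked[OF z h(1)])
  have Y_meas: "Y n \<in> borel_measurable path_space" for n
    unfolding Y_def by (rule measurable_gram_stieltjes[OF z]) (rule measurable_cols[OF h(1)])
  have Y_int: "integrable path_law (Y n)" "integrable path_law (Y' n)" for n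
    using Y_meas Y'_meas norm_gram_stieltjes_le[OF z]
    by (auto intro!: path.integrable_cmod_bounded[of _ "1 / Im z"] simp: Y_def Y'_def)
  define EY where "EY n = (\<integral>x. Y n x \<partial>path_law)" for n
  define EY' where "EY' n = (\<integral>x. Y' n x \<partial>path_law)" for n
  have close: "eventually (\<lambda>n. \<forall>x. cmod (Y n x - Y' n x) \<le> e / 4) sequentially"
    using params
  proof eventually_elim
    case (elim n)
    show ?case
    proof
      fix x
      let ?K = "{l. l < n \<and> \<not> l mod r n + q n < r n}"
      have "cmod (Y n x - Y' n x) \<le> 2 * real (card ?K) / (real (N n) * v)"
        unfolding Y_def Y'_def v_def
        by (rule gram_stieltjes_change_columns[OF z]) (auto simp: mask_def)
      also have "\<dots> \<le> 2 * real (B n * q n) / (real (N n) * v)"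
        using elim v by (intro divide_right_mono mult_left_mono of_nat_mono card_removed_columns) auto
      also have "\<dots> = 2 * real (B n * q n) / real (N n) / v" by simp
      also have "\<dots> \<le> 8 / (c * real D) / v"
        using elim v by (intro divide_right_mono) auto
      finally show "cmod (Y n x - Y' n x) \<le> e / 4" using De by linarith
    qed
  qed
  have tail: "AE x in path_law. eventually (\<lambda>n. Re (\<zeta> * (Y' n x - EY' n)) \<le> 2 * \<tau>) sequentially"
    if \<zeta>: "cmod \<zeta> = 1" for \<zeta>
  proof -
    define F where "F n x = Re (\<zeta> * Y' n x)" for n x
    have F_meas[measurable]: "F n \<in> borel_measurable path_space" for n
      unfolding F_def using Y'_meas by measurable
    have EF: "(\<integral>x. F n x \<partial>path_law) = Re (\<zeta> * EY' n)" for n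
      unfolding F_def EY'_def using Y_int(2)[of n]
      by (simp add: integral_bounded_linear[OF bounded_linear_Re])
    define Bad where "Bad n = {x. F n x \<ge> (\<integral>x. F n x \<partial>path_law) + 2 * \<tau>}" for n
    have Bad: "Bad n \<in> sets path_law" for n
      using measurable_sets[OF F_meas[of n], of "{(\<integral>x. F n x \<partial>path_law) + 2 * \<tau>..}"]
      by (simp add: Bad_def vimage_def space_path_space)
    have "eventually (\<lambda>n. path.prob (Bad n) \<le> 1 / (real n)\<^sup>2 + R n) sequentially"
      using params R_small
    proof eventually_elim
      case (elim n)
      then have el: "n > 1" "B n > 0" "n \<le> B n * r n" "q n < r n" "N n > 0" "2 * m \<le> q n * N n"
        "P n \<le> q n * N n - 2 * m + 1" "1 \<le> \<kappa> * (real n)\<^sup>2 / ln (real n)"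
        "A * c\<^sup>2 / 16 * ln (real n) \<le> (real (N n))\<^sup>2 / (real (B n) * (real (r n))\<^sup>2)"
        "real (B n) \<le> 2 * A * ln (real n)" "R n < \<tau> * v / 2" by auto
      define L where "L = B n - 1"
      have L: "Suc L = B n" using el by (simp add: L_def)
      define b where "b = beta_mixing M eps (q n * N n - 2 * m + 1)"
      have P0: "P n > 0" using el(8) unfolding P_def by linarith
      have b: "0 \<le> b" "b \<le> beta_mixing M eps (P n)"
        unfolding b_def using P0 el(7) by (auto intro: beta_mixing_nonneg beta_mixing_antimono)
      have LR: "real L * b \<le> R n"
      proof -
        have "real L * b \<le> (2 * A * ln (real n)) * beta_mixing M eps (P n)"
          using b el(10) L by (intro mult_mono) auto
        then show ?thesis by (simp add: R_def mult_ac)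
      qed
      have "real L * (2 * (1 / Im z) * b) = 2 / v * (real L * b)" by (simp add: v_def)
      also have "\<dots> \<le> 2 / v * (\<tau> * v / 2)" using LR el(11) v by (intro mult_left_mono) auto
      also have "\<dots> = \<tau>" using v by simp
      finally have small: "real L * (2 * (1 / Im z) * b) \<le> \<tau>" .
      define c0 where "c0 = 2 * real (r n) / (real (N n) * v)"
      have c0: "c0 > 0" using el v by (simp add: c0_def)
      \<comment> \<open>The minimiser of the exponent, which is quadratic in \<open>l\<close>; the
        minimum is \<open>- 2 * \<tau>^2 / (B n * c0^2)\<close>.\<close>
      define l where "l = 4 * \<tau> / (real (B n) * c0\<^sup>2)"
      have l: "l > 0" using \<tau> el c0 by (simp add: l_def)
      have "path.prob (Bad n) \<le> exp (real (Suc L) * (l * c0)\<^sup>2 / 8 - l * \<tau>) + real L * b"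
        using block_concentration[OF z h \<zeta> el(5) _ el(6,4) small[unfolded b_def] l] el(3) L
        by (simp add: Bad_def F_def Y'_def b_def c0_def v_def)
      also have "exp (real (Suc L) * (l * c0)\<^sup>2 / 8 - l * \<tau>) \<le> 1 / (real n)\<^sup>2"
      proof -
        have "real (Suc L) * (l * c0)\<^sup>2 / 8 - l * \<tau> = - 2 * \<tau>\<^sup>2 / (real (B n) * c0\<^sup>2)"
          unfolding L l_def using el(2) c0 by (simp add: power2_eq_square field_simps)
        also have "\<dots> = - (\<tau>\<^sup>2 * v\<^sup>2 / 2) * ((real (N n))\<^sup>2 / (real (B n) * (real (r n))\<^sup>2))"
          unfolding c0_def using el(2,4,5) v by (simp add: power2_eq_square field_simps)
        also have "\<dots> \<le> - (\<tau>\<^sup>2 * v\<^sup>2 / 2) * (A * c\<^sup>2 / 16 * ln (real n))"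
          by (intro mult_left_mono_neg el(9)) simp
        also have "\<dots> = - 2 * ln (real n)"
          unfolding A_def using \<tau> v c by (simp add: field_simps power2_eq_square)
        finally have "exp (real (Suc L) * (l * c0)\<^sup>2 / 8 - l * \<tau>) \<le> exp (- 2 * ln (real n))" by simp
        also have "\<dots> = 1 / (real n)\<^sup>2"
          using el(1) by (simp add: exp_minus exp_double power2_eq_square inverse_eq_divide)
        finally show ?thesis .
      qed
      finally show "path.prob (Bad n) \<le> 1 / (real n)\<^sup>2 + R n" using LR by linarith
    qed
    moreover have "summable (\<lambda>n. 1 / (real n)\<^sup>2 + R n)"
      using inverse_power_summable[of 2, where 'a = real] R
      by (intro summable_add) (auto simp: inverse_eq_divide)
    ultimately have "summable (\<lambda>n. path.prob (Bad n))"
      using summable_comparison_test_ev[of "\<lambda>n. path.prob (Bad n)" "\<lambda>n. 1 / (real n)\<^sup>2 + R n"] by simp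
    then have "AE x in path_law. eventually (\<lambda>n. x \<in> space path_law - Bad n) sequentially"
      using Bad by (intro borel_cantelli_AE1) (auto simp: path.emeasure_eq_measure)
    then show ?thesis
    proof (rule AE_mp, intro AE_I2 impI)
      fix x assume "eventually (\<lambda>n. x \<in> space path_law - Bad n) sequentially"
      then show "eventually (\<lambda>n. Re (\<zeta> * (Y' n x - EY' n)) \<le> 2 * \<tau>) sequentially"
      proof eventually_elim
        case (elim n)
        then have "F n x < Re (\<zeta> * EY' n) + 2 * \<tau>" by (simp add: Bad_def EF)
        then show ?case by (simp add: F_def algebra_simps)
      qed
    qed
  qed
  have "AE x in path_law. \<forall>\<zeta>\<in>{1, -1, \<i>, -\<i>}. eventually (\<lambda>n. Re (\<zeta> * (Y' n x - EY' n)) \<le> 2 * \<tau>) sequentially"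
  proof (rule AE_finite_allI)
    fix \<zeta> :: complex assume "\<zeta> \<in> {1, -1, \<i>, -\<i>}"
    then have "cmod \<zeta> = 1" by auto
    then show "AE x in path_law. eventually (\<lambda>n. Re (\<zeta> * (Y' n x - EY' n)) \<le> 2 * \<tau>) sequentially" by (rule tail)
  qed simp
  then show ?thesis
  proof (rule AE_mp, intro AE_I2 impI)
    fix x assume "\<forall>\<zeta>\<in>{1, -1, \<i>, -\<i>}. eventually (\<lambda>n. Re (\<zeta> * (Y' n x - EY' n)) \<le> 2 * \<tau>) sequentially"
    then have "eventually (\<lambda>n. \<forall>\<zeta>\<in>{1, -1, \<i>, -\<i>}. Re (\<zeta> * (Y' n x - EY' n)) \<le> 2 * \<tau>) sequentially"
      by (intro eventually_ball_finite) auto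
    then show "eventually (\<lambda>n. cmod (Y n x - (\<integral>x. Y n x \<partial>path_law)) \<le> e) sequentially"
      using close
    proof eventually_elim
      case (elim n)
      have "cmod (Y' n x - EY' n) \<le> 2 * (2 * \<tau>)" using elim(1) by (intro cmod_le_of_Re_mult) blast
      moreover have "cmod (Y n x - Y' n x) \<le> e / 4" using elim(2) by blast
      moreover have "cmod (EY n - EY' n) \<le> e / 4"
        using path.cmod_integral_diff_le[OF Y_int, of "\<lambda>_. e / 4" n n] elim(2)
        by (simp add: EY_def EY'_def path.prob_space[simplified])
      moreover have "cmod (Y n x - EY n) \<le> cmod (Y n x - Y' n x) + cmod (Y' n x - EY' n) + cmod (EY n - EY' n)"
        using norm_triangle_ineq[of "Y n x - Y' n x" "Y' n x - EY' n"]
          norm_triangle_ineq4[of "Y n x - EY' n" "EY n - EY' n"] by simp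
      ultimately have "cmod (Y n x - EY n) \<le> e" using e by (simp add: \<tau>_def)
      then show ?case by (simp add: EY_def)
    qed
  qed
qed

section \<open>Almost sure convergence\<close>

text \<open>The matrix is filled column by column along the process, so a sum over its entries is
  one orbit sum of length \<open>n * N\<close>, the kind that a maximal inequality controls.\<close>

lemma sum_blocks:
  fixes f :: "nat \<Rightarrow> 'a :: comm_monoid_add"
  shows "(\<Sum>l<n. \<Sum>i<N. f (l * N + i)) = (\<Sum>k<n * N. f k)"
proof -
  have "(\<Sum>i<N. f (l * N + i)) = sum f {l * N..<l * N + N}" for l
    using sum.shift_bounds_nat_ivl[of f 0 "l * N" N] by (simp add: lessThan_atLeast0 add.commute)
  then show ?thesis by (simp add: sum.nat_group)
qed

lemma stieltjes_Xproc:
  "stieltjes (B_matrix (Xproc g eps) N n \<omega>) z = gram_stieltjes N n z (cols g N (\<lambda>i. eps i \<omega>))"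
  unfolding stieltjes_B_matrix cols_def Xproc_def shift_def ..

lemma gram_stieltjes_cols_diff_le:
  assumes z: "Im z > 0" and \<theta>: "\<theta> > 0"
  shows "cmod (gram_stieltjes N n z (cols g N x) - gram_stieltjes N n z (cols h N x))
    \<le> (\<theta> * (\<Sum>k<n * N. (g (shift (1 + int k) x))\<^sup>2)
       + (1 + 1 / \<theta>) * (\<Sum>k<n * N. (g (shift (1 + int k) x) - h (shift (1 + int k) x))\<^sup>2))
        / (real n * real N) / (Im z)\<^sup>2"
proof -
  have "(\<Sum>l<n. \<Sum>i<N. (cols g N x l i)\<^sup>2) = (\<Sum>k<n * N. (g (shift (1 + int k) x))\<^sup>2)"
    using sum_blocks[of "\<lambda>k. (g (shift (1 + int k) x))\<^sup>2" N n] by (simp add: cols_def algebra_simps)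
  moreover have "(\<Sum>l<n. \<Sum>i<N. (cols g N x l i - cols h N x l i)\<^sup>2)
      = (\<Sum>k<n * N. (g (shift (1 + int k) x) - h (shift (1 + int k) x))\<^sup>2)"
    using sum_blocks[of "\<lambda>k. (g (shift (1 + int k) x) - h (shift (1 + int k) x))\<^sup>2" N n]
    by (simp add: cols_def algebra_simps)
  ultimately show ?thesis
    using gram_stieltjes_diff_le[OF z \<theta>, of N n "cols g N x" "cols h N x"] by simp
qed

lemma shift_funpow: "(shift 1 ^^ k) x = shift (int k) x"
  by (induction k) (auto simp: shift_def fun_eq_iff algebra_simps)

locale stationary_process = process +
  assumes stationary: "strictly_stationary M eps"
begin

lemma distr_shift: "distr path_law path_space (shift k) = path_law"
proof -
  have "distr path_law path_space (shift k) = distr M path_space (shift k \<circ> (\<lambda>\<omega> i. eps i \<omega>))"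
    unfolding path_law_def by (rule distr_distr) measurable
  also have "shift k \<circ> (\<lambda>\<omega> i. eps i \<omega>) = (\<lambda>\<omega> i. eps (i + k) \<omega>)"
    by (auto simp: fun_eq_iff shift_def add.commute)
  also have "distr M path_space (\<lambda>\<omega> i. eps (i + k) \<omega>) = path_law"
    using stationary by (simp add: strictly_stationary_def path_law_def)
  finally show ?thesis .
qed

lemma measurable_shift_law: "shift k \<in> measurable path_law path_space" "shift k \<in> measurable path_law path_law"
  using measurable_shift by (simp_all add: measurable_cong_sets[OF sets_path_law refl] measurable_cong_sets[OF refl sets_path_law])

lemma integral_shift:
  fixes Z :: "(int \<Rightarrow> real) \<Rightarrow> real"
  assumes Z: "integrable path_law Z"
  shows "(\<integral>x. Z (shift k x) \<partial>path_law) = (\<integral>x. Z x \<partial>path_law)"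
    and "integrable path_law (\<lambda>x. Z (shift k x))"
proof -
  have m: "Z \<in> borel_measurable path_space"
    using borel_measurable_integrable[OF Z] by (simp add: measurable_cong_sets[OF sets_path_law refl])
  show "(\<integral>x. Z (shift k x) \<partial>path_law) = (\<integral>x. Z x \<partial>path_law)"
    using integral_distr[OF measurable_shift_law(1) m, of k] by (simp add: distr_shift)
  show "integrable path_law (\<lambda>x. Z (shift k x))"
    by (rule integrable_distr[OF measurable_shift_law(1)]) (simp add: distr_shift Z)
qed

text \<open>Hopf's inequality for \<open>Z\<close> after one shift, because the matrix entries start
  at time 1; stationarity removes the extra shift from the integral.\<close>

lemma maximal_path:
  fixes Z :: "(int \<Rightarrow> real) \<Rightarrow> real"
  assumes Z: "integrable path_law Z" "\<And>x. 0 \<le> Z x" and l: "l > 0"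
  defines "E \<equiv> {x. \<exists>K. (\<Sum>k<K. Z (shift (1 + int k) x)) > l * real K}"
  shows "E \<in> sets path_law" "path.prob E \<le> (\<integral>x. Z x \<partial>path_law) / l"
proof -
  have [measurable]: "Z \<in> borel_measurable path_space"
    using borel_measurable_integrable[OF Z(1)] by (simp add: measurable_cong_sets[OF sets_path_law refl])
  have "(\<lambda>x. Z (shift k x)) \<in> borel_measurable path_law" for k
    by measurable
  then have "{x \<in> space path_law. \<exists>K. (\<Sum>k<K. Z (shift (1 + int k) x)) > l * real K} \<in> sets path_law"
    by measurable
  then show "E \<in> sets path_law" by (simp add: E_def)
  have "shift 1 ((shift 1 ^^ k) x) = shift (1 + int k) x" for k x
    unfolding shift_funpow by (auto simp: shift_def fun_eq_iff algebra_simps)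
  then have "Z (shift 1 ((shift 1 ^^ k) x)) = Z (shift (1 + int k) x)" for k x
    by (simp only:)
  moreover have "distr path_law path_law (shift 1) = path_law"
    using distr_shift[of 1] distr_cong[OF refl sets_path_law, of path_law "shift 1" "shift 1"] by simp
  moreover have "(\<integral>x. Z (shift 1 x) \<partial>path_law) = (\<integral>x. Z x \<partial>path_law)" "integrable path_law (\<lambda>x. Z (shift 1 x))"
    using integral_shift[OF Z(1)] by auto
  ultimately show "path.prob E \<le> (\<integral>x. Z x \<partial>path_law) / l"
    using hopf_maximal_inequality[OF path.prob_space_axioms measurable_shift_law(2), of 1 "\<lambda>x. Z (shift 1 x)" l] Z(2) l
    by (simp add: E_def)
qed

text \<open>Let the level in the maximal inequality tend to infinity. Boundedness of the averages,
  without convergence, suffices where they are multiplied by a small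
  \<open>\<theta>\<close>.\<close>

lemma AE_bounded_averages:
  fixes Z :: "(int \<Rightarrow> real) \<Rightarrow> real"
  assumes Z: "integrable path_law Z" "\<And>x. 0 \<le> Z x"
  shows "AE x in path_law. \<exists>C. \<forall>K. (\<Sum>k<K. Z (shift (1 + int k) x)) \<le> C * real K"
proof -
  define E where "E l = {x. \<exists>K. (\<Sum>k<K. Z (shift (1 + int k) x)) > real (Suc l) * real K}" for l
  have E: "E l \<in> sets path_law" "path.prob (E l) \<le> (\<integral>x. Z x \<partial>path_law) / real (Suc l)" for l
    unfolding E_def by (rule maximal_path[OF Z], simp)+
  have "path.prob (\<Inter>l. E l) \<le> 0"
  proof (rule LIMSEQ_le_const)
    show "(\<lambda>l. (\<integral>x. Z x \<partial>path_law) / real (Suc l)) \<longlonglongrightarrow> 0"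
      using tendsto_mult_right_zero[OF LIMSEQ_inverse_real_of_nat] by (simp add: divide_inverse)
    have "path.prob (\<Inter>l. E l) \<le> path.prob (E l)" for l
      using E by (intro path.finite_measure_mono) auto
    then show "\<exists>n0. \<forall>n\<ge>n0. path.prob (\<Inter>l. E l) \<le> (\<integral>x. Z x \<partial>path_law) / real (Suc n)"
      using E(2) order_trans by blast
  qed
  then have "path.prob (\<Inter>l. E l) = 0" by (simp add: measure_le_0_iff)
  then have "AE x in path_law. x \<notin> (\<Inter>l. E l)"
    using E by (intro AE_not_in) (auto simp: null_sets_def path.emeasure_eq_measure)
  then show ?thesis
    by (rule AE_mp) (auto intro!: AE_I2 simp: E_def not_less)
qed

text \<open>For a fixed approximation \<open>h s\<close>, \<open>n\<close> tends to infinity first;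
  the error of replacing \<open>g\<close> by \<open>h s\<close> is bounded for all positive
  \<open>n\<close> at once and vanishes as \<open>s\<close> grows. The same error bound, integrated,
  takes care of the centring.\<close>

lemma concentration:
  fixes g :: "(int \<Rightarrow> real) \<Rightarrow> real" and N :: "nat \<Rightarrow> nat" and c \<alpha> :: real
  assumes z: "Im z > 0" and g: "sq_integrable path_law g"
    and N: "\<And>n. N n > 0"
    and c: "c > 0" and lim: "(\<lambda>n. real (N n) / real n) \<longlonglongrightarrow> c"
    and \<alpha>: "\<alpha> > 1"
    and sm: "summable (\<lambda>n. ln (real (Suc n)) powr (3 * \<alpha> / 2) * real (Suc n) powr (-1/2)
                        * beta_mixing M eps (Suc n))"
  defines "Y \<equiv> \<lambda>g n x. gram_stieltjes (N n) n z (cols g (N n) x)"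
  shows "AE x in path_law. (\<lambda>n. Y g n x - (\<integral>x. Y g n x \<partial>path_law)) \<longlonglongrightarrow> 0"
proof -
  define E where "E h n = (\<integral>x. Y h n x \<partial>path_law)" for h n
  define S where "S Z K x = (\<Sum>k<K. Z (shift (1 + int k) x))" for Z :: "(int \<Rightarrow> real) \<Rightarrow> real" and K :: nat and x
  \<comment> \<open>The rates fit together: a mean square error below \<open>(1/8)^s\<close> lets
    the averages exceed \<open>(1/4)^s\<close> with probability at most \<open>(1/2)^s\<close>,
    which is summable, and \<open>(1/4)^s\<close> divided by \<open>\<theta> s = (1/2)^s\<close> is
    still \<open>(1/2)^s\<close>.\<close>
  have "\<forall>s :: nat. \<exists>m h. h \<in> borel_measurable path_space \<and> finite_window m h \<and> sq_integrable path_law h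
      \<and> (\<integral>x. (g x - h x)\<^sup>2 \<partial>path_law) < (1/8) ^ s"
    using window_approx_sq_integrable[OF path.prob_space_axioms sets_path_law g]
    unfolding window_approx_def by simp
  from choice[OF this] obtain m where "\<forall>s. \<exists>h. h \<in> borel_measurable path_space \<and> finite_window (m s) h
      \<and> sq_integrable path_law h \<and> (\<integral>x. (g x - h x)\<^sup>2 \<partial>path_law) < (1/8) ^ s" ..
  from choice[OF this] obtain h where h: "\<And>s. h s \<in> borel_measurable path_space" "\<And>s. finite_window (m s) (h s)"
    "\<And>s. sq_integrable path_law (h s)" "\<And>s. (\<integral>x. (g x - h s x)\<^sup>2 \<partial>path_law) < (1/8) ^ s"
    by blast
  have gm: "g \<in> borel_measurable path_space"
    using g by (simp add: sq_integrable_def measurable_cong_sets[OF sets_path_law refl])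
  have gi: "integrable path_law (\<lambda>x. (g x)\<^sup>2)" using g by (simp add: sq_integrable_def)
  have di: "integrable path_law (\<lambda>x. (g x - h s x)\<^sup>2)" for s
    using sq_integrable_diff[OF g h(3)] by (simp add: sq_integrable_def)
  have Y_int: "integrable path_law (Y f n)" if "f \<in> borel_measurable path_space" for f n
    unfolding Y_def
    by (intro path.integrable_cmod_bounded[of _ "1 / Im z"] measurable_gram_stieltjes[OF z]
        measurable_cols that norm_gram_stieltjes_le[OF z])
  define G2 where "G2 = (\<integral>x. (g x)\<^sup>2 \<partial>path_law)"
  define \<theta> where "\<theta> s = (1/2 :: real) ^ s" for s :: nat
  have \<theta>: "\<theta> s > 0" "\<theta> s \<le> 1" "\<theta> s * \<theta> s = (1/4) ^ s" "\<theta> s * (1/4) ^ s = (1/8) ^ s" for s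
    by (simp_all add: \<theta>_def power_le_one flip: power_mult_distrib)
  define w where "w s n x = (\<theta> s * S (\<lambda>x. (g x)\<^sup>2) (n * N n) x
      + (1 + 1 / \<theta> s) * S (\<lambda>x. (g x - h s x)\<^sup>2) (n * N n) x) / (real n * real (N n)) / (Im z)\<^sup>2" for s n x
  have diff: "cmod (Y g n x - Y (h s) n x) \<le> w s n x" for s n x
    unfolding Y_def w_def S_def by (rule gram_stieltjes_cols_diff_le[OF z \<theta>(1)])
  have S_int: "integrable path_law (S Z K)" "(\<integral>x. S Z K x \<partial>path_law) = real K * (\<integral>x. Z x \<partial>path_law)"
    if "integrable path_law Z" for Z K
    unfolding S_def using integral_shift[OF that] by (auto simp: that)
  have factor: "(1 + 1 / \<theta> s) * a \<le> 2 * (a / \<theta> s)" if "a \<ge> 0" for a s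
  proof -
    have "1 + 1 / \<theta> s \<le> 2 / \<theta> s" using \<theta>(1,2)[of s] by (simp add: field_simps)
    then show ?thesis using mult_right_mono[OF _ that] by fastforce
  qed
  have E_diff: "cmod (E g n - E (h s) n) \<le> \<theta> s * (G2 + 2) / (Im z)\<^sup>2" if n: "n > 0" for n s
  proof -
    define d where "d = (\<integral>x. (g x - h s x)\<^sup>2 \<partial>path_law)"
    have d: "0 \<le> d" "d \<le> (1/8) ^ s" using h(4)[of s] by (auto simp: d_def)
    have "cmod (E g n - E (h s) n) \<le> (\<integral>x. w s n x \<partial>path_law)"
      unfolding E_def
      using S_int(1)[OF gi] S_int(1)[OF di] diff
      by (intro path.cmod_integral_diff_le Y_int gm h) (auto simp: w_def)
    also have "\<dots> = (\<theta> s * (real (n * N n) * G2) + (1 + 1 / \<theta> s) * (real (n * N n) * d)) / (real n * real (N n)) / (Im z)\<^sup>2"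
      unfolding w_def using S_int[OF gi] S_int[OF di] by (simp add: G2_def d_def)
    also have "\<dots> = (\<theta> s * G2 + (1 + 1 / \<theta> s) * d) / (Im z)\<^sup>2"
    proof -
      have "\<theta> s * (real (n * N n) * G2) + (1 + 1 / \<theta> s) * (real (n * N n) * d)
          = (\<theta> s * G2 + (1 + 1 / \<theta> s) * d) * (real n * real (N n))"
        by (simp add: algebra_simps)
      moreover have "real n * real (N n) \<noteq> 0" using n N[of n] by simp
      ultimately show ?thesis by (metis nonzero_mult_div_cancel_right)
    qed
    also have "\<dots> \<le> (\<theta> s * G2 + \<theta> s * 2) / (Im z)\<^sup>2"
    proof (intro divide_right_mono add_left_mono)
      have "(1 + 1 / \<theta> s) * d \<le> 2 * (d / \<theta> s)" by (rule factor) fact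
      also have "d / \<theta> s \<le> (1/4) ^ s"
        using d(2) \<theta>(1)[of s] by (simp add: divide_le_eq \<theta>(4) mult.commute)
      also have "(1/4) ^ s \<le> \<theta> s" using \<theta>(1,2)[of s] mult_right_mono[of "\<theta> s" 1 "\<theta> s"] unfolding \<theta>(3)[symmetric] by simp
      finally show "(1 + 1 / \<theta> s) * d \<le> \<theta> s * 2" by simp
    qed simp
    finally show ?thesis by (simp add: distrib_left)
  qed
  have AE1: "AE x in path_law. \<forall>s. eventually (\<lambda>n. cmod (Y (h s) n x - E (h s) n) \<le> \<theta> s) sequentially"
    unfolding AE_all_countable Y_def E_def
    by (intro allI window_concentration[OF z h(1,2) c lim \<alpha> sm \<theta>(1)])
  have AE2: "AE x in path_law. \<exists>C. \<forall>K. S (\<lambda>x. (g x)\<^sup>2) K x \<le> C * real K"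
    unfolding S_def by (rule AE_bounded_averages[OF gi]) simp
  have AE3: "AE x in path_law. eventually (\<lambda>s. \<forall>K. S (\<lambda>x. (g x - h s x)\<^sup>2) K x \<le> (1/4) ^ s * real K) sequentially"
  proof -
    define Bad where "Bad s = {x. \<exists>K. (1/4) ^ s * real K < S (\<lambda>x. (g x - h s x)\<^sup>2) K x}" for s
    have Bad: "Bad s \<in> sets path_law" "path.prob (Bad s) \<le> (\<integral>x. (g x - h s x)\<^sup>2 \<partial>path_law) / (1/4) ^ s" for s
      unfolding Bad_def S_def by (rule maximal_path[OF di], simp, simp)+
    have "path.prob (Bad s) \<le> (1/2) ^ s" for s
    proof -
      have "(\<integral>x. (g x - h s x)\<^sup>2 \<partial>path_law) / (1/4) ^ s \<le> (1/8) ^ s / (1/4) ^ s"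
        using h(4)[of s] by (intro divide_right_mono) auto
      also have "\<dots> = (1/2) ^ s" by (simp flip: power_divide)
      finally show ?thesis using Bad(2)[of s] by linarith
    qed
    then have "summable (\<lambda>s. path.prob (Bad s))"
      by (intro summable_comparison_test'[OF summable_geometric[of "1/2 :: real"], of 0]) auto
    then have "AE x in path_law. eventually (\<lambda>s. x \<in> space path_law - Bad s) sequentially"
      using Bad by (intro borel_cantelli_AE1) (auto simp: path.emeasure_eq_measure)
    then show ?thesis
      by (rule AE_mp) (auto intro!: AE_I2 elim!: eventually_mono simp: Bad_def not_less)
  qed
  show ?thesis using AE1 AE2 AE3
  proof eventually_elim
    case (elim x)
    then obtain C where C: "\<And>K. S (\<lambda>x. (g x)\<^sup>2) K x \<le> C * real K" by blast
    define C' where "C' = (C + 2) / (Im z)\<^sup>2 + 1 + (G2 + 2) / (Im z)\<^sup>2"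
    have bound: "eventually (\<lambda>n. cmod (Y g n x - E g n) \<le> \<theta> s * C') sequentially"
      if s: "\<And>K. S (\<lambda>x. (g x - h s x)\<^sup>2) K x \<le> (1/4) ^ s * real K" for s
    proof -
      have w: "w s n x \<le> \<theta> s * ((C + 2) / (Im z)\<^sup>2)" if n: "n > 0" for n
      proof -
        have nN: "real n * real (N n) > 0" using n N[of n] by simp
        have "\<theta> s * S (\<lambda>x. (g x)\<^sup>2) (n * N n) x \<le> \<theta> s * (C * real (n * N n))"
          by (intro mult_left_mono C less_imp_le[OF \<theta>(1)])
        moreover have "(1 + 1 / \<theta> s) * S (\<lambda>x. (g x - h s x)\<^sup>2) (n * N n) x \<le> (1 + 1 / \<theta> s) * ((1/4) ^ s * real (n * N n))"
          using \<theta>(1)[of s] by (intro mult_left_mono s) simp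
        moreover have "(1 + 1 / \<theta> s) * ((1/4) ^ s * real (n * N n)) \<le> 2 * ((1/4) ^ s * real (n * N n) / \<theta> s)"
          by (rule factor) simp
        moreover have "(1/4) ^ s * real (n * N n) / \<theta> s = \<theta> s * real (n * N n)"
          using \<theta>(1)[of s] unfolding \<theta>(3)[symmetric] by simp
        ultimately have "\<theta> s * S (\<lambda>x. (g x)\<^sup>2) (n * N n) x + (1 + 1 / \<theta> s) * S (\<lambda>x. (g x - h s x)\<^sup>2) (n * N n) x
            \<le> \<theta> s * (C + 2) * (real n * real (N n))"
          by (simp add: algebra_simps)
        then have "(\<theta> s * S (\<lambda>x. (g x)\<^sup>2) (n * N n) x + (1 + 1 / \<theta> s) * S (\<lambda>x. (g x - h s x)\<^sup>2) (n * N n) x)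
            / (real n * real (N n)) \<le> \<theta> s * (C + 2)"
          using nN by (simp add: pos_divide_le_eq)
        then show ?thesis unfolding w_def times_divide_eq_right by (intro divide_right_mono) auto
      qed
      have "eventually (\<lambda>n. cmod (Y (h s) n x - E (h s) n) \<le> \<theta> s) sequentially" using elim(1) by blast
      then show ?thesis using eventually_gt_at_top[of 0]
      proof eventually_elim
        case (elim n)
        have "cmod (Y g n x - E g n)
            \<le> cmod (Y g n x - Y (h s) n x) + cmod (Y (h s) n x - E (h s) n) + cmod (E g n - E (h s) n)"
          using norm_triangle_ineq[of "Y g n x - Y (h s) n x" "Y (h s) n x - E (h s) n"]
            norm_triangle_ineq4[of "Y g n x - E (h s) n" "E g n - E (h s) n"] by simp
        also have "\<dots> \<le> \<theta> s * ((C + 2) / (Im z)\<^sup>2) + \<theta> s + \<theta> s * (G2 + 2) / (Im z)\<^sup>2"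
          using diff[of n x s] w[OF elim(2)] elim(1) E_diff[OF elim(2), of s] by linarith
        also have "\<dots> = \<theta> s * C'" by (simp add: C'_def distrib_left)
        finally show ?case .
      qed
    qed
    have "(\<lambda>n. Y g n x - E g n) \<longlonglongrightarrow> 0"
    proof (rule tendstoI)
      fix e :: real assume "e > 0"
      have "(\<lambda>s. \<theta> s * C') \<longlonglongrightarrow> 0 * C'"
        unfolding \<theta>_def by (intro tendsto_mult LIMSEQ_power_zero tendsto_const) simp
      then have "eventually (\<lambda>s. \<theta> s * C' < e) sequentially"
        using \<open>e > 0\<close> by (intro order_tendstoD) auto
      then have "eventually (\<lambda>s. \<theta> s * C' < e \<and> (\<forall>K. S (\<lambda>x. (g x - h s x)\<^sup>2) K x \<le> (1/4) ^ s * real K)) sequentially"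
        using elim(3) by (rule eventually_conj)
      then obtain s where s: "\<theta> s * C' < e" "\<And>K. S (\<lambda>x. (g x - h s x)\<^sup>2) K x \<le> (1/4) ^ s * real K"
        using eventually_happens'[OF sequentially_bot] by blast
      show "eventually (\<lambda>n. dist (Y g n x - E g n) 0 < e) sequentially"
        using bound[OF s(2)] by eventually_elim (use s(1) in simp)
    qed
    then show ?case by (simp add: E_def)
  qed
qed

end

theorem theorem2p1:
  fixes M :: "'a measure" and eps :: "int \<Rightarrow> 'a \<Rightarrow> real"
    and g :: "(int \<Rightarrow> real) \<Rightarrow> real" and N :: "nat \<Rightarrow> nat"
    and c :: real and \<alpha> :: real
  assumes "prob_space M"
    and "\<And>i. eps i \<in> borel_measurable M"
    and "strictly_stationary M eps"
    and "g \<in> borel_measurable (PiM UNIV (\<lambda>_::int. borel))"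
    and "\<And>k. integral\<^sup>L M (Xproc g eps k) = 0"
    and "\<And>k. integrable M (\<lambda>\<omega>. (Xproc g eps k \<omega>)\<^sup>2)"
    and "\<And>n. N n > 0"
    and "c > 0"
    and "(\<lambda>n. real (N n) / real n) \<longlonglongrightarrow> c"
    and "\<alpha> > 1"
    and "summable (\<lambda>n. ln (real (Suc n)) powr (3 * \<alpha> / 2) * real (Suc n) powr (-1/2)
                        * beta_mixing M eps (Suc n))"
  shows "\<forall>z. Im z > 0 \<longrightarrow>
    (AE \<omega> in M. (\<lambda>n. stieltjes (B_matrix (Xproc g eps) (N n) n \<omega>) z
         - integral\<^sup>L M (\<lambda>\<omega>'. stieltjes (B_matrix (Xproc g eps) (N n) n \<omega>') z))
       \<longlonglongrightarrow> 0)"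
proof (intro allI impI)
  fix z :: complex assume z: "Im z > 0"
  interpret stationary_process M eps
    using assms(1-3) by (simp add: stationary_process_def process_def stationary_process_axioms_def process_axioms_def)
  let ?P = "\<lambda>\<omega> i. eps i \<omega>"
  let ?Y = "\<lambda>n x. gram_stieltjes (N n) n z (cols g (N n) x)"
  have "sq_integrable path_law g"
    unfolding sq_integrable_def
  proof
    show "g \<in> borel_measurable path_law" using assms(4) by (simp add: measurable_cong_sets[OF sets_path_law refl])
    have "integrable M (\<lambda>\<omega>. (g (?P \<omega>))\<^sup>2)"
      using assms(6)[of 0] by (simp add: Xproc_def)
    then show "integrable path_law (\<lambda>x. (g x)\<^sup>2)"
      unfolding path_law_def using assms(4) by (subst integrable_distr_eq) (auto intro: measurable_path)
  qed
  then have "AE x in path_law. (\<lambda>n. ?Y n x - (\<integral>x. ?Y n x \<partial>path_law)) \<longlonglongrightarrow> 0"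
    by (rule concentration[OF z _ assms(7-11)])
  \<comment> \<open>The transform depends on \<open>\<omega>\<close> only through the path, so the
    statement for the law of the path pulls back to \<open>M\<close>.\<close>
  then have "AE \<omega> in M. (\<lambda>n. ?Y n (?P \<omega>) - (\<integral>x. ?Y n x \<partial>path_law)) \<longlonglongrightarrow> 0"
    unfolding path_law_def by (rule AE_distrD[OF measurable_path])
  moreover have "(\<integral>x. ?Y n x \<partial>path_law) = (\<integral>\<omega>. ?Y n (?P \<omega>) \<partial>M)" for n
    unfolding path_law_def
    by (rule integral_distr[OF measurable_path measurable_gram_stieltjes[OF z measurable_cols[OF assms(4)]]])
  ultimately show "AE \<omega> in M. (\<lambda>n. stieltjes (B_matrix (Xproc g eps) (N n) n \<omega>) z
         - integral\<^sup>L M (\<lambda>\<omega>'. stieltjes (B_matrix (Xproc g eps) (N n) n \<omega>') z)) \<longlonglongrightarrow> 0"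
    unfolding stieltjes_Xproc by simp
qed

end
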